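(* Let $G$ be a (discrete) group with $\underline{\underline{\mathrm{cd}}}(G)\leq 1$. Then $G$ is locally virtually cyclic, i.e. every finitely generated subgroup of $G$ is virtually cyclic.
   Context: A group is virtually cyclic if it has a cyclic subgroup of finite index (finite groups are included). For a group $G$, let $\mathcal{VC}$ be the family of virtually cyclic subgroups of $G$. The orbit category $\mathcal{O}_{\mathcal{VC}}G$ has as objects the left coset spaces $G/H$ with $H\in\mathcal{VC}$, and as morphisms all $G$-equivariant maps between them. A right $\mathcal{O}_{\mathcal{VC}}G$-module is a contravariant functor from $\mathcal{O}_{\mathcal{VC}}G$ to abelian groups; morphisms of modules are natural transformations, and a sequence of modules is exact if it is exact when evaluated at every object. This abelian category has enough projectives. $\underline{\mathbb{Z}}$ denotes the constant functor with value $\mathbb{Z}$ (all morphisms sent to the identity). The Bredon cohomological dimension $\underline{\underline{\mathrm{cd}}}(G)$ of $G$ for the family $\mathcal{VC}$ is the shortest length of a projective resolution of $\underline{\mathbb{Z}}$ in the category of right $\mathcal{O}_{\mathcal{VC}}G$-modules ($\infty$ if there is no finite one). *)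

theory Defs
  imports "HOL-Algebra.Algebra" "HOL-Algebra.Left_Coset" "HOL-Library.Extended_Nat"
begin

section \<open>Virtually cyclic groups\<close>

definition virtually_cyclic :: "('g, 'x) monoid_scheme \<Rightarrow> bool" where
  "virtually_cyclic G \<longleftrightarrow>
     (\<exists>C. subgroup C G \<and> cyclic_group (G\<lparr>carrier := C\<rparr>) \<and> finite (lcosets\<^bsub>G\<^esub> C))"

definition VC :: "('g, 'x) monoid_scheme \<Rightarrow> 'g set set" where
  "VC G = {H. subgroup H G \<and> virtually_cyclic (G\<lparr>carrier := H\<rparr>)}"

definition finitely_generated_subgroup :: "'g set \<Rightarrow> ('g, 'x) monoid_scheme \<Rightarrow> bool" where
  "finitely_generated_subgroup H G \<longleftrightarrow>
     subgroup H G \<and> (\<exists>A. finite A \<and> A \<subseteq> carrier G \<and> H = generate G A)"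

definition locally_virtually_cyclic :: "('g, 'x) monoid_scheme \<Rightarrow> bool" where
  "locally_virtually_cyclic G \<longleftrightarrow>
     (\<forall>H. finitely_generated_subgroup H G \<longrightarrow> virtually_cyclic (G\<lparr>carrier := H\<rparr>))"


section \<open>The orbit category\<close>

definition orbit_objects :: "('g, 'x) monoid_scheme \<Rightarrow> 'g set set set" where
  "orbit_objects G = {lcosets\<^bsub>G\<^esub> H | H. H \<in> VC G}"

text \<open>Equivariant maps are extensional functions, so that equality of morphisms is equality in HOL.
  The action of \<open>g\<close> on a coset \<open>x\<close> is \<open>g <#\<^bsub>G\<^esub> x\<close>.\<close>

definition orbit_hom ::
  "('g, 'x) monoid_scheme \<Rightarrow> 'g set set \<Rightarrow> 'g set set \<Rightarrow> ('g set \<Rightarrow> 'g set) set" where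
  "orbit_hom G S T =
     {f \<in> S \<rightarrow>\<^sub>E T. \<forall>g\<in>carrier G. \<forall>x\<in>S. f (g <#\<^bsub>G\<^esub> x) = g <#\<^bsub>G\<^esub> f x}"


section \<open>Right modules over the orbit category\<close>

text \<open>\<open>res M S T f\<close> is the homomorphism from \<open>val M T\<close> to \<open>val M S\<close> induced by \<open>f : S \<rightarrow> T\<close>.  The
  values are abelian groups, written multiplicatively as everywhere in HOL-Algebra, whose
  elements have type \<open>'m\<close>.\<close>

record ('g, 'm) orbit_functor =
  val :: "'g set set \<Rightarrow> 'm monoid"
  res :: "'g set set \<Rightarrow> 'g set set \<Rightarrow> ('g set \<Rightarrow> 'g set) \<Rightarrow> 'm \<Rightarrow> 'm"

definition right_module :: "('g, 'x) monoid_scheme \<Rightarrow> ('g, 'm) orbit_functor \<Rightarrow> bool" where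
  "right_module G M \<longleftrightarrow>
     (\<forall>S\<in>orbit_objects G. comm_group (val M S)) \<and>
     (\<forall>S\<in>orbit_objects G. \<forall>T\<in>orbit_objects G. \<forall>f\<in>orbit_hom G S T.
        res M S T f \<in> hom (val M T) (val M S)) \<and>
     (\<forall>S\<in>orbit_objects G. \<forall>m\<in>carrier (val M S). res M S S (\<lambda>x\<in>S. x) m = m) \<and>
     (\<forall>S\<in>orbit_objects G. \<forall>T\<in>orbit_objects G. \<forall>U\<in>orbit_objects G.
        \<forall>f\<in>orbit_hom G S T. \<forall>h\<in>orbit_hom G T U. \<forall>m\<in>carrier (val M U).
          res M S U (compose S h f) m = res M S T f (res M T U h m))"

definition module_hom ::
  "('g, 'x) monoid_scheme \<Rightarrow> ('g, 'm) orbit_functor \<Rightarrow> ('g, 'n) orbit_functor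
     \<Rightarrow> ('g set set \<Rightarrow> 'm \<Rightarrow> 'n) set" where
  "module_hom G M N =
     {\<eta>. (\<forall>S\<in>orbit_objects G. \<eta> S \<in> hom (val M S) (val N S)) \<and>
         (\<forall>S\<in>orbit_objects G. \<forall>T\<in>orbit_objects G. \<forall>f\<in>orbit_hom G S T. \<forall>m\<in>carrier (val M T).
            \<eta> S (res M S T f m) = res N S T f (\<eta> T m))}"

definition exact_at ::
  "('g, 'x) monoid_scheme \<Rightarrow> ('g, 'l) orbit_functor \<Rightarrow> ('g set set \<Rightarrow> 'l \<Rightarrow> 'm)
     \<Rightarrow> ('g, 'm) orbit_functor \<Rightarrow> ('g set set \<Rightarrow> 'm \<Rightarrow> 'n) \<Rightarrow> ('g, 'n) orbit_functor \<Rightarrow> bool" where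
  "exact_at G L \<alpha> M \<beta> N \<longleftrightarrow>
     (\<forall>S\<in>orbit_objects G. \<alpha> S ` carrier (val L S) = kernel (val M S) (val N S) (\<beta> S))"

definition module_epi ::
  "('g, 'x) monoid_scheme \<Rightarrow> ('g, 'm) orbit_functor \<Rightarrow> ('g, 'n) orbit_functor
     \<Rightarrow> ('g set set \<Rightarrow> 'm \<Rightarrow> 'n) set" where
  "module_epi G M N =
     {\<eta> \<in> module_hom G M N. \<forall>S\<in>orbit_objects G. \<eta> S ` carrier (val M S) = carrier (val N S)}"

definition zero_module :: "('g, 'x) monoid_scheme \<Rightarrow> ('g, 'm) orbit_functor \<Rightarrow> bool" where
  "zero_module G M \<longleftrightarrow> (\<forall>S\<in>orbit_objects G. trivial_group (val M S))"

definition constant_Z :: "('g, int) orbit_functor" where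
  "constant_Z = \<lparr>val = (\<lambda>S. integer_group), res = (\<lambda>S T f m. m)\<rparr>"


section \<open>Projective resolutions and Bredon cohomological dimension\<close>

text \<open>The lifting property is tested against modules with elements in the same type \<open>'m\<close> as those
  of \<open>P\<close>.  This is projectivity in the full category of modules as soon as \<open>'m\<close> is infinite and
  at least as large as the group: virtually cyclic subgroups are finitely generated, so there are
  at most \<open>|'m|\<close> orbits, and hence \<open>P\<close> is a quotient of a free module with elements in \<open>'m\<close>.\<close>

definition projective_module :: "('g, 'x) monoid_scheme \<Rightarrow> ('g, 'm) orbit_functor \<Rightarrow> bool" where
  "projective_module G P \<longleftrightarrow> right_module G P \<and>
     (\<forall>(M :: ('g, 'm) orbit_functor) (N :: ('g, 'm) orbit_functor).
        right_module G M \<longrightarrow> right_module G N \<longrightarrow>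
        (\<forall>p\<in>module_epi G M N. \<forall>f\<in>module_hom G P N.
           \<exists>h\<in>module_hom G P M.
             \<forall>S\<in>orbit_objects G. \<forall>x\<in>carrier (val P S). p S (h S x) = f S x))"

text \<open>An exact sequence \<open>\<dots> \<rightarrow> P 1 \<rightarrow> P 0 \<rightarrow> Z \<rightarrow> 0\<close>, where \<open>d n : P (n + 1) \<rightarrow> P n\<close>.\<close>

definition projective_resolution ::
  "('g, 'x) monoid_scheme \<Rightarrow> (nat \<Rightarrow> ('g, 'm) orbit_functor)
     \<Rightarrow> (nat \<Rightarrow> 'g set set \<Rightarrow> 'm \<Rightarrow> 'm) \<Rightarrow> ('g set set \<Rightarrow> 'm \<Rightarrow> int) \<Rightarrow> bool" where
  "projective_resolution G P d \<epsilon> \<longleftrightarrow>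
     (\<forall>n. projective_module G (P n)) \<and>
     (\<forall>n. d n \<in> module_hom G (P (Suc n)) (P n)) \<and>
     \<epsilon> \<in> module_epi G (P 0) constant_Z \<and>
     exact_at G (P 1) (d 0) (P 0) \<epsilon> constant_Z \<and>
     (\<forall>n. exact_at G (P (Suc (Suc n))) (d (Suc n)) (P (Suc n)) (d n) (P n))"

text \<open>Modules in resolutions take their elements in \<open>'g list + 'm\<close>.  As HOL has no quantification
  over types, the universe is a parameter \<open>'m\<close>; the summand \<open>'g list\<close> makes it infinite and
  at least as large as the group for every choice of \<open>'m\<close>, as required above.  The resulting
  dimension does not depend on \<open>'m\<close>: the constant functor has a free resolution whose modules
  have at most \<open>|'g list|\<close> elements, and by Schanuel's lemma it can be truncated at the length
  of any given projective resolution.\<close>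

definition vc_cd :: "'m itself \<Rightarrow> ('g, 'x) monoid_scheme \<Rightarrow> enat" where
  "vc_cd _ G = Inf {enat n | n.
     \<exists>(P :: nat \<Rightarrow> ('g, 'g list + 'm) orbit_functor) d \<epsilon>.
       projective_resolution G P d \<epsilon> \<and> (\<forall>i>n. zero_module G (P i))}"

end

theory Submission
  imports Defs
begin

text \<open>A resolution of length one is a module-theoretic substitute for a tree.  Evaluated at the orbit of
  the trivial subgroup, its modules are direct summands of permutation modules \<open>Z[Y]\<close> and \<open>Z[X]\<close> with
  virtually cyclic stabilisers, and exactness at the other orbits says that the sequence remains exact
  on the elements supported on the fixed points of any given virtually cyclic subgroup.
  Moving a point \<open>v\<close> of degree one defines a derivation \<open>\<delta>\<close> into \<open>Z[Y]\<close>, where \<open>\<delta>(g)\<close> is the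
  preimage of \<open>gv - v\<close> under the boundary map, and the fixed points of cyclic subgroups show that
  \<open>\<delta>\<close> is inner on every cyclic subgroup.  The homological form
  of Serre's lemma (a finitely generated group acting on a tree by elliptic elements has a fixed point) is
  that \<open>\<delta>\<close> is then inner on finitely generated subgroups: a coefficient of \<open>\<delta>\<close> is an almost invariant
  function, and if it took two values far out, ping-pong with the components of the complement of a
  finite set would give an element of infinite order along which \<open>\<delta>\<close> is not inner.

  Applied to the part of \<open>Z[Y]\<close> with finite stabilisers, this shows that any two elements of
  infinite order have a common power.  Thus all infinite stabilisers are commensurable with one
  infinite cyclic group, and the argument can be repeated modulo this group.  It yields
  an invariant element of degree one in \<open>Z[X]\<close>, hence a finite orbit in \<open>X\<close>, so the finitely generated
  subgroup is virtually cyclic.\<close>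

section \<open>Ends of finitely generated groups relative to a commensurated cyclic subgroup\<close>

context group
begin

text \<open>No actual tree is available, since projective modules are only direct summands of free
  ones. All elements therefore live in the free modules, while existence and uniqueness of preimages
  under the boundary map are claimed only inside the summands. The element \<open>w\<close> produced
  by the ends argument may leave its summand; this does no harm, because the boundary map is defined
  on the whole free module in such a way that the augmentation still kills its image.

  Two passes are forced by what the ends argument demands: small transporters and finite
  \<open>V\<close>-orbits. With \<open>V\<close> trivial this admits only points with finite
  stabiliser. With \<open>V\<close> generated by \<open>s\<close> it admits the points fixed by some
  power of \<open>s\<close>, but then the group has to commensurate \<open>V\<close>, and this is
  what the first pass supplies. A torsion group needs the second pass alone, with
  \<open>s = \<one>\<close>.

  Vectors are kept from vanishing by their augmentation: the chosen fixed vectors have augmentation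
  one and boundaries have augmentation zero.\<close>

definition cayley_adj :: "'a set \<Rightarrow> 'a \<Rightarrow> 'a \<Rightarrow> bool" where
  "cayley_adj A x y \<longleftrightarrow> (\<exists>a\<in>A. y = x \<otimes> a \<or> x = y \<otimes> a)"

definition conn :: "'a set \<Rightarrow> 'a set \<Rightarrow> 'a \<Rightarrow> 'a \<Rightarrow> bool" where
  "conn A C = (\<lambda>x y. x \<in> C \<and> y \<in> C \<and> cayley_adj A x y)\<^sup>*\<^sup>*"

lemma conn_refl [simp]: "conn A C x x"
  by (simp add: conn_def)

lemma conn_trans [trans]: "conn A C x y \<Longrightarrow> conn A C y z \<Longrightarrow> conn A C x z"
  unfolding conn_def by (rule rtranclp_trans)

lemma conn_step: "x \<in> C \<Longrightarrow> y \<in> C \<Longrightarrow> cayley_adj A x y \<Longrightarrow> conn A C x y"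
  unfolding conn_def by (simp add: r_into_rtranclp)

lemma conn_sym: "conn A C x y \<Longrightarrow> conn A C y x"
proof -
  have "symp (\<lambda>x y. x \<in> C \<and> y \<in> C \<and> cayley_adj A x y)"
    unfolding symp_def cayley_adj_def by blast
  then have "symp (conn A C)"
    unfolding conn_def by (rule symp_rtranclp)
  then show "conn A C x y \<Longrightarrow> conn A C y x"
    by (blast dest: sympD)
qed

lemma conn_mono: "conn A C x y \<Longrightarrow> C \<subseteq> C' \<Longrightarrow> conn A C' x y"
  unfolding conn_def by (erule rtranclp_mono[THEN predicate2D, rotated]) blast

lemma conn_in: "conn A C x y \<Longrightarrow> x \<in> C \<Longrightarrow> y \<in> C"
  unfolding conn_def by (induction rule: rtranclp_induct) auto

lemma conn_const:
  assumes "conn A C x y"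
    and "\<And>x y. x \<in> C \<Longrightarrow> y \<in> C \<Longrightarrow> cayley_adj A x y \<Longrightarrow> f x = f y"
  shows "f x = f y"
  using assms(1) unfolding conn_def
  by (induction rule: rtranclp_induct) (use assms(2) in auto)

text \<open>Edges are right multiplications by generators, so left translations are automorphisms of
  the Cayley graph.\<close>

lemma conn_translate:
  assumes "conn A C x y" "C \<subseteq> carrier G" "A \<subseteq> carrier G" "g \<in> carrier G"
  shows "conn A ((\<otimes>) g ` C) (g \<otimes> x) (g \<otimes> y)"
  using assms(1) unfolding conn_def
proof (induction rule: rtranclp_induct)
  case (step y z)
  have "cayley_adj A (g \<otimes> y) (g \<otimes> z)"
    using step.hyps(2) assms(2-4) unfolding cayley_adj_def
    by (metis m_assoc subsetD)
  with step show ?case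
    by (auto intro: rtranclp.rtrancl_into_rtrancl)
qed simp

text \<open>The path stays inside the subgroup generated by \<open>A'\<close>, while the graph is
  that of the larger set \<open>A\<close>. With \<open>A' = A\<close> this connects the whole group
  \<open>K\<close>, with \<open>A' = {s}\<close> the cyclic subgroup \<open>V\<close>.\<close>

lemma conn_generate:
  assumes "A' \<subseteq> A" "A \<subseteq> carrier G" "h \<in> generate G A'"
  shows "conn A (generate G A') \<one> h"
  using assms(3)
proof (induction rule: generate.induct)
  case one
  then show ?case by simp
next
  case (incl h)
  then have "cayley_adj A \<one> h"
    using assms unfolding cayley_adj_def by (metis l_one subsetD)
  then show ?case
    using incl by (intro conn_step) (auto intro: generate.intros)
next
  case (inv h)
  then have "cayley_adj A \<one> (inv h)"
    using assms unfolding cayley_adj_def by (metis l_inv subsetD)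
  then show ?case
    using inv by (intro conn_step) (auto intro: generate.intros)
next
  case (eng h1 h2)
  have sub: "generate G A' \<subseteq> carrier G"
    using assms by (intro generate_incl) auto
  have "conn A ((\<otimes>) h1 ` generate G A') (h1 \<otimes> \<one>) (h1 \<otimes> h2)"
    using eng sub assms by (intro conn_translate) auto
  then have "conn A (generate G A') (h1 \<otimes> \<one>) (h1 \<otimes> h2)"
    by (rule conn_mono) (use eng in \<open>auto intro: generate.eng\<close>)
  moreover have "h1 \<otimes> \<one> = h1"
    using eng sub by auto
  ultimately show ?case
    using eng.IH(1) conn_trans by metis
qed

lemma conn_finite:
  assumes "conn A C x y" "x \<in> C"
  obtains Q where "finite Q" "Q \<subseteq> C" "x \<in> Q" "y \<in> Q" "\<And>q. q \<in> Q \<Longrightarrow> conn A Q x q"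
proof -
  have "\<exists>Q. finite Q \<and> Q \<subseteq> C \<and> x \<in> Q \<and> y \<in> Q \<and> (\<forall>q\<in>Q. conn A Q x q)"
    using assms(1) unfolding conn_def[of A C]
  proof (induction rule: rtranclp_induct)
    case base
    show ?case
      using assms(2) by (intro exI[of _ "{x}"]) auto
  next
    case (step y z)
    then obtain Q where Q: "finite Q" "Q \<subseteq> C" "x \<in> Q" "y \<in> Q" "\<forall>q\<in>Q. conn A Q x q"
      by blast
    have "conn A (insert z Q) x q" if "q \<in> Q" for q
      using Q(5) that by (blast intro: conn_mono)
    moreover have "conn A (insert z Q) y z"
      using Q(4) step.hyps(2) by (intro conn_step) auto
    ultimately show ?case
      using Q step.hyps(2) by (intro exI[of _ "insert z Q"]) (auto intro: conn_trans)
  qed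
  then show thesis
    using that by blast
qed

end

section \<open>Subsets of \<open>K\<close> covered by finitely many left cosets of
  \<open>V\<close>\<close>

locale commensurated = group +
  fixes A :: "'a set" and s :: 'a and K V :: "'a set"
  defines "K \<equiv> generate G A" and "V \<equiv> generate G {s}"
  assumes fin_A: "finite A" and A_sub: "A \<subseteq> carrier G" and s_A: "s \<in> A"
    and comm: "\<And>g. g \<in> K \<Longrightarrow> \<exists>F. finite F \<and> F \<subseteq> K \<and> V #> g \<subseteq> F <#> V"
begin

text \<open>Small sets take the role that finite sets have in the usual theory of ends:
  \<open>K\<close> is studied modulo \<open>V\<close>. The assumption \<open>comm\<close> makes the
  notion stable under right translation too, and \<open>s \<in> A\<close> keeps \<open>V\<close>
  connected in the Cayley graph.\<close>

definition small :: "'a set \<Rightarrow> bool" where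
  "small B \<longleftrightarrow> (\<exists>F. finite F \<and> F \<subseteq> K \<and> B \<subseteq> F <#> V)"

lemma K_subgroup: "subgroup K G"
  unfolding K_def by (rule generate_is_subgroup[OF A_sub])

lemma V_subgroup: "subgroup V G"
  unfolding V_def using A_sub s_A by (intro generate_is_subgroup) auto

lemma V_sub_K: "V \<subseteq> K"
  unfolding V_def K_def using s_A by (intro mono_generate) auto

lemma K_carrier: "x \<in> K \<Longrightarrow> x \<in> carrier G"
  using K_subgroup by (rule subgroup.mem_carrier)

lemma V_carrier: "x \<in> V \<Longrightarrow> x \<in> carrier G"
  using V_subgroup by (rule subgroup.mem_carrier)

lemmas K_closed [simp, intro] =
  subgroup.m_closed[OF K_subgroup] subgroup.m_inv_closed[OF K_subgroup] subgroup.one_closed[OF K_subgroup]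

lemma small_subset: "small B \<Longrightarrow> B' \<subseteq> B \<Longrightarrow> small B'"
  unfolding small_def by blast

lemma small_Un: "small B \<Longrightarrow> small B' \<Longrightarrow> small (B \<union> B')"
  unfolding small_def
proof (elim exE conjE)
  fix F F'
  assume "finite F" "F \<subseteq> K" "B \<subseteq> F <#> V" "finite F'" "F' \<subseteq> K" "B' \<subseteq> F' <#> V"
  then show "\<exists>F. finite F \<and> F \<subseteq> K \<and> B \<union> B' \<subseteq> F <#> V"
    by (intro exI[of _ "F \<union> F'"]) (auto simp: set_mult_def)
qed

lemma small_empty: "small {}"
  unfolding small_def by (intro exI[of _ "{}"]) auto

lemma small_UN: "finite I \<Longrightarrow> (\<And>i. i \<in> I \<Longrightarrow> small (B i)) \<Longrightarrow> small (\<Union>i\<in>I. B i)"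
  by (induction I rule: finite_induct) (auto intro: small_Un small_empty)

lemma small_finite: "finite B \<Longrightarrow> B \<subseteq> K \<Longrightarrow> small B"
  unfolding small_def set_mult_def
  using subgroup.one_closed[OF V_subgroup] K_carrier
  by (intro exI[of _ B]) (force simp: subset_iff)

lemma small_left:
  assumes "small B" "g \<in> K"
  shows "small ((\<otimes>) g ` B)"
proof -
  obtain F where F: "finite F" "F \<subseteq> K" "B \<subseteq> F <#> V"
    using assms unfolding small_def by blast
  have "(\<otimes>) g ` B \<subseteq> ((\<otimes>) g ` F) <#> V"
  proof
    fix x assume "x \<in> (\<otimes>) g ` B"
    then obtain f v where "f \<in> F" "v \<in> V" "x = g \<otimes> (f \<otimes> v)"
      using F(3) by (auto simp: set_mult_def)
    moreover from this have "x = (g \<otimes> f) \<otimes> v"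
      using F(2) assms(2) by (auto simp: m_assoc K_carrier V_carrier subset_iff)
    ultimately show "x \<in> ((\<otimes>) g ` F) <#> V"
      unfolding set_mult_def by blast
  qed
  then show ?thesis
    unfolding small_def using F assms(2) by (intro exI[of _ "(\<otimes>) g ` F"]) auto
qed

text \<open>\<open>F V g\<close> is the finite union of the translates \<open>f (V g)\<close>, and
  \<open>comm\<close> covers \<open>V g\<close> by finitely many left cosets of
  \<open>V\<close>.\<close>

lemma small_right:
  assumes "small B" "g \<in> K"
  shows "small (B #> g)"
proof -
  obtain F where F: "finite F" "F \<subseteq> K" "B \<subseteq> F <#> V"
    using assms unfolding small_def by blast
  have Vg: "small (V #> g)"
    using comm[OF assms(2)] unfolding small_def by blast
  have "B #> g \<subseteq> (\<Union>f\<in>F. (\<otimes>) f ` (V #> g))"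
  proof
    fix x assume "x \<in> B #> g"
    then obtain f v where "f \<in> F" "v \<in> V" "x = (f \<otimes> v) \<otimes> g"
      using F(3) by (auto simp: set_mult_def r_coset_def)
    moreover from this have "x = f \<otimes> (v \<otimes> g)"
      using F(2) assms(2) by (auto simp: m_assoc K_carrier V_carrier subset_iff)
    ultimately show "x \<in> (\<Union>f\<in>F. (\<otimes>) f ` (V #> g))"
      unfolding r_coset_def by blast
  qed
  moreover have "small (\<Union>f\<in>F. (\<otimes>) f ` (V #> g))"
    using F Vg by (intro small_UN small_left) auto
  ultimately show ?thesis
    by (rule small_subset[rotated])
qed

text \<open>Such \<open>g\<close> lie in \<open>B B^-1\<close>, which is contained in
  \<open>F V F^-1\<close>. Hence \<open>g B\<close> misses \<open>B\<close> for all \<open>g\<close>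
  outside a small set; this stands in for properness of the translation action.\<close>

lemma small_quotients:
  assumes "small B" "B \<subseteq> K"
  shows "small {g \<in> K. \<exists>b\<in>B. g \<otimes> b \<in> B}"
proof -
  obtain F where F: "finite F" "F \<subseteq> K" "B \<subseteq> F <#> V"
    using assms unfolding small_def by blast
  have "{g \<in> K. \<exists>b\<in>B. g \<otimes> b \<in> B} \<subseteq> (\<Union>f\<in>F. (F <#> V) #> inv f)"
  proof
    fix g assume "g \<in> {g \<in> K. \<exists>b\<in>B. g \<otimes> b \<in> B}"
    then obtain b where b: "g \<in> K" "b \<in> B" "g \<otimes> b \<in> B" by blast
    obtain f v where fv: "f \<in> F" "v \<in> V" "b = f \<otimes> v"
      using F(3) b by (auto simp: set_mult_def)
    obtain f' v' where fv': "f' \<in> F" "v' \<in> V" "g \<otimes> b = f' \<otimes> v'"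
      using F(3) b by (auto simp: set_mult_def)
    have c: "f \<in> carrier G" "v \<in> carrier G" "f' \<in> carrier G" "v' \<in> carrier G" "g \<in> carrier G"
      using fv fv' F(2) b by (auto simp: K_carrier V_carrier)
    have "g = (f' \<otimes> v') \<otimes> inv (f \<otimes> v)"
      using fv fv' c by (simp add: inv_solve_right)
    also have "\<dots> = (f' \<otimes> (v' \<otimes> inv v)) \<otimes> inv f"
      using c by (simp add: inv_mult_group m_assoc)
    finally have "g = (f' \<otimes> (v' \<otimes> inv v)) \<otimes> inv f" .
    moreover have "v' \<otimes> inv v \<in> V"
      using fv fv' V_subgroup by (simp add: subgroup.m_closed subgroup.m_inv_closed)
    ultimately show "g \<in> (\<Union>f\<in>F. (F <#> V) #> inv f)"
      using fv(1) fv'(1) by (auto simp: set_mult_def r_coset_def)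
  qed
  moreover have "small (F <#> V)"
    unfolding small_def using F by blast
  then have "small (\<Union>f\<in>F. (F <#> V) #> inv f)"
    using F by (intro small_UN small_right) auto
  ultimately show ?thesis
    by (rule small_subset[rotated])
qed

text \<open>Finite paths from \<open>\<one>\<close> to each \<open>f\<close> are added to the cosets
  \<open>f V\<close>, which are connected because \<open>s\<close> is a generator. Including
  \<open>\<one>\<close> among the representatives puts \<open>V\<close> itself into the hull, so
  that elements of \<open>V\<close> never count as far out.\<close>

lemma small_connected_hull:
  assumes "small W" "W \<subseteq> K"
  obtains B where "small B" "B \<subseteq> K" "W \<subseteq> B" "V \<subseteq> B" "\<And>b. b \<in> B \<Longrightarrow> conn A B \<one> b"
proof -
  obtain F where F: "finite F" "F \<subseteq> K" "W \<subseteq> F <#> V"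
    using assms unfolding small_def by blast
  have "\<exists>Q. finite Q \<and> Q \<subseteq> K \<and> \<one> \<in> Q \<and> f \<in> Q \<and> (\<forall>q\<in>Q. conn A Q \<one> q)" if "f \<in> K" for f
  proof -
    have "conn A K \<one> f"
      using conn_generate[of A A f] A_sub that unfolding K_def by blast
    then show ?thesis
      by (rule conn_finite) auto
  qed
  then obtain Q where Q: "\<And>f. f \<in> K \<Longrightarrow> finite (Q f) \<and> Q f \<subseteq> K \<and> \<one> \<in> Q f \<and> f \<in> Q f \<and>
      (\<forall>q\<in>Q f. conn A (Q f) \<one> q)"
    by metis
  let ?F = "insert \<one> F"
  define B where "B = (\<Union>f\<in>?F. (\<otimes>) f ` V \<union> Q f)"
  have FK: "f \<in> K" if "f \<in> ?F" for f
    using that F(2) by auto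
  have V1: "\<one> \<in> V"
    using V_subgroup by (rule subgroup.one_closed)
  have VV: "small V"
    unfolding small_def by (intro exI[of _ "{\<one>}"]) (auto simp: set_mult_def V_carrier)
  show thesis
  proof
    show "small B"
      unfolding B_def using F(1) Q FK VV
      by (intro small_UN small_Un small_left small_finite[of "Q _"]) auto
    show "B \<subseteq> K"
      unfolding B_def using Q FK V_sub_K by blast
    show "W \<subseteq> B"
      using F(3) unfolding B_def set_mult_def by auto
    show "V \<subseteq> B"
      unfolding B_def by (force simp: image_iff V_carrier)
    fix b assume "b \<in> B"
    then obtain f where f: "f \<in> ?F" "b \<in> (\<otimes>) f ` V \<union> Q f"
      unfolding B_def by blast
    have QB: "conn A B \<one> q" if "q \<in> Q f" for q
      by (rule conn_mono[of _ "Q f"]) (use Q FK f(1) that in \<open>auto simp: B_def\<close>)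
    show "conn A B \<one> b"
    proof (cases "b \<in> Q f")
      case True
      then show ?thesis by (rule QB)
    next
      case False
      then obtain v where v: "v \<in> V" "b = f \<otimes> v"
        using f by blast
      have "conn A V \<one> v"
        using v(1) s_A A_sub unfolding V_def by (intro conn_generate) auto
      then have "conn A ((\<otimes>) f ` V) (f \<otimes> \<one>) (f \<otimes> v)"
        using A_sub FK[OF f(1)] by (intro conn_translate) (auto simp: K_carrier V_carrier)
      then have "conn A B (f \<otimes> \<one>) (f \<otimes> v)"
        by (rule conn_mono) (use f(1) in \<open>auto simp: B_def\<close>)
      moreover have "conn A B \<one> f"
        using QB Q FK f(1) by blast
      ultimately show ?thesis
        using v FK[OF f(1)] conn_trans K_carrier r_one by metis
    qed
  qed
qed

text \<open>The ends argument: outside the small connected set \<open>B\<close> the function \<open>\<phi>\<close> is constant on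
  components.  If \<open>\<phi>\<close> took two values far out, then some \<open>g\<close> would translate \<open>B\<close> into one component
  and \<open>inv g\<close> into another one with a different value, and the powers of \<open>g\<close> and of \<open>inv g\<close> would
  stay in these two components.\<close>

lemma almost_constant:
  fixes \<phi> :: "'a \<Rightarrow> 'z"
  assumes W: "small {g \<in> K. \<exists>a\<in>A. \<phi> (g \<otimes> a) \<noteq> \<phi> g}"
    and axis: "\<And>g. g \<in> K \<Longrightarrow> \<exists>n>0. g [^] (n::nat) \<in> V \<or> \<phi> (g [^] n) = \<phi> (inv (g [^] n))"
  obtains c where "small {g \<in> K. \<phi> g \<noteq> c}"
proof -
  obtain B where B: "small B" "B \<subseteq> K" "{g \<in> K. \<exists>a\<in>A. \<phi> (g \<otimes> a) \<noteq> \<phi> g} \<subseteq> B" "V \<subseteq> B"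
      and Bconn: "\<And>b. b \<in> B \<Longrightarrow> conn A B \<one> b"
    using small_connected_hull[OF W] by auto
  define C where "C = K - B"
  have oneB: "\<one> \<in> B"
    using B(4) V_subgroup subgroup.one_closed by auto
  have AK: "a \<in> K" if "a \<in> A" for a
    using that unfolding K_def by (rule generate.incl)
  have phi_conn: "\<phi> x = \<phi> y" if "conn A C x y" for x y
  proof (rule conn_const[OF that])
    fix x y
    assume xy: "x \<in> C" "y \<in> C" "cayley_adj A x y"
    then obtain a where a: "a \<in> A" "y = x \<otimes> a \<or> x = y \<otimes> a"
      unfolding cayley_adj_def by blast
    have "\<phi> (z \<otimes> a) = \<phi> z" if "z \<in> C" for z
    proof (rule ccontr)
      assume "\<phi> (z \<otimes> a) \<noteq> \<phi> z"
      then have "z \<in> {g \<in> K. \<exists>a\<in>A. \<phi> (g \<otimes> a) \<noteq> \<phi> g}"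
        using a(1) that by (auto simp: C_def)
      then show False
        using B(3) that by (auto simp: C_def)
    qed
    then show "\<phi> x = \<phi> y"
      using xy a(2) by auto
  qed
  \<comment> \<open>Since \<open>B\<close> is connected, a translate \<open>g B\<close> that misses
    \<open>B\<close> lies in a single component of \<open>C\<close>.\<close>
  define deep where "deep g \<longleftrightarrow> g \<in> K \<and> (\<forall>b\<in>B. g \<otimes> b \<notin> B)" for g
  have deep_inv: "deep (inv g)" if "deep g" for g
    unfolding deep_def
  proof (intro conjI ballI notI)
    show "inv g \<in> K"
      using that unfolding deep_def by blast
    fix b assume b: "b \<in> B" "inv g \<otimes> b \<in> B"
    then have "g \<otimes> (inv g \<otimes> b) \<notin> B"
      using that unfolding deep_def by blast
    moreover have "g \<otimes> (inv g \<otimes> b) = b"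
      using b that B(2) unfolding deep_def by (simp add: K_carrier m_assoc[symmetric] subset_iff)
    ultimately show False
      using b by simp
  qed
  have deepC: "g \<in> C" if "deep g" for g
    using that oneB unfolding deep_def C_def by (metis DiffI K_carrier r_one)
  have translate_B: "conn A C g (g \<otimes> b)" if "deep g" "b \<in> B" for g b
  proof -
    have g: "g \<in> K"
      using that unfolding deep_def by blast
    have "conn A ((\<otimes>) g ` B) (g \<otimes> \<one>) (g \<otimes> b)"
      using Bconn[OF that(2)] g B(2) A_sub by (intro conn_translate) (auto simp: K_carrier)
    then have "conn A C (g \<otimes> \<one>) (g \<otimes> b)"
      by (rule conn_mono) (use that B(2) g in \<open>auto simp: C_def deep_def\<close>)
    then show ?thesis
      using g K_carrier by simp
  qed
  \<comment> \<open>Ping-pong: a deep \<open>g\<close> maps every component of \<open>C\<close>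
    other than that of \<open>inv g\<close> into the component of \<open>g\<close>.\<close>
  have push: "conn A C g (g \<otimes> x)" if "deep g" "x \<in> C" "\<not> conn A C x (inv g)" for g x
  proof -
    have gK: "g \<in> K" and xK: "x \<in> K"
      using that unfolding deep_def C_def by auto
    define Z where "Z = {z. conn A C x z}"
    have ZC: "Z \<subseteq> C"
      using that(2) conn_in unfolding Z_def by blast
    have conn_Z: "conn A Z x z" if "conn A C x z" for z
      using that unfolding conn_def[of A C]
    proof (induction rule: rtranclp_induct)
      case (step y z)
      then have "y \<in> Z" "z \<in> Z"
        unfolding Z_def conn_def by (auto intro: rtranclp.rtrancl_into_rtrancl)
      then have "conn A Z y z"
        using step.hyps(2) by (intro conn_step) auto
      with step.IH show ?case
        by (rule conn_trans)
    qed simp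
    \<comment> \<open>\<open>K\<close> is connected and \<open>\<one>\<close> lies in
      \<open>B\<close>, so a path from \<open>x\<close> to \<open>\<one>\<close> has to leave the
      component \<open>Z\<close> through an edge ending in \<open>B\<close>.\<close>
    have "\<exists>z b. z \<in> Z \<and> b \<in> B \<and> cayley_adj A z b"
    proof (rule ccontr)
      assume no: "\<nexists>z b. z \<in> Z \<and> b \<in> B \<and> cayley_adj A z b"
      have "conn A K \<one> x"
        using conn_generate[of A A x] A_sub xK unfolding K_def by blast
      then have "conn A K x \<one>"
        by (rule conn_sym)
      then have "\<one> \<in> Z"
        unfolding conn_def[of A K]
      proof (induction rule: rtranclp_induct)
        case base
        show ?case by (simp add: Z_def)
      next
        case (step y z)
        then have "z \<in> C" "y \<in> C"
          using no ZC unfolding C_def by blast+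
        then have "conn A C y z"
          using step by (intro conn_step) auto
        then show ?case
          using step.IH unfolding Z_def by (auto intro: conn_trans)
      qed
      then show False
        using ZC oneB unfolding C_def by blast
    qed
    then obtain z b where zb: "z \<in> Z" "b \<in> B" "cayley_adj A z b" by blast
    \<comment> \<open>The extra vertex \<open>b\<close> attaches the translate of \<open>Z\<close>
      to \<open>g B\<close>, which already lies in the component of \<open>g\<close>.\<close>
    define D where "D = insert b Z"
    have "conn A D x z"
      using conn_Z zb(1) unfolding D_def Z_def by (auto intro: conn_mono)
    moreover have "conn A D z b"
      using zb unfolding D_def by (intro conn_step) auto
    ultimately have "conn A D x b"
      by (rule conn_trans)
    then have "conn A ((\<otimes>) g ` D) (g \<otimes> x) (g \<otimes> b)"
      using gK A_sub zb(2) B(2) ZC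
      by (intro conn_translate) (auto simp: D_def C_def K_carrier)
    moreover have "(\<otimes>) g ` D \<subseteq> C"
    proof
      fix y assume "y \<in> (\<otimes>) g ` D"
      then obtain d where d: "d \<in> D" "y = g \<otimes> d" by blast
      have dK: "d \<in> K"
        using d(1) zb(2) B(2) ZC by (auto simp: D_def C_def)
      have "g \<otimes> d \<notin> B"
      proof
        assume gd: "g \<otimes> d \<in> B"
        then have "d \<notin> B"
          using that(1) unfolding deep_def by blast
        then have "conn A C x d"
          using d(1) zb(2) unfolding D_def Z_def by auto
        moreover have "conn A C (inv g) (inv g \<otimes> (g \<otimes> d))"
          using translate_B[OF deep_inv[OF that(1)] gd] .
        then have "conn A C d (inv g)"
          using gK dK by (metis K_carrier conn_sym inv_closed l_inv l_one m_assoc)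
        ultimately show False
          using that(3) conn_trans by blast
      qed
      then show "y \<in> C"
        using d gK dK by (simp add: C_def)
    qed
    ultimately have "conn A C (g \<otimes> x) (g \<otimes> b)"
      by (rule conn_mono)
    then show ?thesis
      using translate_B[OF that(1) zb(2)] conn_sym conn_trans by blast
  qed
  have powers: "conn A C g (g [^] n) \<and> g [^] n \<in> C"
    if "deep g" "\<not> conn A C g (inv g)" "n > 0" for g and n :: nat
    using that(3)
  proof (induction n rule: nat_induct_non_zero)
    case 1
    then show ?case
      using that(1) deepC[OF that(1)] by (simp add: deep_def K_carrier)
  next
    case (Suc n)
    have g: "g \<in> carrier G"
      using that(1) by (simp add: deep_def K_carrier)
    have "\<not> conn A C (g [^] n) (inv g)"
      using Suc.IH that(2) conn_trans by blast
    then have "conn A C g (g \<otimes> g [^] n)"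
      using push[OF that(1)] Suc.IH by blast
    moreover have "g \<otimes> g [^] n = g [^] Suc n"
      using g nat_pow_Suc2 by metis
    ultimately show ?case
      using conn_in deepC[OF that(1)] by metis
  qed
  \<comment> \<open>If the values differed, \<open>g\<close> and \<open>inv g\<close> would lie in
    different components, and by \<open>powers\<close> so would all positive powers of
    \<open>g\<close> and of \<open>inv g\<close>. These powers stay in \<open>C\<close>, hence
    outside \<open>V\<close>, against \<open>axis\<close>.\<close>
  have sym: "\<phi> g = \<phi> (inv g)" if "deep g" for g
  proof (rule ccontr)
    assume ne: "\<phi> g \<noteq> \<phi> (inv g)"
    have g: "g \<in> carrier G" "g \<in> K"
      using that by (auto simp: deep_def K_carrier)
    obtain n :: nat where n: "n > 0" "g [^] n \<in> V \<or> \<phi> (g [^] n) = \<phi> (inv (g [^] n))"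
      using axis[OF g(2)] by blast
    have nc: "\<not> conn A C g (inv g)"
      using ne phi_conn by blast
    then have nc': "\<not> conn A C (inv g) (inv (inv g))"
      using g conn_sym by auto
    have "conn A C g (g [^] n)" "g [^] n \<in> C"
      using powers[OF that nc n(1)] by auto
    moreover have "conn A C (inv g) ((inv g) [^] n)"
      using powers[OF deep_inv[OF that] nc' n(1)] by auto
    ultimately show False
      using n(2) phi_conn ne B(4) g(1) unfolding C_def by (metis DiffD2 nat_pow_inv subsetD)
  qed
  \<comment> \<open>By \<open>sym\<close> an element and its inverse share their value, so different
    values at \<open>g\<close> and \<open>h\<close> separate the components of \<open>g\<close> and
    \<open>inv g\<close> from those of \<open>h\<close> and \<open>inv h\<close>. Then
    \<open>g \<otimes> h\<close> lands in the component of \<open>g\<close> and its inverse in that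
    of \<open>inv h\<close>, which contradicts \<open>sym\<close> for
    \<open>g \<otimes> h\<close>.\<close>
  have eq: "\<phi> g = \<phi> h" if "deep g" "deep h" for g h
  proof (rule ccontr)
    assume ne: "\<phi> g \<noteq> \<phi> h"
    have K: "g \<in> K" "h \<in> K"
      using that by (auto simp: deep_def)
    have n1: "\<not> conn A C h (inv g)"
      using ne sym[OF that(1)] phi_conn by metis
    then have n2: "\<not> conn A C (inv g) (inv (inv h))"
      using K conn_sym K_carrier by (metis inv_inv)
    have gh: "conn A C g (g \<otimes> h)"
      using push[OF that(1) deepC[OF that(2)] n1] .
    have "deep (g \<otimes> h)"
      unfolding deep_def
    proof (intro conjI ballI)
      show "g \<otimes> h \<in> K"
        using K by blast
      fix b assume b: "b \<in> B"
      have hb: "conn A C h (h \<otimes> b)"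
        using translate_B[OF that(2) b] .
      then have "\<not> conn A C (h \<otimes> b) (inv g)"
        using n1 conn_trans by blast
      then have "conn A C g (g \<otimes> (h \<otimes> b))"
        using push[OF that(1)] hb conn_in deepC[OF that(2)] by blast
      then have "g \<otimes> (h \<otimes> b) \<in> C"
        using conn_in deepC[OF that(1)] by blast
      then show "g \<otimes> h \<otimes> b \<notin> B"
        using K b B(2) by (simp add: C_def m_assoc K_carrier subset_iff)
    qed
    then have "\<phi> (g \<otimes> h) = \<phi> (inv (g \<otimes> h))"
      by (rule sym)
    moreover have "conn A C (inv h) (inv h \<otimes> inv g)"
      using push[OF deep_inv[OF that(2)] deepC[OF deep_inv[OF that(1)]] n2] .
    then have "\<phi> (inv (g \<otimes> h)) = \<phi> h"
      using phi_conn sym[OF that(2)] K by (metis K_carrier inv_mult_group)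
    ultimately show False
      using phi_conn[OF gh] ne by simp
  qed
  have sm: "small {g \<in> K. \<not> deep g}"
    by (rule small_subset[OF small_quotients[OF B(1,2)]]) (auto simp: deep_def)
  show thesis
  proof (cases "\<exists>g. deep g")
    case True
    then obtain g where g: "deep g" ..
    show thesis
      by (rule that[of "\<phi> g"], rule small_subset[OF sm]) (use eq[OF g] in auto)
  next
    \<comment> \<open>Without deep elements \<open>K\<close> itself is small, and any constant will
      do.\<close>
    case False
    show thesis
      by (rule that[of undefined], rule small_subset[OF sm]) (use False in auto)
  qed
qed

end

section \<open>Derivations into permutation modules\<close>

abbreviation frag_map :: "('y \<Rightarrow> 'z) \<Rightarrow> ('y \<Rightarrow>\<^sub>0 int) \<Rightarrow> ('z \<Rightarrow>\<^sub>0 int)" where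
  "frag_map f \<equiv> frag_extend (\<lambda>y. frag_of (f y))"

lemma lookup_frag_map:
  assumes "Poly_Mapping.keys c \<subseteq> Y" and "\<And>z. z \<in> Y \<Longrightarrow> f z = y \<longleftrightarrow> z = y'"
  shows "Poly_Mapping.lookup (frag_map f c) y = Poly_Mapping.lookup c y'"
  using assms(1)
  by (induction c rule: frag_induction) (use assms(2) in \<open>auto simp: frag_extend_diff lookup_minus\<close>)

lemma keys_frag_map: "Poly_Mapping.keys (frag_map f c) \<subseteq> f ` Poly_Mapping.keys c"
  using keys_frag_extend[of "\<lambda>y. frag_of (f y)" c] by auto

lemma frag_map_compose: "frag_map f (frag_map g c) = frag_map (\<lambda>y. f (g y)) c"
  using frag_extend_compose[of "\<lambda>y. frag_of (f y)" g c] by (simp add: comp_def)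

lemma frag_map_cong:
  "Poly_Mapping.keys c \<subseteq> Y \<Longrightarrow> (\<And>y. y \<in> Y \<Longrightarrow> f y = g y) \<Longrightarrow> frag_map f c = frag_map g c"
  by (rule frag_extend_eq) auto

lemma frag_map_id: "Poly_Mapping.keys c \<subseteq> Y \<Longrightarrow> (\<And>y. y \<in> Y \<Longrightarrow> f y = y) \<Longrightarrow> frag_map f c = c"
  by (subst (2) frag_expansion, rule frag_extend_eq) auto

lemma frag_eqI:
  assumes "Poly_Mapping.keys c \<subseteq> Y" "Poly_Mapping.keys d \<subseteq> Y"
    and "\<And>y. y \<in> Y \<Longrightarrow> Poly_Mapping.lookup c y = Poly_Mapping.lookup d y"
  shows "c = d"
  by (rule poly_mapping_eqI) (metis assms in_keys_iff subsetD)

lemma frag_of_coefficients: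
  fixes c :: "'y \<Rightarrow> int"
  assumes "finite {y \<in> Y. c y \<noteq> 0}"
  obtains w where "Poly_Mapping.keys w \<subseteq> Y" "\<And>y. y \<in> Y \<Longrightarrow> Poly_Mapping.lookup w y = c y"
proof
  let ?f = "\<lambda>y. if y \<in> Y then c y else 0"
  have "finite {y. ?f y \<noteq> 0}"
    by (rule finite_subset[OF _ assms]) auto
  then have l: "Poly_Mapping.lookup (Abs_poly_mapping ?f) = ?f"
    by (simp add: lookup_Abs_poly_mapping)
  show "Poly_Mapping.keys (Abs_poly_mapping ?f) \<subseteq> Y"
    by (auto simp: in_keys_iff l split: if_splits)
  show "Poly_Mapping.lookup (Abs_poly_mapping ?f) y = c y" if "y \<in> Y" for y
    using that by (simp add: l)
qed

locale commensurated_action = commensurated +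
  fixes Y :: "'y set" and act :: "'a \<Rightarrow> 'y \<Rightarrow> 'y"
  assumes act_closed: "\<And>g y. g \<in> K \<Longrightarrow> y \<in> Y \<Longrightarrow> act g y \<in> Y"
    and act_one: "\<And>y. y \<in> Y \<Longrightarrow> act \<one> y = y"
    and act_mult: "\<And>g h y. g \<in> K \<Longrightarrow> h \<in> K \<Longrightarrow> y \<in> Y \<Longrightarrow> act (g \<otimes> h) y = act g (act h y)"
begin

lemma act_inv: "g \<in> K \<Longrightarrow> y \<in> Y \<Longrightarrow> act (inv g) (act g y) = y"
  by (metis K_carrier K_closed(2) act_mult act_one l_inv)

lemma act_inv': "g \<in> K \<Longrightarrow> y \<in> Y \<Longrightarrow> act g (act (inv g) y) = y"
  by (metis K_carrier K_closed(2) act_mult act_one r_inv)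

lemma lookup_act:
  assumes "Poly_Mapping.keys c \<subseteq> Y" "g \<in> K" "y \<in> Y"
  shows "Poly_Mapping.lookup (frag_map (act g) c) y = Poly_Mapping.lookup c (act (inv g) y)"
  by (rule lookup_frag_map[OF assms(1)]) (use assms act_inv act_inv' in auto)

lemma keys_act: "Poly_Mapping.keys c \<subseteq> Y \<Longrightarrow> g \<in> K \<Longrightarrow> Poly_Mapping.keys (frag_map (act g) c) \<subseteq> Y"
  using keys_frag_map[of "act g" c] act_closed by blast

text \<open>The coefficient of \<open>\<delta>\<close> at a point \<open>y\<close> is almost constant on \<open>K\<close>; its value far out is the
  coefficient at \<open>y\<close> of the element whose inner derivation is \<open>\<delta>\<close>.\<close>

lemma inner_derivation:
  fixes \<delta> :: "'a \<Rightarrow> 'y \<Rightarrow>\<^sub>0 int"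
  assumes keys: "\<And>g. g \<in> K \<Longrightarrow> Poly_Mapping.keys (\<delta> g) \<subseteq> Y"
    and deriv: "\<And>g h. g \<in> K \<Longrightarrow> h \<in> K \<Longrightarrow> \<delta> (g \<otimes> h) = \<delta> g + frag_map (act g) (\<delta> h)"
    and stab: "\<And>y y'. y \<in> Y \<Longrightarrow> y' \<in> Y \<Longrightarrow> small {g \<in> K. act g y = y'}"
    and orb: "\<And>y. y \<in> Y \<Longrightarrow> finite ((\<lambda>v. act v y) ` V)"
    and big: "\<not> small K"
    and axis: "\<And>g y. g \<in> K \<Longrightarrow> y \<in> Y \<Longrightarrow> \<exists>n>0. g [^] (n::nat) \<in> V \<or>
        Poly_Mapping.lookup (\<delta> (g [^] n)) y = Poly_Mapping.lookup (\<delta> (inv (g [^] n))) y"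
  obtains w where "Poly_Mapping.keys w \<subseteq> Y" "\<And>g. g \<in> K \<Longrightarrow> \<delta> g = w - frag_map (act g) w"
proof -
  define \<phi> where "\<phi> y g = Poly_Mapping.lookup (\<delta> g) y" for y g
  have AK: "a \<in> K" if "a \<in> A" for a
    using that unfolding K_def by (rule generate.incl)
  have mult: "\<phi> y (g \<otimes> h) = \<phi> y g + \<phi> (act (inv g) y) h" if "g \<in> K" "h \<in> K" "y \<in> Y" for g h y
    using that deriv lookup_act[OF keys] by (simp add: \<phi>_def lookup_add)
  have one: "\<phi> y \<one> = 0" if "y \<in> Y" for y
    using mult[of \<one> \<one> y] that act_one by simp
  \<comment> \<open>Along the edge from \<open>g\<close> to \<open>g \<otimes> a\<close> the
    coefficient at \<open>y\<close> changes by the coefficient of \<open>\<delta> a\<close> at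
    \<open>act (inv g) y\<close>. A jump thus means that \<open>g\<close> carries a point of the
    support of \<open>\<delta> a\<close> to \<open>y\<close>.\<close>
  have W: "{g \<in> K. \<exists>a\<in>A. \<phi> y (g \<otimes> a) \<noteq> \<phi> y g} \<subseteq>
      (\<Union>a\<in>A. \<Union>z\<in>Poly_Mapping.keys (\<delta> a). {g \<in> K. act g z = y})" if "y \<in> Y" for y
  proof
    fix g assume "g \<in> {g \<in> K. \<exists>a\<in>A. \<phi> y (g \<otimes> a) \<noteq> \<phi> y g}"
    then obtain a where a: "g \<in> K" "a \<in> A" "\<phi> y (g \<otimes> a) \<noteq> \<phi> y g" by blast
    then have "\<phi> (act (inv g) y) a \<noteq> 0"
      using mult[of g a y] AK that by auto
    then have "act (inv g) y \<in> Poly_Mapping.keys (\<delta> a)"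
      by (simp add: \<phi>_def in_keys_iff)
    moreover have "act g (act (inv g) y) = y"
      using act_inv' a that by blast
    ultimately show "g \<in> (\<Union>a\<in>A. \<Union>z\<in>Poly_Mapping.keys (\<delta> a). {g \<in> K. act g z = y})"
      using a by blast
  qed
  have Wsmall: "small {g \<in> K. \<exists>a\<in>A. \<phi> y (g \<otimes> a) \<noteq> \<phi> y g}" if "y \<in> Y" for y
    by (rule small_subset[OF _ W[OF that]], intro small_UN fin_A finite_keys stab that)
       (use keys AK in blast)
  have "\<exists>c. small {g \<in> K. \<phi> y g \<noteq> c}" if "y \<in> Y" for y
  proof (rule almost_constant[OF Wsmall[OF that]])
    show "\<exists>n>0. g [^] (n::nat) \<in> V \<or> \<phi> y (g [^] n) = \<phi> y (inv (g [^] n))" if "g \<in> K" for g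
      using axis[OF that \<open>y \<in> Y\<close>] unfolding \<phi>_def .
  qed blast
  then obtain c where c: "\<And>y. y \<in> Y \<Longrightarrow> small {g \<in> K. \<phi> y g \<noteq> c y}"
    by metis
  \<comment> \<open>Two different limits would make \<open>K\<close> the union of two small
    sets.\<close>
  have c_unique: "c y = d" if "y \<in> Y" "small {g \<in> K. \<phi> y g \<noteq> d}" for y d
  proof (rule ccontr)
    assume "c y \<noteq> d"
    then have "K \<subseteq> {g \<in> K. \<phi> y g \<noteq> c y} \<union> {g \<in> K. \<phi> y g \<noteq> d}"
      by auto
    then show False
      using big small_Un[OF c[OF that(1)] that(2)] small_subset by blast
  qed
  \<comment> \<open>Letting \<open>h\<close> go far out in \<open>mult\<close> gives the rule for
    the limits. It is already the coefficientwise form of \<open>\<delta> g = w - g w\<close>; what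
    remains is that \<open>c\<close> has finite support.\<close>
  have c_act: "c (act (inv g) y) = c y - \<phi> y g" if "g \<in> K" "y \<in> Y" for g y
  proof (rule c_unique)
    show "act (inv g) y \<in> Y"
      using that act_closed by blast
    have "{h \<in> K. \<phi> (act (inv g) y) h \<noteq> c y - \<phi> y g} \<subseteq> (\<otimes>) (inv g) ` {h \<in> K. \<phi> y h \<noteq> c y}"
    proof
      fix h assume "h \<in> {h \<in> K. \<phi> (act (inv g) y) h \<noteq> c y - \<phi> y g}"
      then have h: "h \<in> K" "\<phi> (act (inv g) y) h \<noteq> c y - \<phi> y g" by auto
      then have "\<phi> y (g \<otimes> h) \<noteq> c y"
        using mult that by auto
      moreover have "h = inv g \<otimes> (g \<otimes> h)"
        using h that by (simp add: K_carrier m_assoc[symmetric])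
      ultimately show "h \<in> (\<otimes>) (inv g) ` {h \<in> K. \<phi> y h \<noteq> c y}"
        using h that by blast
    qed
    then show "small {h \<in> K. \<phi> (act (inv g) y) h \<noteq> c y - \<phi> y g}"
      using small_left[OF c[OF that(2)]] that(1) small_subset by blast
  qed
  define Y0 where "Y0 = (\<Union>a\<in>A. Poly_Mapping.keys (\<delta> a))"
  have Y0: "finite Y0" "Y0 \<subseteq> Y"
    unfolding Y0_def using fin_A keys AK by auto
  \<comment> \<open>Off the \<open>K\<close>-orbits of the supports of the \<open>\<delta> a\<close>
    no edge makes the coefficient jump, so it is constant on the connected group \<open>K\<close>
    and equal to its value \<open>0\<close> at \<open>\<one>\<close>.\<close>
  have in_Y0: "\<exists>g\<in>K. \<exists>z\<in>Y0. y = act g z" if "y \<in> Y" "c y \<noteq> 0" for y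
  proof (rule ccontr)
    assume no: "\<not> (\<exists>g\<in>K. \<exists>z\<in>Y0. y = act g z)"
    then have flat: "\<phi> y (g \<otimes> a) = \<phi> y g" if "g \<in> K" "a \<in> A" for g a
      using W[OF \<open>y \<in> Y\<close>] that unfolding Y0_def by blast
    have "\<phi> y g = 0" if "g \<in> K" for g
    proof -
      have "conn A K \<one> g"
        using conn_generate[of A A g] A_sub that unfolding K_def by blast
      then have "\<phi> y \<one> = \<phi> y g"
        by (rule conn_const) (use flat in \<open>auto simp: cayley_adj_def\<close>)
      then show ?thesis
        using one \<open>y \<in> Y\<close> by simp
    qed
    then have "{g \<in> K. \<phi> y g \<noteq> 0} = {}" by auto
    then have "small {g \<in> K. \<phi> y g \<noteq> 0}"
      by (simp only: small_empty)
    then show False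
      using c_unique that by blast
  qed
  \<comment> \<open>By \<open>c_act\<close> a non-zero limit at \<open>act (inv g) z\<close> forces
    \<open>\<phi> z g\<close> to differ from \<open>c z\<close>, so \<open>g\<close> lies in a small
    set \<open>F V\<close>. Then \<open>act (inv g) z\<close> lies in one of finitely many
    \<open>V\<close>-orbits, each of which is finite.\<close>
  have "finite {act (inv g) z | g. g \<in> K \<and> c (act (inv g) z) \<noteq> 0}" if z: "z \<in> Y0" for z
  proof -
    have zY: "z \<in> Y" using z Y0 by blast
    obtain F where F: "finite F" "F \<subseteq> K" "{g \<in> K. \<phi> z g \<noteq> c z} \<subseteq> F <#> V"
      using c[OF zY] unfolding small_def by blast
    have "{act (inv g) z | g. g \<in> K \<and> c (act (inv g) z) \<noteq> 0} \<subseteq>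
        (\<Union>f\<in>F. (\<lambda>v. act v (act (inv f) z)) ` V)"
    proof
      fix y assume "y \<in> {act (inv g) z | g. g \<in> K \<and> c (act (inv g) z) \<noteq> 0}"
      then obtain g where g: "g \<in> K" "c (act (inv g) z) \<noteq> 0" "y = act (inv g) z" by blast
      then have "\<phi> z g \<noteq> c z"
        using c_act zY by auto
      then obtain f v where fv: "f \<in> F" "v \<in> V" "g = f \<otimes> v"
        using F(3) g(1) unfolding set_mult_def by blast
      then have K: "f \<in> K" "v \<in> K" "inv v \<in> K" "inv f \<in> K"
        using F(2) V_sub_K by auto
      have "y = act (inv v) (act (inv f) z)"
        using g(3) fv(3) K zY act_mult by (simp add: inv_mult_group K_carrier)
      moreover have "inv v \<in> V"
        using fv(2) V_subgroup subgroup.m_inv_closed by metis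
      ultimately show "y \<in> (\<Union>f\<in>F. (\<lambda>v. act v (act (inv f) z)) ` V)"
        using fv(1) by blast
    qed
    moreover have "finite (\<Union>f\<in>F. (\<lambda>v. act v (act (inv f) z)) ` V)"
      using F zY by (intro finite_UN_I orb act_closed) auto
    ultimately show ?thesis
      by (rule finite_subset)
  qed
  then have "finite (\<Union>z\<in>Y0. {act (inv g) z | g. g \<in> K \<and> c (act (inv g) z) \<noteq> 0})"
    using Y0 by blast
  moreover have "{y \<in> Y. c y \<noteq> 0} \<subseteq> (\<Union>z\<in>Y0. {act (inv g) z | g. g \<in> K \<and> c (act (inv g) z) \<noteq> 0})"
  proof
    fix y assume y: "y \<in> {y \<in> Y. c y \<noteq> 0}"
    then obtain g z where gz: "g \<in> K" "z \<in> Y0" "y = act g z"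
      using in_Y0 by blast
    then have "y = act (inv (inv g)) z" "inv g \<in> K"
      by (auto simp: K_carrier)
    then show "y \<in> (\<Union>z\<in>Y0. {act (inv g) z | g. g \<in> K \<and> c (act (inv g) z) \<noteq> 0})"
      using y gz(2) by blast
  qed
  ultimately have "finite {y \<in> Y. c y \<noteq> 0}"
    by (rule finite_subset[rotated])
  then obtain w where w: "Poly_Mapping.keys w \<subseteq> Y" "\<And>y. y \<in> Y \<Longrightarrow> Poly_Mapping.lookup w y = c y"
    using frag_of_coefficients by blast
  show thesis
  proof (rule that[OF w(1)])
    fix g assume g: "g \<in> K"
    show "\<delta> g = w - frag_map (act g) w"
    proof (rule frag_eqI)
      show "Poly_Mapping.keys (\<delta> g) \<subseteq> Y"
        using keys g .
      show "Poly_Mapping.keys (w - frag_map (act g) w) \<subseteq> Y"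
        using keys_diff[of w "frag_map (act g) w"] keys_act[OF w(1) g] w(1) by blast
      fix y assume y: "y \<in> Y"
      have "act (inv g) y \<in> Y"
        using g y act_closed by blast
      then show "Poly_Mapping.lookup (\<delta> g) y = Poly_Mapping.lookup (w - frag_map (act g) w) y"
        using c_act[OF g y] w g y by (simp add: lookup_minus lookup_act \<phi>_def)
    qed
  qed
qed

end

section \<open>Virtually cyclic subgroups\<close>

context group
begin

lemma inv_cancel_left [simp]:
  assumes "x \<in> carrier G" "y \<in> carrier G"
  shows "inv x \<otimes> (x \<otimes> y) = y" "x \<otimes> (inv x \<otimes> y) = y"
  using assms by (simp_all add: m_assoc[symmetric])

lemma int_pow_conj:
  assumes "x \<in> carrier G" "g \<in> carrier G"
  shows "(g \<otimes> x \<otimes> inv g) [^] (k::int) = g \<otimes> x [^] k \<otimes> inv g"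
proof -
  have nat: "(g \<otimes> x \<otimes> inv g) [^] (n::nat) = g \<otimes> x [^] n \<otimes> inv g" for n
  proof (induction n)
    case (Suc n)
    have "(g \<otimes> x [^] n \<otimes> inv g) \<otimes> (g \<otimes> x \<otimes> inv g) = g \<otimes> x [^] n \<otimes> (inv g \<otimes> g) \<otimes> x \<otimes> inv g"
      using assms by (simp add: m_assoc)
    then show ?case
      using Suc assms by (simp add: m_assoc)
  qed (use assms in simp)
  show ?thesis
  proof (cases k)
    case (nonneg n)
    then show ?thesis
      using nat by (simp add: int_pow_int)
  next
    case (neg n)
    then have "(g \<otimes> x \<otimes> inv g) [^] k = inv ((g \<otimes> x \<otimes> inv g) [^] Suc n)"
      using assms by (metis int_pow_neg_int m_closed inv_closed)
    also have "\<dots> = inv (g \<otimes> x [^] Suc n \<otimes> inv g)"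
      by (simp only: nat)
    also have "\<dots> = g \<otimes> inv (x [^] Suc n) \<otimes> inv g"
      using assms by (simp add: inv_mult_group m_assoc)
    also have "inv (x [^] Suc n) = x [^] k"
      using neg assms by (metis int_pow_neg_int)
    finally show ?thesis .
  qed
qed

lemma generate_singleton_carrier: "s \<in> carrier G \<Longrightarrow> x \<in> generate G {s} \<Longrightarrow> x \<in> carrier G"
  using generate_in_carrier by blast

lemma generate_pow_subset:
  assumes "s \<in> carrier G" "x \<in> generate G {s}"
  shows "generate G {x} \<subseteq> generate G {s}"
  using assms by (intro generate_subgroup_incl generate_is_subgroup) auto

text \<open>A coset that meets \<open>L\<close> may be named by any of its elements in
  \<open>L\<close>. Both \<open>small\<close> and \<open>VC_iff\<close> ask for representatives
  inside the group in question.\<close>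

lemma cover_representatives:
  assumes "subgroup V G" "finite F" "F \<subseteq> carrier G" "L \<subseteq> F <#> V" "L \<subseteq> carrier G"
  obtains F' where "finite F'" "F' \<subseteq> L" "L \<subseteq> F' <#> V"
proof -
  define r where "r f = (SOME l. l \<in> L \<and> l \<in> f <# V)" for f
  have r: "r f \<in> L \<and> r f \<in> f <# V" if "l \<in> L" "l \<in> f <# V" for l f
    unfolding r_def by (rule someI[of _ l]) (use that in auto)
  define F' where "F' = r ` {f \<in> F. \<exists>l\<in>L. l \<in> f <# V}"
  show thesis
  proof
    show "finite F'"
      unfolding F'_def using assms(2) by simp
    show "F' \<subseteq> L"
      unfolding F'_def using r by blast
    show "L \<subseteq> F' <#> V"
    proof
      fix l assume l: "l \<in> L"
      then obtain f v where fv: "f \<in> F" "v \<in> V" "l = f \<otimes> v"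
        using assms(4) unfolding set_mult_def by blast
      then have lf: "l \<in> f <# V"
        by (auto simp: l_coset_def)
      then have rf: "r f \<in> F'" "r f \<in> f <# V"
        using r l fv(1) unfolding F'_def by blast+
      then obtain u where u: "u \<in> V" "r f = f \<otimes> u"
        by (auto simp: l_coset_def)
      have c: "f \<in> carrier G" "u \<in> carrier G" "v \<in> carrier G"
        using fv u assms(1,3) subgroup.mem_carrier by auto
      then have "l = r f \<otimes> (inv u \<otimes> v)"
        unfolding fv(3) u(2) by (simp add: m_assoc)
      moreover have "inv u \<otimes> v \<in> V"
        using assms(1) u fv by (simp add: subgroup.m_closed subgroup.m_inv_closed)
      ultimately show "l \<in> F' <#> V"
        using rf(1) unfolding set_mult_def by blast
    qed
  qed
qed

text \<open>A covering by finitely many cosets of a cyclic group, written with the operations of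
  \<open>G\<close> itself, is the form in which \<open>small\<close> and \<open>cyclic_cover\<close>
  speak of finite index.\<close>

lemma VC_iff:
  "H \<in> VC G \<longleftrightarrow> subgroup H G \<and> (\<exists>c\<in>H. \<exists>F. finite F \<and> F \<subseteq> H \<and> H \<subseteq> F <#> generate G {c})"
  (is "?l \<longleftrightarrow> ?r")
proof
  assume ?l
  then obtain C where H: "subgroup H G" and C: "subgroup C (G\<lparr>carrier := H\<rparr>)"
      "cyclic_group (G\<lparr>carrier := C\<rparr>)" "finite (lcosets\<^bsub>G\<lparr>carrier := H\<rparr>\<^esub> C)"
    by (auto simp: VC_def virtually_cyclic_def)
  have CG: "subgroup C G"
    using C(1) H incl_subgroup by blast
  have CH: "C \<subseteq> H"
    using subgroup.subset[OF C(1)] by simp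
  have HG: "H \<subseteq> carrier G"
    using H subgroup.subset by blast
  obtain c where c: "c \<in> C" "C = range (\<lambda>n::int. c [^]\<^bsub>G\<lparr>carrier := C\<rparr>\<^esub> n)"
    using C(2) group.cyclic_group[OF subgroup_imp_group[OF CG]] by auto
  have "C = generate G {c}"
    using c int_pow_consistent[OF CG c(1)] generate_pow[of c] CG by (auto simp: subgroup.mem_carrier)
  define r where "r D = (SOME x. x \<in> H \<and> D = x <# C)" for D
  have r: "r D \<in> H \<and> D = r D <# C" if "D \<in> lcosets\<^bsub>G\<lparr>carrier := H\<rparr>\<^esub> C" for D
  proof -
    have "\<exists>x\<in>H. D = x <# C"
      using that by (auto simp: LCOSETS_def l_coset_def)
    then obtain x where "x \<in> H" "D = x <# C" by blast
    then show ?thesis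
      unfolding r_def by (metis (mono_tags, lifting) someI)
  qed
  have "H \<subseteq> r ` (lcosets\<^bsub>G\<lparr>carrier := H\<rparr>\<^esub> C) <#> C"
  proof
    fix h assume h: "h \<in> H"
    then have D: "h <# C \<in> lcosets\<^bsub>G\<lparr>carrier := H\<rparr>\<^esub> C"
      by (auto simp: LCOSETS_def l_coset_def)
    then have "h \<in> r (h <# C) <# C"
      using r h HG CG lcos_self by blast
    then show "h \<in> r ` (lcosets\<^bsub>G\<lparr>carrier := H\<rparr>\<^esub> C) <#> C"
      using D by (auto simp: l_coset_def set_mult_def)
  qed
  then show ?r
    using H C(3) c(1) CH r \<open>C = generate G {c}\<close>
    by (intro conjI bexI[of _ c] exI[of _ "r ` (lcosets\<^bsub>G\<lparr>carrier := H\<rparr>\<^esub> C)"]) auto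
next
  assume ?r
  then obtain c F where H: "subgroup H G" and c: "c \<in> H" and F: "finite F" "F \<subseteq> H" "H \<subseteq> F <#> generate G {c}"
    by blast
  interpret GH: group "G\<lparr>carrier := H\<rparr>"
    using H by (rule subgroup_imp_group)
  have HG: "H \<subseteq> carrier G"
    using H subgroup.subset by blast
  define C where "C = generate G {c}"
  have CG: "subgroup C G"
    unfolding C_def using c HG by (intro generate_is_subgroup) auto
  have CH: "C \<subseteq> H"
    unfolding C_def using c H by (intro generate_subgroup_incl) auto
  have sub: "subgroup C (G\<lparr>carrier := H\<rparr>)"
    using CG CH H subgroup_incl by blast
  have cC: "c \<in> C"
    unfolding C_def by (simp add: generate.incl)
  have "C = range (\<lambda>n::int. c [^]\<^bsub>G\<lparr>carrier := C\<rparr>\<^esub> n)"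
    using int_pow_consistent[OF CG cC] generate_pow[of c] c HG unfolding C_def by auto
  then have cyc: "cyclic_group (G\<lparr>carrier := C\<rparr>)"
    using group.cyclic_group[OF subgroup_imp_group[OF CG]] cC by auto
  have "lcosets\<^bsub>G\<lparr>carrier := H\<rparr>\<^esub> C \<subseteq> (\<lambda>f. f <# C) ` F"
  proof
    fix D assume "D \<in> lcosets\<^bsub>G\<lparr>carrier := H\<rparr>\<^esub> C"
    then obtain h where h: "h \<in> H" "D = h <# C"
      by (auto simp: LCOSETS_def l_coset_def)
    then obtain f v where fv: "f \<in> F" "v \<in> C" "h = f \<otimes> v"
      using F(3) unfolding set_mult_def C_def by blast
    then have "h \<in> f <# C"
      by (auto simp: l_coset_def)
    then have "f <# C = h <# C"
      using l_repr_independence[OF _ _ CG] fv(1) F(2) HG by blast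
    then show "D \<in> (\<lambda>f. f <# C) ` F"
      using h fv by blast
  qed
  then have "finite (lcosets\<^bsub>G\<lparr>carrier := H\<rparr>\<^esub> C)"
    using F(1) finite_subset by blast
  then show ?l
    using H sub cyc by (auto simp: VC_def virtually_cyclic_def)
qed

lemma generate_singleton_VC: "g \<in> carrier G \<Longrightarrow> generate G {g} \<in> VC G"
  unfolding VC_iff
  by (intro conjI generate_is_subgroup bexI[of _ g] exI[of _ "{\<one>}"])
     (auto simp: set_mult_def generate.one generate.incl generate_singleton_carrier)

lemma VC_conj:
  assumes "H \<in> VC G" "g \<in> carrier G"
  shows "(\<lambda>h. g \<otimes> h \<otimes> inv g) ` H \<in> VC G"
proof -
  obtain c F where H: "subgroup H G" "c \<in> H" "finite F" "F \<subseteq> H" "H \<subseteq> F <#> generate G {c}"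
    using assms(1) unfolding VC_iff by blast
  let ?i = "\<lambda>h. g \<otimes> h \<otimes> inv g"
  have HG: "h \<in> carrier G" if "h \<in> H" for h
    using that subgroup.mem_carrier[OF H(1)] by auto
  have mult: "?i (x \<otimes> y) = ?i x \<otimes> ?i y" if "x \<in> carrier G" "y \<in> carrier G" for x y
  proof -
    have "?i x \<otimes> ?i y = g \<otimes> x \<otimes> (inv g \<otimes> g) \<otimes> y \<otimes> inv g"
      using that assms(2) by (simp add: m_assoc)
    then show ?thesis
      using that assms(2) by (simp add: m_assoc)
  qed
  have "?i ` H \<subseteq> (?i ` F) <#> generate G {?i c}"
  proof
    fix x assume "x \<in> ?i ` H"
    then obtain h where h: "h \<in> H" "x = ?i h" by blast
    then obtain f k where fk: "f \<in> F" "h = f \<otimes> c [^] (k::int)"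
      using H generate_pow[of c] HG by (force simp: set_mult_def)
    have "x = ?i f \<otimes> ?i c [^] k"
      using h fk mult H(2,4) HG assms(2) by (simp add: int_pow_conj subset_iff)
    moreover have "?i c [^] k \<in> generate G {?i c}"
      using generate_pow[of "?i c"] H(2) HG assms(2) by auto
    ultimately show "x \<in> (?i ` F) <#> generate G {?i c}"
      using fk(1) unfolding set_mult_def by blast
  qed
  moreover have "subgroup (?i ` H) G"
  proof (rule subgroupI)
    show "?i ` H \<subseteq> carrier G"
      using HG assms(2) by auto
    show "?i ` H \<noteq> {}"
      using H(2) by blast
    fix x assume "x \<in> ?i ` H"
    then obtain h where h: "h \<in> H" "x = ?i h" by blast
    then have "inv x = ?i (inv h)"
      using HG assms(2) by (simp add: inv_mult_group m_assoc)
    then show "inv x \<in> ?i ` H"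
      using h subgroup.m_inv_closed[OF H(1)] by blast
    fix y assume "y \<in> ?i ` H"
    then obtain h' where h': "h' \<in> H" "y = ?i h'" by blast
    then have "x \<otimes> y = ?i (h \<otimes> h')"
      using h mult HG by simp
    then show "x \<otimes> y \<in> ?i ` H"
      using h h' subgroup.m_closed[OF H(1)] by blast
  qed
  moreover have "finite (?i ` F)" "?i ` F \<subseteq> ?i ` H" "?i c \<in> ?i ` H"
    using H(2-4) by auto
  ultimately show ?thesis
    unfolding VC_iff by (intro conjI bexI[of _ "?i c"] exI[of _ "?i ` F"])
qed

text \<open>A list of generators names the subgroup; this bounds the number of orbits by the number
  of lists of group elements.\<close>

lemma VC_finitely_generated:
  assumes "H \<in> VC G"
  obtains xs where "set xs \<subseteq> carrier G" "H = generate G (set xs)"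
proof -
  obtain c F where H: "subgroup H G" "c \<in> H" "finite F" "F \<subseteq> H" "H \<subseteq> F <#> generate G {c}"
    using assms(1) unfolding VC_iff by blast
  obtain xs where xs: "set xs = insert c F"
    using finite_list H(3) by (metis finite_insert)
  have "generate G (set xs) \<subseteq> H"
    using xs H by (intro generate_subgroup_incl) auto
  moreover have "H \<subseteq> generate G (set xs)"
  proof
    fix h assume "h \<in> H"
    then obtain f v where fv: "f \<in> F" "v \<in> generate G {c}" "h = f \<otimes> v"
      using H(5) unfolding set_mult_def by blast
    then have "v \<in> generate G (set xs)"
      using mono_generate[of "{c}" "set xs"] xs by auto
    then show "h \<in> generate G (set xs)"
      using fv xs by (auto intro: generate.eng generate.incl)
  qed
  moreover have "set xs \<subseteq> carrier G"
    using xs H subgroup.mem_carrier by fastforce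
  ultimately show thesis
    using that by blast
qed

text \<open>Pigeonhole: two powers of \<open>g\<close> fall into the same left coset of
  \<open>V\<close>, and their quotient is the power sought.\<close>

lemma finite_index_power:
  assumes "subgroup V G" "finite F" "F \<subseteq> carrier G" "g \<in> carrier G" "\<And>n::nat. g [^] n \<in> F <#> V"
  shows "\<exists>n>0. g [^] (n::nat) \<in> V"
proof -
  define r where "r n = (SOME f. f \<in> F \<and> g [^] n \<in> f <# V)" for n :: nat
  have r: "r n \<in> F \<and> g [^] n \<in> r n <# V" for n
  proof -
    have "\<exists>f. f \<in> F \<and> g [^] n \<in> f <# V"
      using assms(5)[of n] by (auto simp: l_coset_def set_mult_def)
    then show ?thesis
      unfolding r_def by (rule someI_ex)
  qed
  have "\<not> inj r"
  proof
    assume "inj r"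
    then have "infinite (range r)"
      by (simp add: finite_image_iff)
    moreover have "range r \<subseteq> F"
      using r by blast
    ultimately show False
      using assms(2) finite_subset by blast
  qed
  then obtain i j where "r i = r j" "i \<noteq> j"
    unfolding inj_def by blast
  then obtain i j where ij: "r i = r j" "i < j"
    by (metis nat_neq_iff)
  obtain u v where uv: "u \<in> V" "v \<in> V" "g [^] i = r i \<otimes> u" "g [^] j = r i \<otimes> v"
    using r[of i] r[of j] ij(1) by (auto simp: l_coset_def)
  have c: "r i \<in> carrier G" "u \<in> carrier G" "v \<in> carrier G"
    using uv(1,2) r[of i] assms(3) subgroup.mem_carrier[OF assms(1)] by auto
  have "g [^] i \<otimes> g [^] (j - i) = g [^] j"
    using assms(4) ij(2) by (simp add: nat_pow_mult)
  then have "g [^] (j - i) = inv (g [^] i) \<otimes> g [^] j"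
    using assms(4) by (metis inv_cancel_left(1) nat_pow_closed)
  also have "\<dots> = inv u \<otimes> v"
    using c uv by (simp add: inv_mult_group m_assoc)
  finally have "g [^] (j - i) \<in> V"
    using uv assms(1) by (simp add: subgroup.m_closed subgroup.m_inv_closed)
  then show ?thesis
    using ij(2) by (intro exI[of _ "j - i"]) auto
qed

text \<open>Division of the exponent by \<open>p\<close> with remainder.\<close>

lemma cyclic_cover:
  assumes "c \<in> carrier G" "p > 0"
  shows "generate G {c} \<subseteq> ((\<lambda>j. c [^] j) ` {..<p}) <#> generate G {c [^] (p::nat)}"
proof
  fix x assume "x \<in> generate G {c}"
  then obtain k :: int where k: "x = c [^] k"
    using generate_pow assms(1) by blast
  let ?j = "nat (k mod int p)"
  have "c [^] k = c [^] (int ?j) \<otimes> c [^] (int p * (k div int p))"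
    using assms int_pow_mult[of c "int ?j" "int p * (k div int p)"] by simp
  also have "\<dots> = c [^] ?j \<otimes> (c [^] p) [^] (k div int p)"
    using assms(1) by (metis int_pow_int int_pow_pow)
  finally have "x = c [^] ?j \<otimes> (c [^] p) [^] (k div int p)"
    using k by simp
  moreover have "?j < p"
    using assms(2) by (simp add: nat_less_iff)
  moreover have "(c [^] p) [^] (k div int p) \<in> generate G {c [^] p}"
    using generate_pow[of "c [^] p"] assms(1) by auto
  ultimately show "x \<in> ((\<lambda>j. c [^] j) ` {..<p}) <#> generate G {c [^] p}"
    unfolding set_mult_def by blast
qed

text \<open>If a positive power of \<open>c\<close> lies in \<open>L\<close>, then a further power
  of it lies in the cyclic group of \<open>s\<close>, so finitely many cosets of that group cover
  \<open>H\<close>. Otherwise \<open>L\<close> meets the cyclic group of \<open>c\<close> trivially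
  and is finite, because its elements lie in distinct cosets of it.\<close>

lemma VC_cover:
  assumes "H \<in> VC G" "subgroup L G" "L \<subseteq> H" "s \<in> carrier G"
    and pow: "\<And>g. g \<in> L \<Longrightarrow> \<exists>n>0. g [^] (n::nat) \<in> generate G {s}"
  obtains F where "finite F" "F \<subseteq> L" "L \<subseteq> F <#> generate G {s}"
proof -
  obtain c F where H: "subgroup H G" "c \<in> H" "finite F" "F \<subseteq> H" "H \<subseteq> F <#> generate G {c}"
    using assms(1) unfolding VC_iff by blast
  have HG: "h \<in> carrier G" if "h \<in> H" for h
    using that subgroup.mem_carrier[OF H(1)] by auto
  have cG: "c \<in> carrier G"
    using H HG by blast
  let ?V = "generate G {s}"
  have V: "subgroup ?V G"
    using assms(4) by (intro generate_is_subgroup) auto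
  have "\<exists>F. finite F \<and> F \<subseteq> carrier G \<and> L \<subseteq> F <#> ?V"
  proof (cases "\<exists>k>0. c [^] (k::nat) \<in> L")
    case True
    then obtain k where k: "k > 0" "c [^] (k::nat) \<in> L" by blast
    obtain m where m: "m > 0" "(c [^] k) [^] (m::nat) \<in> ?V"
      using pow[OF k(2)] by blast
    define p where "p = k * m"
    have p: "p > 0" "c [^] p \<in> ?V"
      using k m cG by (auto simp: p_def nat_pow_pow)
    let ?P = "(\<lambda>j. c [^] j) ` {..<p}"
    have "L \<subseteq> (F <#> ?P) <#> ?V"
    proof
      fix l assume "l \<in> L"
      then obtain f x where fx: "f \<in> F" "x \<in> generate G {c}" "l = f \<otimes> x"
        using assms(3) H(5) unfolding set_mult_def by blast
      then obtain q v where qv: "q \<in> ?P" "v \<in> generate G {c [^] p}" "x = q \<otimes> v"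
        using cyclic_cover[OF cG p(1)] unfolding set_mult_def by blast
      have "v \<in> ?V"
        using qv generate_pow_subset[OF assms(4) p(2)] by blast
      moreover have "l = (f \<otimes> q) \<otimes> v"
        using fx qv H HG cG generate_singleton_carrier[OF assms(4) \<open>v \<in> ?V\<close>]
        by (auto simp: m_assoc)
      moreover have "f \<otimes> q \<in> F <#> ?P"
        using fx qv unfolding set_mult_def by blast
      ultimately show "l \<in> (F <#> ?P) <#> ?V"
        unfolding set_mult_def[of _ "F <#> ?P"] by blast
    qed
    moreover have "finite (F <#> ?P)"
      using H(3) by (simp add: set_mult_def)
    moreover have "F <#> ?P \<subseteq> carrier G"
      using H HG cG by (auto simp: set_mult_def)
    ultimately show ?thesis
      by blast
  next
    case no_power: False
    have triv: "x = \<one>" if x: "x \<in> L" "x \<in> generate G {c}" for x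
    proof -
      obtain k :: int where k: "x = c [^] k"
        using generate_pow[OF cG] x by blast
      have "c [^] nat \<bar>k\<bar> \<in> L"
      proof (cases "k \<ge> 0")
        case True
        then show ?thesis
          using x k cG by (metis abs_of_nonneg int_pow_int nat_0_le)
      next
        case False
        then have "c [^] nat \<bar>k\<bar> = inv x"
          using k cG by (metis abs_of_neg int_pow_int int_pow_neg nat_0_le neg_0_le_iff_le linorder_not_le order_less_imp_le)
        then show ?thesis
          using x assms(2) by (simp add: subgroup.m_inv_closed)
      qed
      then have "nat \<bar>k\<bar> = 0"
        using no_power by (metis gr0I)
      then have "k = 0"
        by simp
      then show ?thesis
        using k by simp
    qed
    define r where "r l = (SOME f. f \<in> F \<and> l \<in> f <# generate G {c})" for l
    have r: "r l \<in> F \<and> l \<in> r l <# generate G {c}" if "l \<in> L" for l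
    proof -
      have "l \<in> F <#> generate G {c}"
        using that assms(3) H(5) by blast
      then have "\<exists>f. f \<in> F \<and> l \<in> f <# generate G {c}"
        by (auto simp: l_coset_def set_mult_def)
      then show ?thesis
        unfolding r_def by (rule someI_ex)
    qed
    have "inj_on r L"
    proof (rule inj_onI)
      fix l l' assume l: "l \<in> L" "l' \<in> L" "r l = r l'"
      have "l \<in> r l <# generate G {c}" "l' \<in> r l <# generate G {c}"
        using r[OF l(1)] r[OF l(2)] l(3) by simp_all
      then obtain u v where uv: "u \<in> generate G {c}" "v \<in> generate G {c}" "l = r l \<otimes> u" "l' = r l \<otimes> v"
        unfolding l_coset_def by blast
      have c: "r l \<in> carrier G" "u \<in> carrier G" "v \<in> carrier G"
        using r[OF l(1)] H(4) HG generate_singleton_carrier[OF cG uv(1)]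
          generate_singleton_carrier[OF cG uv(2)] by blast+
      have "inv l \<otimes> l' = inv (r l \<otimes> u) \<otimes> (r l \<otimes> v)"
        using uv(3,4) by simp
      also have "\<dots> = inv u \<otimes> v"
        using c by (simp add: inv_mult_group m_assoc)
      finally have "inv l \<otimes> l' = inv u \<otimes> v" .
      moreover have "inv u \<otimes> v \<in> generate G {c}"
        using uv cG generate_is_subgroup[of "{c}"] by (simp add: subgroup.m_closed subgroup.m_inv_closed)
      moreover have "inv l \<otimes> l' \<in> L"
        using l assms(2) by (simp add: subgroup.m_closed subgroup.m_inv_closed)
      ultimately have "inv l \<otimes> l' = \<one>"
        using triv by metis
      then show "l = l'"
        using l assms(2) subgroup.mem_carrier inv_equality by (metis inv_closed inv_inv)
    qed
    then have "finite L"
      using r H(3) by (meson finite_imageD finite_subset image_subsetI)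
    moreover have "L \<subseteq> L <#> ?V"
      using assms(2) subgroup.mem_carrier generate.one[of G "{s}"] r_one unfolding set_mult_def by force
    ultimately show ?thesis
      using assms(2) subgroup.subset by blast
  qed
  then show thesis
    using cover_representatives[OF V] that subgroup.subset[OF assms(2)] by metis
qed

lemma VC_power:
  assumes "H \<in> VC G" "c \<in> H" "finite F" "F \<subseteq> H" "H \<subseteq> F <#> generate G {c}" "g \<in> H"
  shows "\<exists>n>0. g [^] (n::nat) \<in> generate G {c}"
proof -
  have H: "subgroup H G"
    using assms(1) by (simp add: VC_def)
  have "g [^] n \<in> H" for n :: nat
    using H assms(6) by (metis int_pow_int subgroup_int_pow_closed)
  then show ?thesis
    using assms subgroup.subset[OF H]
    by (intro finite_index_power[of _ F] generate_is_subgroup) auto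
qed

text \<open>Both elements have positive powers in one cyclic group, say \<open>s^a = c^i\<close> and
  \<open>t^b = c^j\<close>. Here \<open>j\<close> is non-zero because \<open>t\<close> has infinite
  order, and raising the first equation to the power \<open>|j|\<close> expresses the result through
  \<open>t\<close>.\<close>

lemma VC_commensurable:
  assumes "H \<in> VC G" "s \<in> H" "t \<in> H" and inf: "\<And>n. n > 0 \<Longrightarrow> t [^] (n::nat) \<noteq> \<one>"
  shows "\<exists>n>0. s [^] (n::nat) \<in> generate G {t}"
proof -
  obtain c F where H: "subgroup H G" "c \<in> H" "finite F" "F \<subseteq> H" "H \<subseteq> F <#> generate G {c}"
    using assms(1) unfolding VC_iff by blast
  have G: "c \<in> carrier G" "s \<in> carrier G" "t \<in> carrier G"
    using H(2) assms(2,3) subgroup.mem_carrier[OF H(1)] by auto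
  obtain a i where a: "a > 0" "s [^] (a::nat) = c [^] (i::int)"
    using VC_power[OF assms(1) H(2-5) assms(2)] generate_pow[OF G(1)] by blast
  obtain b j where b: "b > 0" "t [^] (b::nat) = c [^] (j::int)"
    using VC_power[OF assms(1) H(2-5) assms(3)] generate_pow[OF G(1)] by blast
  have j: "j \<noteq> 0"
    using b inf by auto
  have "s [^] (a * nat \<bar>j\<bar>) = s [^] (int a * \<bar>j\<bar>)"
    using G by (metis abs_ge_zero int_nat_eq int_pow_int of_nat_mult)
  also have "\<dots> = (c [^] i) [^] \<bar>j\<bar>"
    using a G by (metis int_pow_int int_pow_pow)
  also have "\<dots> = c [^] (j * (sgn j * i))"
    using G by (simp add: int_pow_pow abs_sgn mult.commute mult.left_commute)
  also have "\<dots> = t [^] (int b * (sgn j * i))"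
    using b G by (metis int_pow_int int_pow_pow)
  finally have "s [^] (a * nat \<bar>j\<bar>) \<in> generate G {t}"
    using generate_pow[OF G(3)] by auto
  then show ?thesis
    using a j by (intro exI[of _ "a * nat \<bar>j\<bar>"]) auto
qed

text \<open>A torsion group satisfies the hypothesis of \<open>VC_cover\<close> with
  \<open>s = \<one>\<close>, and finitely many cosets of the trivial group form a finite
  set.\<close>

lemma VC_infinite_order:
  assumes "H \<in> VC G" "infinite H"
  obtains g where "g \<in> H" "\<And>n. n > 0 \<Longrightarrow> g [^] (n::nat) \<noteq> \<one>"
proof -
  have H: "subgroup H G"
    using assms(1) by (simp add: VC_def)
  have "\<exists>g\<in>H. \<forall>n>0. g [^] (n::nat) \<noteq> \<one>"
  proof (rule ccontr)
    assume no: "\<not> (\<exists>g\<in>H. \<forall>n>0. g [^] (n::nat) \<noteq> \<one>)"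
    have pow: "\<exists>n>0. g [^] (n::nat) \<in> generate G {\<one>}" if "g \<in> H" for g
      using no that generate.one[of G "{\<one>}"] by metis
    obtain F where F: "finite F" "F \<subseteq> H" "H \<subseteq> F <#> generate G {\<one>}"
      by (rule VC_cover[OF assms(1) H order_refl one_closed pow])
    have "finite (F <#> generate G {\<one>})"
      using F(1) generate_one by (simp add: set_mult_def)
    then show False
      using F(3) assms(2) finite_subset by blast
  qed
  then show thesis
    using that by blast
qed

end

section \<open>Serre's lemma for complexes of permutation modules\<close>

text \<open>The projection of a permutation module onto the span of the points in \<open>S\<close>;
  it is equivariant when \<open>S\<close> is invariant.\<close>

definition frag_restrict :: "'y set \<Rightarrow> ('y \<Rightarrow>\<^sub>0 int) \<Rightarrow> ('y \<Rightarrow>\<^sub>0 int)" where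
  "frag_restrict S = frag_extend (\<lambda>y. if y \<in> S then frag_of y else 0)"

lemma lookup_frag_restrict:
  "Poly_Mapping.lookup (frag_restrict S c) y = (if y \<in> S then Poly_Mapping.lookup c y else 0)"
  unfolding frag_restrict_def using subset_UNIV
  by (induction c rule: frag_induction) (auto simp: frag_extend_diff lookup_minus)

lemma keys_frag_restrict: "Poly_Mapping.keys (frag_restrict S c) = Poly_Mapping.keys c \<inter> S"
  by (auto simp: in_keys_iff lookup_frag_restrict split: if_splits)

lemma frag_restrict_diff: "frag_restrict S (a - b) = frag_restrict S a - frag_restrict S b"
  by (simp add: frag_restrict_def frag_extend_diff)

lemma frag_restrict_add: "frag_restrict S (a + b) = frag_restrict S a + frag_restrict S b"
  by (simp add: frag_restrict_def frag_extend_add)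

lemma frag_restrict_map:
  assumes "Poly_Mapping.keys c \<subseteq> Y" "\<And>y. y \<in> Y \<Longrightarrow> f y \<in> S \<longleftrightarrow> y \<in> S"
  shows "frag_restrict S (frag_map f c) = frag_map f (frag_restrict S c)"
  using assms(1) unfolding frag_restrict_def
  by (induction c rule: frag_induction) (auto simp: frag_extend_diff assms(2))

context group
begin

lemma pow_inj:
  assumes "g \<in> carrier G" "\<And>n. n > 0 \<Longrightarrow> g [^] (n::nat) \<noteq> \<one>"
  shows "inj (\<lambda>n::nat. g [^] n)"
proof -
  have "i = j" if "g [^] i = g [^] j" "i \<le> j" for i j :: nat
  proof (rule ccontr)
    assume "i \<noteq> j"
    have "g [^] i \<otimes> g [^] (j - i) = g [^] j"
      using assms(1) that(2) by (simp add: nat_pow_mult)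
    then have "g [^] i \<otimes> g [^] (j - i) = g [^] i"
      using that(1) by simp
    then have "g [^] (j - i) = \<one>"
      using assms(1) by (metis inv_cancel_left(1) l_inv nat_pow_closed)
    then show False
      using assms(2) that(2) \<open>i \<noteq> j\<close> by (metis diff_is_0_eq gr0I le_antisym)
  qed
  then show ?thesis
    unfolding inj_def by (metis nat_le_linear)
qed

lemma pow_in_generate: "g \<in> carrier G \<Longrightarrow> g [^] (n::nat) \<in> generate G {g}"
  using generate_pow[of g] int_pow_int[of G g n, symmetric] by auto

lemma pow_in_subgroup: "subgroup H G \<Longrightarrow> g \<in> H \<Longrightarrow> g [^] (n::nat) \<in> H"
  by (metis int_pow_int subgroup_int_pow_closed)

end

section \<open>Sets with virtually cyclic stabilisers and their permutation modules\<close>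

locale VC_set = group +
  fixes S :: "'x set" and act :: "'a \<Rightarrow> 'x \<Rightarrow> 'x"
  assumes act_closed [simp]: "\<And>g x. g \<in> carrier G \<Longrightarrow> x \<in> S \<Longrightarrow> act g x \<in> S"
    and act_one [simp]: "\<And>x. x \<in> S \<Longrightarrow> act \<one> x = x"
    and act_mult: "\<And>g h x. g \<in> carrier G \<Longrightarrow> h \<in> carrier G \<Longrightarrow> x \<in> S \<Longrightarrow> act (g \<otimes> h) x = act g (act h x)"
    and stab_VC: "\<And>x. x \<in> S \<Longrightarrow> {g \<in> carrier G. act g x = x} \<in> VC G"
begin

definition stab :: "'x \<Rightarrow> 'a set" where
  "stab x = {g \<in> carrier G. act g x = x}"

definition fixed :: "'a set \<Rightarrow> 'x set" where
  "fixed H = {x \<in> S. \<forall>h\<in>H. act h x = x}"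

lemma stab_in_VC: "x \<in> S \<Longrightarrow> stab x \<in> VC G"
  unfolding stab_def by (rule stab_VC)

lemma stab_subgroup: "x \<in> S \<Longrightarrow> subgroup (stab x) G"
  using stab_in_VC unfolding VC_def by blast

lemma fixed_sub: "fixed H \<subseteq> S"
  unfolding fixed_def by blast

lemma act_inv [simp]: "g \<in> carrier G \<Longrightarrow> x \<in> S \<Longrightarrow> act (inv g) (act g x) = x"
  by (metis act_mult act_one inv_closed l_inv)

lemma act_inv' [simp]: "g \<in> carrier G \<Longrightarrow> x \<in> S \<Longrightarrow> act g (act (inv g) x) = x"
  by (metis act_mult act_one inv_closed r_inv)

lemma fixed_generateI:
  assumes "x \<in> S" "s \<in> carrier G" "act s x = x"
  shows "x \<in> fixed (generate G {s})"
proof -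
  have "generate G {s} \<subseteq> stab x"
    using assms stab_subgroup by (intro generate_subgroup_incl) (auto simp: stab_def)
  then show ?thesis
    using assms(1) unfolding fixed_def stab_def by blast
qed

lemma lookup_act:
  assumes "Poly_Mapping.keys c \<subseteq> S" "g \<in> carrier G" "x \<in> S"
  shows "Poly_Mapping.lookup (frag_map (act g) c) x = Poly_Mapping.lookup c (act (inv g) x)"
  by (rule lookup_frag_map[OF assms(1)]) (use assms act_inv act_inv' in auto)

lemma keys_act:
  "Poly_Mapping.keys c \<subseteq> S \<Longrightarrow> g \<in> carrier G \<Longrightarrow> Poly_Mapping.keys (frag_map (act g) c) \<subseteq> S"
  using keys_frag_map[of "act g" c] by force

lemma act_frag_mult:
  "Poly_Mapping.keys c \<subseteq> S \<Longrightarrow> g \<in> carrier G \<Longrightarrow> h \<in> carrier G \<Longrightarrow>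
    frag_map (act (g \<otimes> h)) c = frag_map (act g) (frag_map (act h) c)"
  unfolding frag_map_compose by (erule frag_map_cong) (simp add: act_mult)

lemma act_frag_fixed:
  "Poly_Mapping.keys c \<subseteq> fixed H \<Longrightarrow> h \<in> H \<Longrightarrow> frag_map (act h) c = c"
  by (erule frag_map_id) (simp add: fixed_def)

lemma transporter_coset:
  assumes "x \<in> S" "g0 \<in> carrier G" "act g0 x = x'" "g \<in> carrier G" "act g x = x'"
  shows "inv g0 \<otimes> g \<in> stab x" "g = g0 \<otimes> (inv g0 \<otimes> g)"
  using assms act_inv[of g0 x] by (auto simp: stab_def act_mult)

lemma finite_transporter:
  assumes "x \<in> S" "finite (stab x)" "finite Z"
  shows "finite {g \<in> carrier G. act g x \<in> Z}"
proof -
  have "finite {g \<in> carrier G. act g x = z}" for z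
  proof (cases "\<exists>g0\<in>carrier G. act g0 x = z")
    case True
    then obtain g0 where g0: "g0 \<in> carrier G" "act g0 x = z" by blast
    have "{g \<in> carrier G. act g x = z} \<subseteq> (\<otimes>) g0 ` stab x"
      using transporter_coset[OF assms(1) g0] by blast
    then show ?thesis
      using assms(2) finite_subset by blast
  next
    case False
    then have "{g \<in> carrier G. act g x = z} = {}" by blast
    then show ?thesis
      by (simp only: finite.emptyI)
  qed
  then have "finite (\<Union>z\<in>Z. {g \<in> carrier G. act g x = z})"
    using assms(3) by blast
  moreover have "{g \<in> carrier G. act g x \<in> Z} = (\<Union>z\<in>Z. {g \<in> carrier G. act g x = z})"
    by blast
  ultimately show ?thesis
    by simp
qed

text \<open>An element of infinite order has only infinite orbits on points with finite stabiliser,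
  whereas an invariant vector has a finite invariant support.\<close>

lemma invariant_finite_stab_zero:
  assumes "Poly_Mapping.keys w \<subseteq> {x \<in> S. finite (stab x)}" "s \<in> carrier G"
    and inf: "\<And>n. n > 0 \<Longrightarrow> s [^] (n::nat) \<noteq> \<one>"
    and inv: "frag_map (act s) w = w"
  shows "w = 0"
proof (rule ccontr)
  assume "w \<noteq> 0"
  then obtain x where x: "x \<in> Poly_Mapping.keys w"
    by (metis all_not_in_conv keys_eq_empty)
  then have xX: "x \<in> S" "finite (stab x)"
    using assms(1) by auto
  have wX: "Poly_Mapping.keys w \<subseteq> S"
    using assms(1) by auto
  have "act (s [^] n) x \<in> Poly_Mapping.keys w" for n :: nat
  proof (induction n)
    case (Suc n)
    let ?y = "act (s [^] n) x"
    have "Poly_Mapping.lookup (frag_map (act s) w) (act s ?y) = Poly_Mapping.lookup w ?y"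
      using lookup_act[OF wX assms(2), of "act s ?y"] assms(2) xX by simp
    then have "act s ?y \<in> Poly_Mapping.keys w"
      using Suc inv by (simp add: in_keys_iff)
    then show ?case
      using assms(2) xX(1) by (metis act_mult nat_pow_Suc2 nat_pow_closed)
  qed (use x xX in simp)
  then have "range (\<lambda>n::nat. s [^] n) \<subseteq> {g \<in> carrier G. act g x \<in> Poly_Mapping.keys w}"
    using assms(2) by auto
  then have "finite (range (\<lambda>n::nat. s [^] n))"
    using finite_transporter[OF xX finite_keys] finite_subset by blast
  then show False
    using pow_inj[OF assms(2) inf] finite_imageD by blast
qed

end

text \<open>\<open>M0\<close> and \<open>M1\<close> stand for the direct summands of \<open>Z[Vx]\<close> and \<open>Z[Ed]\<close> that are the values of the
  projective modules at the orbit of the trivial subgroup; exactness only holds for them.\<close>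

locale bredon_complex =
  Vx: VC_set G Vx actV + Ed: VC_set G Ed actE
  for G (structure) and Vx :: "'x set" and actV and Ed :: "'y set" and actE +
  fixes D :: "'y \<Rightarrow> 'x \<Rightarrow>\<^sub>0 int" and E :: "('x \<Rightarrow>\<^sub>0 int) \<Rightarrow> int"
    and M0 :: "('x \<Rightarrow>\<^sub>0 int) set" and M1 :: "('y \<Rightarrow>\<^sub>0 int) set"
  assumes D_fixed: "\<And>y. y \<in> Ed \<Longrightarrow> Poly_Mapping.keys (D y) \<subseteq> Vx.fixed (Ed.stab y)"
    and D_act: "\<And>g y. g \<in> carrier G \<Longrightarrow> y \<in> Ed \<Longrightarrow> D (actE g y) = frag_map (actV g) (D y)"
    and E_diff: "\<And>a b. Poly_Mapping.keys a \<subseteq> Vx \<Longrightarrow> Poly_Mapping.keys b \<subseteq> Vx \<Longrightarrow> E (a - b) = E a - E b"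
    and E_act: "\<And>g a. g \<in> carrier G \<Longrightarrow> Poly_Mapping.keys a \<subseteq> Vx \<Longrightarrow> E (frag_map (actV g) a) = E a"
    and E_D: "\<And>c. Poly_Mapping.keys c \<subseteq> Ed \<Longrightarrow> E (frag_extend D c) = 0"
    and M0_sub: "\<And>a. a \<in> M0 \<Longrightarrow> Poly_Mapping.keys a \<subseteq> Vx"
    and M0_diff: "\<And>a b. a \<in> M0 \<Longrightarrow> b \<in> M0 \<Longrightarrow> a - b \<in> M0"
    and M0_act: "\<And>g a. g \<in> carrier G \<Longrightarrow> a \<in> M0 \<Longrightarrow> frag_map (actV g) a \<in> M0"
    and M1_sub: "\<And>a. a \<in> M1 \<Longrightarrow> Poly_Mapping.keys a \<subseteq> Ed"
    and M1_diff: "\<And>a b. a \<in> M1 \<Longrightarrow> b \<in> M1 \<Longrightarrow> a - b \<in> M1"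
    and M1_act: "\<And>g a. g \<in> carrier G \<Longrightarrow> a \<in> M1 \<Longrightarrow> frag_map (actE g) a \<in> M1"
    and D_inj: "\<And>a. a \<in> M1 \<Longrightarrow> frag_extend D a = 0 \<Longrightarrow> a = 0"
    and fixed_point: "\<And>H. H \<in> VC G \<Longrightarrow> \<exists>v\<in>M0. Poly_Mapping.keys v \<subseteq> Vx.fixed H \<and> E v = 1"
    and exact: "\<And>H v. H \<in> VC G \<Longrightarrow> v \<in> M0 \<Longrightarrow> Poly_Mapping.keys v \<subseteq> Vx.fixed H \<Longrightarrow> E v = 0 \<Longrightarrow>
        \<exists>e\<in>M1. Poly_Mapping.keys e \<subseteq> Ed.fixed H \<and> frag_extend D e = v"
begin

abbreviation DD :: "('y \<Rightarrow>\<^sub>0 int) \<Rightarrow> ('x \<Rightarrow>\<^sub>0 int)" where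
  "DD \<equiv> frag_extend D"

lemma D_sub: "y \<in> Ed \<Longrightarrow> Poly_Mapping.keys (D y) \<subseteq> Vx"
  using D_fixed Vx.fixed_sub by blast

lemma DD_sub: "Poly_Mapping.keys c \<subseteq> Ed \<Longrightarrow> Poly_Mapping.keys (DD c) \<subseteq> Vx"
  using keys_frag_extend[of D c] D_sub by blast

lemma DD_act:
  assumes "g \<in> carrier G" "Poly_Mapping.keys c \<subseteq> Ed"
  shows "DD (frag_map (actE g) c) = frag_map (actV g) (DD c)"
  using assms(2)
  by (induction c rule: frag_induction) (auto simp: frag_extend_diff D_act assms(1))

lemma M1_zero: "a \<in> M1 \<Longrightarrow> 0 \<in> M1"
  using M1_diff[of a a] by simp

lemma M1_add: "a \<in> M1 \<Longrightarrow> b \<in> M1 \<Longrightarrow> a + b \<in> M1"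
  using M1_diff[of a "0 - b"] M1_diff[of 0 b] M1_zero by simp

lemma DD_unique: "a \<in> M1 \<Longrightarrow> b \<in> M1 \<Longrightarrow> DD a = DD b \<Longrightarrow> a = b"
  using D_inj[OF M1_diff[of a b]] by (simp add: frag_extend_diff)

lemma exact_trivial:
  assumes "v \<in> M0" "E v = 0"
  obtains e where "e \<in> M1" "DD e = v"
proof -
  have "Poly_Mapping.keys v \<subseteq> Vx.fixed (generate G {\<one>})"
    using M0_sub[OF assms(1)] Vx.fixed_generateI[of _ \<one>] by auto
  then show thesis
    using exact[OF Vx.generate_singleton_VC[OF Vx.one_closed] assms(1) _ assms(2)] that by blast
qed

text \<open>The boundary map is injective on \<open>M1\<close>, so the preimage of
  \<open>g v - v\<close> is unique there and the derivation rule may be checked after applying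
  \<open>DD\<close>.\<close>

lemma cocycle_exists:
  assumes "v \<in> M0"
  obtains \<eta> where "\<And>g. g \<in> carrier G \<Longrightarrow> \<eta> g \<in> M1"
    "\<And>g. g \<in> carrier G \<Longrightarrow> DD (\<eta> g) = frag_map (actV g) v - v"
    "\<And>g h. g \<in> carrier G \<Longrightarrow> h \<in> carrier G \<Longrightarrow> \<eta> (g \<otimes> h) = \<eta> g + frag_map (actE g) (\<eta> h)"
proof -
  have vX: "Poly_Mapping.keys v \<subseteq> Vx"
    using M0_sub assms by blast
  have "\<exists>e\<in>M1. DD e = frag_map (actV g) v - v" if "g \<in> carrier G" for g
  proof (rule exact_trivial)
    show "frag_map (actV g) v - v \<in> M0"
      using assms that M0_act M0_diff by blast
    show "E (frag_map (actV g) v - v) = 0"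
      using E_diff E_act Vx.keys_act vX that by simp
  qed blast
  then obtain \<eta> where \<eta>: "\<And>g. g \<in> carrier G \<Longrightarrow> \<eta> g \<in> M1 \<and> DD (\<eta> g) = frag_map (actV g) v - v"
    by metis
  have "\<eta> (g \<otimes> h) = \<eta> g + frag_map (actE g) (\<eta> h)" if "g \<in> carrier G" "h \<in> carrier G" for g h
  proof (rule DD_unique)
    show "\<eta> (g \<otimes> h) \<in> M1" "\<eta> g + frag_map (actE g) (\<eta> h) \<in> M1"
      using that \<eta> M1_add M1_act by auto
    show "DD (\<eta> (g \<otimes> h)) = DD (\<eta> g + frag_map (actE g) (\<eta> h))"
      using that \<eta> vX M1_sub
      by (simp add: frag_extend_add frag_extend_diff DD_act Vx.act_frag_mult)
  qed
  then show thesis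
    using that \<eta> by blast
qed

text \<open>The chain \<open>e\<close> with boundary \<open>vs - vt\<close> acts as a path from the
  fixed points of \<open>s\<close> to those of \<open>t\<close>. The ends argument shows that it
  contains no point with finite stabiliser. Along points with infinite stabiliser the property of
  being fixed by a power of \<open>s\<close> cannot change, so if \<open>t\<close> had nothing in
  common with \<open>s\<close>, part of \<open>e\<close> would have boundary \<open>vs\<close>,
  although \<open>vs\<close> has augmentation one.\<close>

lemma infinite_order_commensurable:
  assumes s: "s \<in> carrier G" "\<And>n. n > 0 \<Longrightarrow> s [^] (n::nat) \<noteq> \<one>"
    and t: "t \<in> carrier G" "\<And>n. n > 0 \<Longrightarrow> t [^] (n::nat) \<noteq> \<one>"
  shows "\<exists>n>0. s [^] (n::nat) \<in> generate G {t}"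
proof (rule ccontr)
  assume no: "\<not> (\<exists>n>0. s [^] (n::nat) \<in> generate G {t})"
  \<comment> \<open>With \<open>V\<close> trivial, small means finite, so transporters are small
    just for points with finite stabiliser.\<close>
  define Yf where "Yf = {y \<in> Ed. finite (Ed.stab y)}"
  let ?P = "frag_restrict Yf"
  have Yf_act: "actE g y \<in> Yf \<longleftrightarrow> y \<in> Yf" if "g \<in> carrier G" "y \<in> Ed" for g y
  proof -
    have *: "actE g y \<in> Yf" if "g \<in> carrier G" "y \<in> Yf" for g y
    proof -
      have "Ed.stab (actE g y) \<subseteq> (\<lambda>h. g \<otimes> h \<otimes> inv g) ` Ed.stab y"
      proof
        fix k assume k: "k \<in> Ed.stab (actE g y)"
        then have kG: "k \<in> carrier G" "actE k (actE g y) = actE g y"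
          unfolding Ed.stab_def by auto
        then have "actE (inv g \<otimes> k \<otimes> g) y = y"
          using that by (simp add: Ed.act_mult Yf_def)
        then have "inv g \<otimes> k \<otimes> g \<in> Ed.stab y"
          using kG that unfolding Ed.stab_def by simp
        moreover have "k = g \<otimes> (inv g \<otimes> k \<otimes> g) \<otimes> inv g"
          using kG that by (simp add: Vx.m_assoc)
        ultimately show "k \<in> (\<lambda>h. g \<otimes> h \<otimes> inv g) ` Ed.stab y"
          by blast
      qed
      then show ?thesis
        using that finite_subset unfolding Yf_def by auto
    qed
    show ?thesis
      using *[of g y] *[of "inv g" "actE g y"] that by auto
  qed
  have YfY: "Yf \<subseteq> Ed"
    unfolding Yf_def by blast
  obtain vs where vs: "vs \<in> M0" "Poly_Mapping.keys vs \<subseteq> Vx.fixed (generate G {s})" "E vs = 1"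
    using fixed_point[OF Vx.generate_singleton_VC[OF s(1)]] by blast
  obtain \<eta> where \<eta>: "\<And>g. g \<in> carrier G \<Longrightarrow> \<eta> g \<in> M1"
    "\<And>g. g \<in> carrier G \<Longrightarrow> DD (\<eta> g) = frag_map (actV g) vs - vs"
    "\<And>g h. g \<in> carrier G \<Longrightarrow> h \<in> carrier G \<Longrightarrow> \<eta> (g \<otimes> h) = \<eta> g + frag_map (actE g) (\<eta> h)"
    using cocycle_exists[OF vs(1)] by blast
  \<comment> \<open>If \<open>g\<close> fixes \<open>v\<close> and \<open>DD e = vs - v\<close>,
    then \<open>h e - e\<close> has boundary \<open>h vs - vs\<close> for every \<open>h\<close> in
    the cyclic group of \<open>g\<close>, so it equals \<open>\<eta> h\<close> by
    uniqueness.\<close>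
  have local_inner: "\<exists>v\<in>M0. \<exists>e\<in>M1. Poly_Mapping.keys v \<subseteq> Vx.fixed (generate G {g}) \<and> DD e = vs - v \<and>
      (\<forall>h\<in>generate G {g}. \<eta> h = frag_map (actE h) e - e)" if g: "g \<in> carrier G" for g
  proof -
    obtain v where v: "v \<in> M0" "Poly_Mapping.keys v \<subseteq> Vx.fixed (generate G {g})" "E v = 1"
      using fixed_point[OF Vx.generate_singleton_VC[OF g]] by blast
    obtain e where e: "e \<in> M1" "DD e = vs - v"
    proof (rule exact_trivial)
      show "vs - v \<in> M0"
        using vs v M0_diff by blast
      show "E (vs - v) = 0"
        using E_diff M0_sub vs v by simp
    qed blast
    have "\<eta> h = frag_map (actE h) e - e" if h: "h \<in> generate G {g}" for h
    proof (rule DD_unique)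
      have hG: "h \<in> carrier G"
        using h g Vx.generate_singleton_carrier by blast
      show "\<eta> h \<in> M1" "frag_map (actE h) e - e \<in> M1"
        using \<eta> hG e M1_act M1_diff by auto
      have "frag_map (actV h) v = v"
        using Vx.act_frag_fixed[OF v(2) h] .
      then show "DD (\<eta> h) = DD (frag_map (actE h) e - e)"
        using \<eta> hG e M1_sub by (simp add: frag_extend_diff DD_act)
    qed
    then show ?thesis
      using v e by blast
  qed
  \<comment> \<open>\<open>\<one>\<close> is listed because the locale wants the generator of
    \<open>V\<close>, here \<open>\<one>\<close>, to belong to \<open>A\<close>.\<close>
  define A where "A = {\<one>, s, t}"
  define K where "K = generate G A"
  have A: "finite A" "A \<subseteq> carrier G" "\<one> \<in> A"
    unfolding A_def using s t by auto
  have KG: "K \<subseteq> carrier G"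
    unfolding K_def using A by (intro Vx.generate_incl) auto
  have Kgrp: "subgroup K G"
    unfolding K_def using A by (intro Vx.generate_is_subgroup) auto
  have V: "generate G {\<one>} = {\<one>}"
    by (rule Vx.generate_one)
  interpret C: commensurated_action G A \<one> K "generate G {\<one>}" Yf actE
  proof unfold_locales
    show "\<exists>F. finite F \<and> F \<subseteq> generate G A \<and> generate G {\<one>} #> g \<subseteq> F <#> generate G {\<one>}"
      if "g \<in> generate G A" for g
      using that KG unfolding V K_def
      by (intro exI[of _ "{g}"]) (auto simp: r_coset_def set_mult_def)
    show "K \<equiv> generate G A"
      by (rule eq_reflection[OF K_def])
    show "actE g y \<in> Yf" if "g \<in> generate G A" "y \<in> Yf" for g y
      using that Yf_act YfY KG unfolding K_def by blast
  qed (use A KG[unfolded K_def, THEN subsetD] YfY[THEN subsetD] in \<open>auto simp: Ed.act_mult\<close>)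
  have small_finite: "C.small B \<Longrightarrow> finite B" for B
    unfolding C.small_def V by (auto simp: set_mult_def intro: finite_subset)
  define \<delta> where "\<delta> g = ?P (\<eta> g)" for g
  have P_act: "?P (frag_map (actE g) e) = frag_map (actE g) (?P e)" if "g \<in> carrier G" "e \<in> M1" for g e
    using that M1_sub Yf_act by (intro frag_restrict_map) auto
  have "\<exists>w. Poly_Mapping.keys w \<subseteq> Yf \<and> (\<forall>g\<in>K. \<delta> g = w - frag_map (actE g) w)"
  proof (rule C.inner_derivation)
    show "Poly_Mapping.keys (\<delta> g) \<subseteq> Yf" for g
      unfolding \<delta>_def keys_frag_restrict by blast
    show "\<delta> (g \<otimes> h) = \<delta> g + frag_map (actE g) (\<delta> h)" if "g \<in> K" "h \<in> K" for g h
      using that KG \<eta> P_act by (simp add: \<delta>_def subset_iff frag_restrict_add)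
    show "C.small {g \<in> K. actE g y = y'}" if "y \<in> Yf" for y y'
    proof (rule C.small_finite)
      have "finite {g \<in> carrier G. actE g y \<in> {y'}}"
        using that by (intro Ed.finite_transporter) (auto simp: Yf_def)
      then show "finite {g \<in> K. actE g y = y'}"
        by (rule rev_finite_subset) (use KG in auto)
    qed auto
    show "finite ((\<lambda>v. actE v y) ` generate G {\<one>})" for y
      unfolding V by simp
    show "\<not> C.small K"
    proof
      assume "C.small K"
      then have "finite K"
        by (rule small_finite)
      moreover have "range (\<lambda>n::nat. s [^] n) \<subseteq> K"
        using Vx.pow_in_subgroup[OF Kgrp, of s] unfolding K_def A_def by (auto intro: generate.incl)
      ultimately show False
        using Vx.pow_inj[OF s] finite_imageD finite_subset by blast
    qed
    show "\<exists>n>0. g [^] (n::nat) \<in> generate G {\<one>} \<or>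
        Poly_Mapping.lookup (\<delta> (g [^] n)) y = Poly_Mapping.lookup (\<delta> (inv (g [^] n))) y"
      if "g \<in> K" "y \<in> Yf" for g y
    proof (cases "\<exists>n>0. g [^] (n::nat) = \<one>")
      case True
      then show ?thesis
        unfolding V by auto
    next
      case False
      have g: "g \<in> carrier G"
        using that KG by blast
      obtain e where e: "e \<in> M1" "\<And>h. h \<in> generate G {g} \<Longrightarrow> \<eta> h = frag_map (actE h) e - e"
        using local_inner[OF g] by blast
      have y: "y \<in> Ed" "finite (Ed.stab y)"
        using that unfolding Yf_def by auto
      \<comment> \<open>For \<open>h\<close> in the cyclic group of \<open>g\<close>, the
        coefficient of \<open>\<delta> h\<close> at \<open>y\<close> is that of \<open>e\<close> at
        \<open>inv h y\<close> minus that of \<open>e\<close> at \<open>y\<close>. As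
        \<open>y\<close> has finite stabiliser, some \<open>n\<close> makes both \<open>g^n\<close>
        and its inverse move \<open>y\<close> off the support of \<open>e\<close>, and then both
        coefficients equal minus that of \<open>e\<close> at \<open>y\<close>. Excluding
        \<open>0\<close> below makes \<open>n\<close> positive.\<close>
      define B where "B = {h \<in> carrier G. actE h y \<in> Poly_Mapping.keys e}"
      have "finite B"
        unfolding B_def using Ed.finite_transporter[OF y finite_keys] .
      have inj: "inj (\<lambda>n::nat. g [^] n)"
        using Vx.pow_inj[OF g] False by blast
      then have "inj (\<lambda>n::nat. inv (g [^] n))"
        using g unfolding inj_def by (metis Vx.inv_inv Vx.nat_pow_closed)
      then have "finite ((\<lambda>n::nat. g [^] n) -` B \<union> (\<lambda>n::nat. inv (g [^] n)) -` B \<union> {0})"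
        using \<open>finite B\<close> inj by (simp add: finite_vimageI)
      from ex_new_if_finite[OF infinite_UNIV_nat this]
      obtain n :: nat where n: "n \<notin> (\<lambda>n::nat. g [^] n) -` B \<union> (\<lambda>n::nat. inv (g [^] n)) -` B \<union> {0}" ..
      have out: "Poly_Mapping.lookup (\<delta> h) y = - Poly_Mapping.lookup e y"
        if "h \<in> generate G {g}" "inv h \<notin> B" for h
      proof -
        have h: "h \<in> carrier G"
          using that(1) g Vx.generate_singleton_carrier by blast
        have "actE (inv h) y \<notin> Poly_Mapping.keys e"
          using that(2) h unfolding B_def by simp
        then show ?thesis
          using e that(1) h y \<open>y \<in> Yf\<close> M1_sub
          by (simp add: \<delta>_def lookup_frag_restrict lookup_minus Ed.lookup_act in_keys_iff)
      qed
      have gn: "g [^] n \<in> generate G {g}"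
        using Vx.pow_in_generate g by blast
      then have "inv (g [^] n) \<in> generate G {g}"
        using Vx.generate_m_inv_closed[of "{g}"] g by simp
      then have "Poly_Mapping.lookup (\<delta> (g [^] n)) y = Poly_Mapping.lookup (\<delta> (inv (g [^] n))) y"
        using out[OF gn] out[of "inv (g [^] n)"] n g by simp
      then show ?thesis
        using n by auto
    qed
  qed blast
  then obtain w where w: "Poly_Mapping.keys w \<subseteq> Yf" "\<And>g. g \<in> K \<Longrightarrow> \<delta> g = w - frag_map (actE g) w"
    by blast
  have sK: "s \<in> K" and tK: "t \<in> K"
    unfolding K_def A_def by (auto intro: generate.incl)
  have ss: "s \<in> generate G {s}" and tt: "t \<in> generate G {t}"
    by (auto intro: generate.incl)
  \<comment> \<open>\<open>s\<close> fixes \<open>vs\<close>, so \<open>\<eta> s\<close> vanishes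
    and \<open>w\<close> is invariant under \<open>s\<close>; an element of infinite order leaves
    only \<open>w = 0\<close>.\<close>
  have "DD (\<eta> s) = 0"
    using \<eta>(2)[OF s(1)] Vx.act_frag_fixed[OF vs(2) ss] by simp
  then have "\<eta> s = 0"
    using \<eta>(1)[OF s(1)] D_inj by blast
  then have "frag_map (actE s) w = w"
    using w(2)[OF sK] by (simp add: \<delta>_def frag_restrict_def)
  then have "w = 0"
    using Ed.invariant_finite_stab_zero[OF _ s] w(1) unfolding Yf_def by blast
  then have \<delta>t: "\<delta> t = 0"
    using w(2)[OF tK] by simp
  obtain vt e where vt: "vt \<in> M0" "Poly_Mapping.keys vt \<subseteq> Vx.fixed (generate G {t})"
    and e: "e \<in> M1" "DD e = vs - vt" "\<eta> t = frag_map (actE t) e - e"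
    using local_inner[OF t(1)] tt by blast
  \<comment> \<open>Now \<open>\<delta> t\<close> vanishes, so the part of \<open>e\<close> with
    finite stabilisers is invariant under \<open>t\<close> and vanishes by the same
    argument.\<close>
  have "frag_map (actE t) (?P e) = ?P e"
    using \<delta>t e P_act[OF t(1) e(1)] by (simp add: \<delta>_def frag_restrict_diff)
  then have "?P e = 0"
    using Ed.invariant_finite_stab_zero[OF _ t, of "?P e"] keys_frag_restrict[of Yf e] unfolding Yf_def by blast
  then have eYf: "Poly_Mapping.keys e \<inter> Yf = {}"
    using keys_frag_restrict[of Yf e] by simp
  \<comment> \<open>Points are now sorted by whether some positive power of \<open>s\<close> fixes
    them.\<close>
  define Ys where "Ys = {y \<in> Ed. \<exists>n>0. s [^] (n::nat) \<in> Ed.stab y}"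
  define Xs where "Xs = {x \<in> Vx. \<exists>n>0. s [^] (n::nat) \<in> Vx.stab x}"
  define e1 where "e1 = frag_restrict Ys e"
  define e2 where "e2 = e - e1"
  have e1: "Poly_Mapping.keys e1 \<subseteq> Ys" and e1Y: "Poly_Mapping.keys e1 \<subseteq> Ed"
    unfolding e1_def keys_frag_restrict using M1_sub e by auto
  have e2: "Poly_Mapping.keys e2 \<subseteq> Poly_Mapping.keys e - Ys"
    by (auto simp: e2_def e1_def in_keys_iff lookup_minus lookup_frag_restrict split: if_splits)
  have De1: "Poly_Mapping.keys (DD e1) \<subseteq> Xs"
  proof -
    have "Poly_Mapping.keys (D y) \<subseteq> Xs" if "y \<in> Ys" for y
      using D_fixed[of y] that unfolding Ys_def Xs_def Vx.fixed_def Vx.stab_def Ed.stab_def by blast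
    then show ?thesis
      using keys_frag_extend[of D e1] e1 by blast
  qed
  \<comment> \<open>The stabiliser of \<open>y\<close> is infinite and fixes the support of
    \<open>D y\<close>. If a point of that support were fixed by a power of \<open>s\<close>,
    virtual cyclicity of its stabiliser would put a power of \<open>s\<close> into the stabiliser of
    \<open>y\<close>, contrary to \<open>y \<notin> Ys\<close>.\<close>
  have De2: "Poly_Mapping.keys (DD e2) \<inter> Xs = {}"
  proof -
    have "x \<notin> Xs" if y: "y \<in> Poly_Mapping.keys e2" and x: "x \<in> Poly_Mapping.keys (D y)" for x y
    proof
      assume "x \<in> Xs"
      then obtain n :: nat where n: "n > 0" "s [^] n \<in> Vx.stab x" and xX: "x \<in> Vx"
        unfolding Xs_def by blast
      have yY: "y \<in> Ed" "infinite (Ed.stab y)" "y \<notin> Ys"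
        using y e2 eYf M1_sub[OF e(1)] unfolding Yf_def by auto
      obtain g where g: "g \<in> Ed.stab y" "\<And>n. n > 0 \<Longrightarrow> g [^] (n::nat) \<noteq> \<one>"
        using Vx.VC_infinite_order[OF Ed.stab_in_VC[OF yY(1)] yY(2)] by blast
      have "g \<in> Vx.stab x"
        using g(1) x D_fixed[OF yY(1)] unfolding Vx.fixed_def Vx.stab_def Ed.stab_def by blast
      then obtain m :: nat where m: "m > 0" "(s [^] n) [^] m \<in> generate G {g}"
        using Vx.VC_commensurable[OF Vx.stab_in_VC[OF xX] n(2) _ g(2)] by blast
      have "generate G {g} \<subseteq> Ed.stab y"
        using g(1) Ed.stab_subgroup[OF yY(1)] by (intro Vx.generate_subgroup_incl) auto
      then have "s [^] (n * m) \<in> Ed.stab y"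
        using m s(1) by (auto simp: Vx.nat_pow_pow)
      moreover have "n * m > 0"
        using n m by simp
      ultimately show False
        using yY unfolding Ys_def by blast
    qed
    then show ?thesis
      using keys_frag_extend[of D e2] by blast
  qed
  have vtXs: "Poly_Mapping.keys vt \<inter> Xs = {}"
  proof (rule ccontr)
    assume "Poly_Mapping.keys vt \<inter> Xs \<noteq> {}"
    then obtain x n where x: "x \<in> Vx" "x \<in> Poly_Mapping.keys vt" "(n::nat) > 0" "s [^] n \<in> Vx.stab x"
      unfolding Xs_def by blast
    have "t \<in> Vx.stab x"
      using x vt(2) tt t(1) unfolding Vx.fixed_def Vx.stab_def by blast
    then obtain m :: nat where m: "m > 0" "(s [^] n) [^] m \<in> generate G {t}"
      using Vx.VC_commensurable[OF Vx.stab_in_VC[OF x(1)] x(4) _ t(2)] by blast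
    then have "s [^] (n * m) \<in> generate G {t}" "n * m > 0"
      using x(3) s(1) by (auto simp: Vx.nat_pow_pow)
    then show False
      using no by blast
  qed
  have vsXs: "Poly_Mapping.keys vs \<subseteq> Xs"
  proof
    fix x assume "x \<in> Poly_Mapping.keys vs"
    then have "x \<in> Vx" "s \<in> Vx.stab x"
      using vs(2) ss s(1) unfolding Vx.fixed_def Vx.stab_def by auto
    then show "x \<in> Xs"
      unfolding Xs_def using s(1) by (intro CollectI conjI exI[of _ "1::nat"]) auto
  qed
  \<comment> \<open>One side is supported inside \<open>Xs\<close> and the other outside, so both
    vanish.\<close>
  have "vs - DD e1 = vt + DD e2"
    using e(2) by (simp add: e2_def frag_extend_diff algebra_simps)
  moreover have "Poly_Mapping.keys (vs - DD e1) \<subseteq> Xs"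
    using keys_diff[of vs "DD e1"] vsXs De1 by blast
  moreover have "Poly_Mapping.keys (vt + DD e2) \<inter> Xs = {}"
    using keys_add[of vt "DD e2"] vtXs De2 by blast
  ultimately have "Poly_Mapping.keys (vs - DD e1) = {}"
    by (metis inf.absorb1)
  then have "vs = DD e1"
    by simp
  then show False
    using E_D[OF e1Y] vs(3) by simp
qed

text \<open>If the group were not small relative to \<open>V\<close>, the derivation of a
  \<open>V\<close>-fixed vector \<open>v\<close> would be inner on it, and correcting
  \<open>v\<close> by the boundary of \<open>w\<close> would give an invariant vector of
  augmentation one. The support of that vector is a finite invariant set of points with small
  stabilisers, so the group would be small after all. The order of \<open>s\<close> may be
  finite.\<close>

lemma finitely_generated_VC:
  assumes A0: "finite A0" "A0 \<subseteq> carrier G" and s: "s \<in> generate G A0"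
    and pow: "\<And>g. g \<in> generate G A0 \<Longrightarrow> \<exists>n>0. g [^] (n::nat) \<in> generate G {s}"
  shows "generate G A0 \<in> VC G"
proof -
  \<comment> \<open>Adding \<open>s\<close> leaves the generated group unchanged and provides
    \<open>s \<in> A\<close> for the locale.\<close>
  define A where "A = insert s A0"
  define K where "K = generate G A"
  define V where "V = generate G {s}"
  have sG: "s \<in> carrier G"
    using s A0(2) Vx.generate_in_carrier by blast
  have A: "finite A" "A \<subseteq> carrier G" "s \<in> A"
    unfolding A_def using A0 sG by auto
  have K: "K = generate G A0"
  proof
    show "K \<subseteq> generate G A0"
      unfolding K_def A_def using s A0
      by (intro Vx.generate_subgroup_incl Vx.generate_is_subgroup) (auto intro: generate.incl)
    show "generate G A0 \<subseteq> K"
      unfolding K_def A_def by (intro Vx.mono_generate) auto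
  qed
  have Kgrp: "subgroup K G"
    unfolding K_def using A by (intro Vx.generate_is_subgroup) auto
  have KG: "g \<in> carrier G" if "g \<in> K" for g
    using that subgroup.mem_carrier[OF Kgrp] by blast
  have Kmult: "g \<otimes> h \<in> K" if "g \<in> K" "h \<in> K" for g h
    using that subgroup.m_closed[OF Kgrp] by blast
  have Kinv: "inv g \<in> K" if "g \<in> K" for g
    using that subgroup.m_inv_closed[OF Kgrp] by blast
  have sK: "s \<in> K"
    unfolding K by (rule s)
  have conj_pow: "\<exists>n>0. (inv g \<otimes> s \<otimes> g) [^] (n::nat) \<in> V" if "g \<in> K" for g
    unfolding V_def using that sK Kinv Kmult by (intro pow) (auto simp: K[symmetric])
  have conj_nat: "(inv g \<otimes> s \<otimes> g) [^] (n::nat) = inv g \<otimes> s [^] n \<otimes> g" if "g \<in> K" for g n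
    using Vx.int_pow_conj[of s "inv g" "int n"] that sG KG by (simp add: int_pow_int)
  \<comment> \<open>These are points with finite \<open>V\<close>-orbits, as
    \<open>inner_derivation\<close> demands. The set is invariant under \<open>K\<close> because
    every conjugate of \<open>s\<close> by an element of \<open>K\<close> has a positive power in
    \<open>V\<close>.\<close>
  define Yv where "Yv = {y \<in> Ed. \<exists>n>0. s [^] (n::nat) \<in> Ed.stab y}"
  have YvE: "y \<in> Ed" if "y \<in> Yv" for y
    using that unfolding Yv_def by blast
  have Yv_act: "actE g y \<in> Yv" if g: "g \<in> K" and y: "y \<in> Yv" for g y
  proof -
    obtain n :: nat where n: "n > 0" "s [^] n \<in> Ed.stab y"
      using y unfolding Yv_def by blast
    obtain m :: nat where m: "m > 0" "(inv g \<otimes> s \<otimes> g) [^] m \<in> V"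
      using conj_pow[OF g] by blast
    obtain k :: int where k: "(inv g \<otimes> s \<otimes> g) [^] m = s [^] k"
      using m(2) Vx.generate_pow[OF sG] unfolding V_def by blast
    have u: "inv g \<otimes> s \<otimes> g \<in> carrier G"
      using g sG KG by simp
    have "(inv g \<otimes> s \<otimes> g) [^] (m * n) = (s [^] k) [^] int n"
      using u k by (simp add: Vx.nat_pow_pow[symmetric] int_pow_int)
    also have "\<dots> = (s [^] n) [^] k"
      using sG by (metis Vx.int_pow_pow int_pow_int mult.commute)
    also have "\<dots> \<in> Ed.stab y"
      using n(2) Vx.subgroup_int_pow_closed[OF Ed.stab_subgroup] YvE[OF y] by blast
    finally have "actE (inv g \<otimes> s [^] (m * n) \<otimes> g) y = y"
      using conj_nat[OF g] by (simp add: Ed.stab_def)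
    then have "actE (inv g) (actE (s [^] (m * n)) (actE g y)) = y"
      using g y sG KG YvE by (simp add: Ed.act_mult)
    then have "actE (s [^] (m * n)) (actE g y) = actE g y"
      using g y sG KG YvE by (metis Ed.act_closed Ed.act_inv' Vx.nat_pow_closed)
    then have "s [^] (m * n) \<in> Ed.stab (actE g y)"
      using sG by (simp add: Ed.stab_def)
    moreover have "m * n > 0"
      using m(1) n(1) by simp
    moreover have "actE g y \<in> Ed"
      using Ed.act_closed[OF KG[OF g] YvE[OF y]] .
    ultimately show ?thesis
      unfolding Yv_def by blast
  qed
  interpret C: commensurated_action G A s K V Yv actE
  proof unfold_locales
    show "K \<equiv> generate G A" "V \<equiv> generate G {s}"
      by (rule eq_reflection, rule K_def, rule eq_reflection, rule V_def)
    show "\<exists>F. finite F \<and> F \<subseteq> generate G A \<and> generate G {s} #> g \<subseteq> F <#> generate G {s}"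
      if "g \<in> generate G A" for g
    proof -
      have g: "g \<in> K"
        unfolding K_def by (rule that)
      \<comment> \<open>\<open>V g\<close> is \<open>g\<close> times the cyclic group of the
        conjugate \<open>u\<close>, and some power \<open>u^n\<close> lies in \<open>V\<close>;
        hence the cosets \<open>g u^j V\<close> with \<open>j < n\<close> suffice.\<close>
      define u where "u = inv g \<otimes> s \<otimes> g"
      have u: "u \<in> K" "u \<in> carrier G"
        unfolding u_def using g sK Kinv Kmult KG by auto
      obtain n :: nat where n: "n > 0" "u [^] n \<in> V"
        using conj_pow[OF g] unfolding u_def by blast
      let ?F = "(\<lambda>j. g \<otimes> u [^] j) ` {..<n}"
      have "V #> g \<subseteq> ?F <#> V"
      proof
        fix x assume "x \<in> V #> g"
        then obtain v where v: "v \<in> V" "x = v \<otimes> g"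
          unfolding r_coset_def by blast
        then obtain k :: int where k: "v = s [^] k"
          using Vx.generate_pow[OF sG] unfolding V_def by blast
        have "inv g \<otimes> v \<otimes> g = u [^] k"
          using Vx.int_pow_conj[of s "inv g" k] g sG KG k by (simp add: u_def)
        moreover have "u [^] k \<in> generate G {u}"
          using Vx.generate_pow[OF u(2)] by blast
        ultimately have "inv g \<otimes> v \<otimes> g \<in> (\<lambda>j. u [^] j) ` {..<n} <#> generate G {u [^] n}"
          using Vx.cyclic_cover[OF u(2) n(1)] by auto
        then obtain j w where jw: "j < n" "w \<in> generate G {u [^] n}" "inv g \<otimes> v \<otimes> g = u [^] j \<otimes> w"
          unfolding set_mult_def by blast
        have w: "w \<in> V"
          using jw(2) n(2) Vx.generate_pow_subset[OF sG] unfolding V_def by blast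
        then have wG: "w \<in> carrier G"
          unfolding V_def using Vx.generate_singleton_carrier[OF sG] by blast
        have vG: "v \<in> carrier G"
          using k sG by simp
        have "x = g \<otimes> (inv g \<otimes> v \<otimes> g)"
          using v(2) vG g KG by (simp add: Vx.m_assoc)
        also have "\<dots> = (g \<otimes> u [^] j) \<otimes> w"
          using jw(3) g KG u wG by (simp add: Vx.m_assoc)
        finally show "x \<in> ?F <#> V"
          using jw(1) w unfolding set_mult_def by blast
      qed
      moreover have "?F \<subseteq> K"
        using g u Kmult Vx.pow_in_subgroup[OF Kgrp] by auto
      ultimately show ?thesis
        unfolding K_def V_def by (intro exI[of _ ?F]) auto
    qed
    show "actE g y \<in> Yv" if "g \<in> generate G A" "y \<in> Yv" for g y
      using that Yv_act unfolding K_def by blast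
    show "actE (g \<otimes> h) y = actE g (actE h y)" if "g \<in> generate G A" "h \<in> generate G A" "y \<in> Yv" for g h y
      using that KG YvE unfolding K_def by (simp add: Ed.act_mult)
  qed (use A YvE in auto)
  have small_stab: "C.small L" if L: "subgroup L G" "L \<subseteq> K" "L \<subseteq> H" "H \<in> VC G" for L H
  proof -
    have "\<exists>n>0. g [^] (n::nat) \<in> generate G {s}" if "g \<in> L" for g
      using that \<open>L \<subseteq> K\<close> pow unfolding K by blast
    then obtain F where "finite F" "F \<subseteq> L" "L \<subseteq> F <#> generate G {s}"
      by (rule Vx.VC_cover[OF L(4,1,3) sG])
    then show ?thesis
      using L(2) unfolding C.small_def V_def by blast
  qed
  \<comment> \<open>Stated for an arbitrary set with virtually cyclic stabilisers, since it serves
    for \<open>Ed\<close> in the ends argument and for \<open>Vx\<close> at the end.\<close>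
  have small_transporter: "C.small {g \<in> K. act g x = x'}"
    if "VC_set G S act" "x \<in> S" for S :: "'z set" and act x x'
  proof (cases "\<exists>g0\<in>K. act g0 x = x'")
    case True
    interpret S: VC_set G S act by (rule that)
    obtain g0 where g0: "g0 \<in> K" "act g0 x = x'"
      using True by blast
    have "C.small (K \<inter> S.stab x)"
      using that(2) Kgrp S.stab_subgroup S.stab_in_VC
      by (intro small_stab[of _ "S.stab x"] Vx.subgroups_Inter_pair) auto
    then have "C.small ((\<otimes>) g0 ` (K \<inter> S.stab x))"
      using C.small_left g0(1) by blast
    moreover have "{g \<in> K. act g x = x'} \<subseteq> (\<otimes>) g0 ` (K \<inter> S.stab x)"
    proof
      fix g assume "g \<in> {g \<in> K. act g x = x'}"
      then have g: "g \<in> K" "act g x = x'" by auto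
      then show "g \<in> (\<otimes>) g0 ` (K \<inter> S.stab x)"
        using S.transporter_coset[OF that(2) KG[OF g0(1)] g0(2) KG[OF g(1)] g(2)] g0(1) Kinv Kmult by blast
    qed
    ultimately show ?thesis
      by (rule C.small_subset)
  next
    case False
    then have "{g \<in> K. act g x = x'} = {}" by blast
    then show ?thesis
      by (simp only: C.small_empty)
  qed
  have VxS: "VC_set G Vx actV" and EdS: "VC_set G Ed actE"
    by unfold_locales
  have "C.small K"
  proof (rule ccontr)
    assume big: "\<not> C.small K"
    obtain v where v: "v \<in> M0" "Poly_Mapping.keys v \<subseteq> Vx.fixed V" "E v = 1"
      using fixed_point[OF Vx.generate_singleton_VC[OF sG]] unfolding V_def by blast
    have vX: "Poly_Mapping.keys v \<subseteq> Vx"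
      using v(2) Vx.fixed_sub by blast
    obtain \<eta> where \<eta>: "\<And>g. g \<in> carrier G \<Longrightarrow> \<eta> g \<in> M1"
      "\<And>g. g \<in> carrier G \<Longrightarrow> DD (\<eta> g) = frag_map (actV g) v - v"
      "\<And>g h. g \<in> carrier G \<Longrightarrow> h \<in> carrier G \<Longrightarrow> \<eta> (g \<otimes> h) = \<eta> g + frag_map (actE g) (\<eta> h)"
      using cocycle_exists[OF v(1)] by blast
    have "\<exists>w. Poly_Mapping.keys w \<subseteq> Yv \<and> (\<forall>g\<in>K. \<eta> g = w - frag_map (actE g) w)"
    proof (rule C.inner_derivation)
      \<comment> \<open>Some power \<open>s^m\<close> fixes both \<open>v\<close> and
        \<open>g v\<close>. Exactness at the orbit of the group it generates gives a preimage of
        \<open>g v - v\<close> supported on fixed points of \<open>s^m\<close>; by uniqueness this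
        preimage is \<open>\<eta> g\<close>.\<close>
      fix g assume g: "g \<in> K"
      obtain m :: nat where m: "m > 0" "(inv g \<otimes> s \<otimes> g) [^] m \<in> V"
        using conj_pow[OF g] by blast
      have sm: "s [^] m \<in> carrier G" "s [^] m \<in> V"
        unfolding V_def using Vx.pow_in_generate sG by auto
      have "Poly_Mapping.keys (frag_map (actV g) v - v) \<subseteq> Vx.fixed (generate G {s [^] m})"
      proof
        fix x assume "x \<in> Poly_Mapping.keys (frag_map (actV g) v - v)"
        then consider "x \<in> Poly_Mapping.keys v" | z where "z \<in> Poly_Mapping.keys v" "x = actV g z"
          using keys_diff[of "frag_map (actV g) v" v] keys_frag_map[of "actV g" v] by blast
        then have "x \<in> Vx \<and> actV (s [^] m) x = x"
        proof cases
          case 1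
          then show ?thesis
            using v(2) sm unfolding Vx.fixed_def by blast
        next
          case 2
          then have z: "z \<in> Vx" "actV (inv g \<otimes> s [^] m \<otimes> g) z = z"
            using v(2) m(2) conj_nat[OF g, of m] unfolding Vx.fixed_def by auto
          then have "actV (inv g) (actV (s [^] m) (actV g z)) = z"
            using g sm KG by (simp add: Vx.act_mult)
          then have "actV (s [^] m) (actV g z) = actV g z"
            using g sm KG z by (metis Vx.act_closed Vx.act_inv')
          then show ?thesis
            using 2 z g KG by simp
        qed
        then show "x \<in> Vx.fixed (generate G {s [^] m})"
          using Vx.fixed_generateI sm by blast
      qed
      moreover have "frag_map (actV g) v - v \<in> M0"
        using v g KG M0_act M0_diff by blast
      moreover have "E (frag_map (actV g) v - v) = 0"
        using E_diff E_act Vx.keys_act vX g KG by simp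
      ultimately obtain e where e: "e \<in> M1" "Poly_Mapping.keys e \<subseteq> Ed.fixed (generate G {s [^] m})"
          "DD e = frag_map (actV g) v - v"
        using exact[OF Vx.generate_singleton_VC[OF sm(1)]] by blast
      have "e = \<eta> g"
        using DD_unique e \<eta> g KG by metis
      have "Ed.fixed (generate G {s [^] m}) \<subseteq> Yv"
        unfolding Yv_def Ed.fixed_def Ed.stab_def using m(1) sm(1) by (auto intro: generate.incl)
      then show "Poly_Mapping.keys (\<eta> g) \<subseteq> Yv"
        using e(2) unfolding \<open>e = \<eta> g\<close> by blast
    next
      show "\<eta> (g \<otimes> h) = \<eta> g + frag_map (actE g) (\<eta> h)" if "g \<in> K" "h \<in> K" for g h
        using that \<eta> KG by blast
      show "C.small {g \<in> K. actE g y = y'}" if "y \<in> Yv" for y y'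
        using small_transporter[OF EdS] YvE[OF that] .
      show "finite ((\<lambda>v. actE v y) ` V)" if y: "y \<in> Yv" for y
      proof -
        obtain n :: nat where n: "n > 0" "s [^] n \<in> Ed.stab y"
          using y unfolding Yv_def by blast
        have gen: "generate G {s [^] n} \<subseteq> Ed.stab y"
          using n(2) Ed.stab_subgroup YvE[OF y] by (intro Vx.generate_subgroup_incl) auto
        have "(\<lambda>v. actE v y) ` V \<subseteq> (\<lambda>j. actE (s [^] j) y) ` {..<n}"
        proof
          fix z assume "z \<in> (\<lambda>v. actE v y) ` V"
          then obtain v where v: "v \<in> V" "z = actE v y" by blast
          then obtain j w where jw: "j < n" "w \<in> generate G {s [^] n}" "v = s [^] j \<otimes> w"
            using Vx.cyclic_cover[OF sG n(1)] unfolding V_def set_mult_def by blast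
          then have "w \<in> carrier G" "actE w y = y"
            using gen unfolding Ed.stab_def by auto
          then have "z = actE (s [^] j) y"
            using v jw sG YvE[OF y] by (simp add: Ed.act_mult)
          then show "z \<in> (\<lambda>j. actE (s [^] j) y) ` {..<n}"
            using jw(1) by blast
        qed
        then show ?thesis
          using finite_subset by blast
      qed
      show "\<not> C.small K" by (rule big)
      \<comment> \<open>Every element of \<open>K\<close> has a power in \<open>V\<close>, so the
        first alternative always holds.\<close>
      show "\<exists>n>0. g [^] (n::nat) \<in> V \<or> Poly_Mapping.lookup (\<eta> (g [^] n)) y = Poly_Mapping.lookup (\<eta> (inv (g [^] n))) y"
        if "g \<in> K" for g y
        using pow that unfolding K V_def by blast
    qed blast
    then obtain w where w: "Poly_Mapping.keys w \<subseteq> Yv" "\<And>g. g \<in> K \<Longrightarrow> \<eta> g = w - frag_map (actE g) w"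
      by blast
    have wY: "Poly_Mapping.keys w \<subseteq> Ed"
      using w(1) YvE by blast
    have DwX: "Poly_Mapping.keys (DD w) \<subseteq> Vx" "Poly_Mapping.keys (- DD w) \<subseteq> Vx"
      using DD_sub[OF wY] by auto
    \<comment> \<open>This is \<open>v + DD w\<close>, written as a difference to suit
      \<open>E_diff\<close>.\<close>
    define z where "z = v - (- DD w)"
    have zX: "Poly_Mapping.keys z \<subseteq> Vx"
      unfolding z_def using keys_diff[of v "- DD w"] vX DwX by blast
    have z_inv: "frag_map (actV g) z = z" if "g \<in> K" for g
    proof -
      have "frag_map (actV g) v - v = DD w - frag_map (actV g) (DD w)"
        using \<eta>(2)[OF KG[OF that]] w(2)[OF that] DD_act[OF KG[OF that] wY] by (simp add: frag_extend_diff)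
      then show ?thesis
        by (simp add: z_def frag_extend_add algebra_simps)
    qed
    have "E (DD w - 0) = E (DD w) - E 0" "E (0 - DD w) = E 0 - E (DD w)"
      by (rule E_diff; use DwX in simp)+
    then have "E z = 1"
      unfolding z_def using E_diff[OF vX DwX(2)] E_D[OF wY] v(3) by simp
    moreover have "E 0 = 0"
      using E_diff[of 0 0] by simp
    ultimately have "z \<noteq> 0" by auto
    then obtain x where x: "x \<in> Poly_Mapping.keys z"
      by (metis all_not_in_conv keys_eq_empty)
    have "actV g x \<in> Poly_Mapping.keys z" if "g \<in> K" for g
    proof -
      have "Poly_Mapping.lookup (frag_map (actV g) z) (actV g x) = Poly_Mapping.lookup z x"
        using Vx.lookup_act[OF zX KG[OF that], of "actV g x"] x zX KG[OF that] by auto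
      then show ?thesis
        using z_inv[OF that] x by (simp add: in_keys_iff)
    qed
    then have "K \<subseteq> (\<Union>x'\<in>Poly_Mapping.keys z. {g \<in> K. actV g x = x'})"
      by blast
    moreover have "C.small (\<Union>x'\<in>Poly_Mapping.keys z. {g \<in> K. actV g x = x'})"
      using x zX by (intro C.small_UN small_transporter[OF VxS] finite_keys) auto
    ultimately show False
      using big C.small_subset by blast
  qed
  then obtain F where "finite F" "F \<subseteq> K" "K \<subseteq> F <#> generate G {s}"
    unfolding C.small_def V_def by blast
  then show ?thesis
    unfolding Vx.VC_iff K[symmetric] using Kgrp sK by blast
qed

theorem finitely_generated_subgroups_VC:
  assumes "finite A" "A \<subseteq> carrier G"
  shows "generate G A \<in> VC G"
proof (cases "\<exists>s\<in>generate G A. \<forall>n>0. s [^] (n::nat) \<noteq> \<one>")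
  case True
  then obtain s where s: "s \<in> generate G A" "\<And>n. n > 0 \<Longrightarrow> s [^] (n::nat) \<noteq> \<one>" by blast
  show ?thesis
  proof (rule finitely_generated_VC[OF assms s(1)])
    fix g assume g: "g \<in> generate G A"
    show "\<exists>n>0. g [^] (n::nat) \<in> generate G {s}"
    proof (cases "\<exists>n>0. g [^] (n::nat) = \<one>")
      case True
      then show ?thesis
        using generate.one by metis
    next
      case False
      then show ?thesis
        using g s assms Vx.generate_in_carrier by (intro infinite_order_commensurable) blast+
    qed
  qed
next
  \<comment> \<open>In the torsion case \<open>V\<close> is trivial, and every element has a power
    in it.\<close>
  case False
  show ?thesis
  proof (rule finitely_generated_VC[OF assms generate.one])
    show "\<exists>n>0. g [^] (n::nat) \<in> generate G {\<one>}" if "g \<in> generate G A" for g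
      using False that generate.one by metis
  qed
qed

end

section \<open>Projective modules over the orbit category\<close>

lemma image_group_comm_group:
  assumes "comm_group G" "inj_on j (carrier G)"
  shows "comm_group (image_group j G)" "j \<in> iso G (image_group j G)"
proof -
  interpret comm_group G by fact
  show iso: "j \<in> iso G (image_group j G)"
    using assms(2) by (auto simp: iso_def hom_def image_group_def bij_betw_def)
  show "comm_group (image_group j G)"
    using iso_imp_img_comm_group[OF iso] by (simp add: image_group_def)
qed

lemma right_module_comm_group: "right_module G M \<Longrightarrow> T \<in> orbit_objects G \<Longrightarrow> comm_group (val M T)"
  by (simp add: right_module_def)

lemma right_module_group: "right_module G M \<Longrightarrow> T \<in> orbit_objects G \<Longrightarrow> group (val M T)"
  using right_module_comm_group comm_group_def by blast

lemma right_module_hom: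
  "right_module G M \<Longrightarrow> S \<in> orbit_objects G \<Longrightarrow> T \<in> orbit_objects G \<Longrightarrow> f \<in> orbit_hom G S T \<Longrightarrow>
    res M S T f \<in> hom (val M T) (val M S)"
  by (simp add: right_module_def)

lemma right_module_closed:
  "right_module G M \<Longrightarrow> S \<in> orbit_objects G \<Longrightarrow> T \<in> orbit_objects G \<Longrightarrow> f \<in> orbit_hom G S T \<Longrightarrow>
    m \<in> carrier (val M T) \<Longrightarrow> res M S T f m \<in> carrier (val M S)"
  by (rule hom_in_carrier[OF right_module_hom])

lemma right_module_id:
  "right_module G M \<Longrightarrow> S \<in> orbit_objects G \<Longrightarrow> m \<in> carrier (val M S) \<Longrightarrow> res M S S (\<lambda>x\<in>S. x) m = m"
  by (simp add: right_module_def)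

lemma right_module_compose:
  "right_module G M \<Longrightarrow> S \<in> orbit_objects G \<Longrightarrow> T \<in> orbit_objects G \<Longrightarrow> U \<in> orbit_objects G \<Longrightarrow>
    f \<in> orbit_hom G S T \<Longrightarrow> h \<in> orbit_hom G T U \<Longrightarrow> m \<in> carrier (val M U) \<Longrightarrow>
    res M S U (compose S h f) m = res M S T f (res M T U h m)"
  by (simp add: right_module_def)

lemma module_hom_hom: "\<eta> \<in> module_hom G M N \<Longrightarrow> T \<in> orbit_objects G \<Longrightarrow> \<eta> T \<in> hom (val M T) (val N T)"
  by (simp add: module_hom_def)

lemma module_hom_closed:
  "\<eta> \<in> module_hom G M N \<Longrightarrow> T \<in> orbit_objects G \<Longrightarrow> m \<in> carrier (val M T) \<Longrightarrow> \<eta> T m \<in> carrier (val N T)"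
  by (rule hom_in_carrier[OF module_hom_hom])

lemma module_hom_natural:
  "\<eta> \<in> module_hom G M N \<Longrightarrow> S \<in> orbit_objects G \<Longrightarrow> T \<in> orbit_objects G \<Longrightarrow> f \<in> orbit_hom G S T \<Longrightarrow>
    m \<in> carrier (val M T) \<Longrightarrow> \<eta> S (res M S T f m) = res N S T f (\<eta> T m)"
  by (simp add: module_hom_def)

text \<open>Projectivity only refers to modules with elements in the same type, so a module with elements
  in another type is first transported along injections of its values.\<close>

lemma projective_section:
  fixes P :: "('g, 'a) orbit_functor" and F :: "('g, 'b) orbit_functor"
  assumes P: "projective_module G P" and F: "right_module G F"
    and inj: "\<And>T. T \<in> orbit_objects G \<Longrightarrow> \<exists>j::'b \<Rightarrow> 'a. inj_on j (carrier (val F T))"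
    and q: "q \<in> module_epi G F P"
  obtains i where "i \<in> module_hom G P F"
    "\<And>T x. T \<in> orbit_objects G \<Longrightarrow> x \<in> carrier (val P T) \<Longrightarrow> q T (i T x) = x"
proof -
  obtain j :: "'g set set \<Rightarrow> 'b \<Rightarrow> 'a"
    where j: "\<And>T. T \<in> orbit_objects G \<Longrightarrow> inj_on (j T) (carrier (val F T))"
    using inj by metis
  define k where "k T = inv_into (carrier (val F T)) (j T)" for T
  have kj: "k T (j T x) = x" if "T \<in> orbit_objects G" "x \<in> carrier (val F T)" for T x
    unfolding k_def using j that by simp
  \<comment> \<open>\<open>F\<close> is moved into the type of \<open>P\<close> by transport of
    structure along the injections \<open>j T\<close>. The identity of \<open>P\<close> is lifted
    there, and \<open>k\<close> brings the lift back.\<close>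
  define F' :: "('g, 'a) orbit_functor"
    where "F' = \<lparr>val = (\<lambda>T. image_group (j T) (val F T)), res = (\<lambda>S T f x. j S (res F S T f (k T x)))\<rparr>"
  have valF': "val F' T = image_group (j T) (val F T)" and resF': "res F' S T f x = j S (res F S T f (k T x))"
    for S T f x
    by (simp_all add: F'_def)
  have carrF': "carrier (val F' T) = j T ` carrier (val F T)" for T
    by (simp add: valF' image_group_def)
  have jhom: "j T \<in> hom (val F T) (val F' T)" if "T \<in> orbit_objects G" for T
    using image_group_comm_group(2)[OF right_module_comm_group[OF F that] j[OF that]]
    by (simp add: valF' iso_def)
  have khom: "k T \<in> hom (val F' T) (val F T)" if "T \<in> orbit_objects G" for T
    using group.iso_set_sym[OF right_module_group[OF F that]
        image_group_comm_group(2)[OF right_module_comm_group[OF F that] j[OF that]]]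
    by (simp add: valF' iso_def k_def)
  have F': "right_module G F'"
    unfolding right_module_def
  proof (intro conjI ballI)
    fix S assume S: "S \<in> orbit_objects G"
    show "comm_group (val F' S)"
      unfolding valF' using image_group_comm_group(1)[OF right_module_comm_group[OF F S] j[OF S]] .
    show "res F' S S (\<lambda>x\<in>S. x) m = m" if "m \<in> carrier (val F' S)" for m
      using that S kj right_module_id[OF F] by (auto simp: resF' carrF')
    fix T assume T: "T \<in> orbit_objects G"
    fix f assume f: "f \<in> orbit_hom G S T"
    have "(\<lambda>x. j S (res F S T f (k T x))) \<in> hom (val F' T) (val F' S)"
      using Group.hom_compose[OF Group.hom_compose[OF khom[OF T] right_module_hom[OF F S T f]] jhom[OF S]]
      by (simp add: comp_def)
    then show "res F' S T f \<in> hom (val F' T) (val F' S)"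
      by (simp add: F'_def)
    fix U h m
    assume U: "U \<in> orbit_objects G" "h \<in> orbit_hom G T U" "m \<in> carrier (val F' U)"
    then obtain x where x: "x \<in> carrier (val F U)" "m = j U x"
      by (auto simp: carrF')
    show "res F' S U (compose S h f) m = res F' S T f (res F' T U h m)"
      using S T U f x by (simp add: resF' kj right_module_closed[OF F] right_module_compose[OF F])
  qed
  define q' where "q' T = q T \<circ> k T" for T
  have qhom: "q \<in> module_hom G F P"
    using q by (simp add: module_epi_def)
  have q': "q' \<in> module_epi G F' P"
    unfolding module_epi_def module_hom_def
  proof (intro CollectI conjI ballI)
    fix S assume S: "S \<in> orbit_objects G"
    show "q' S \<in> hom (val F' S) (val P S)"
      unfolding q'_def using Group.hom_compose[OF khom[OF S] module_hom_hom[OF qhom S]] .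
    have "q S ` carrier (val F S) = carrier (val P S)"
      using q S by (simp add: module_epi_def)
    then show "q' S ` carrier (val F' S) = carrier (val P S)"
      unfolding carrF' q'_def image_image using kj[OF S] by simp
    fix T f m
    assume "T \<in> orbit_objects G" "f \<in> orbit_hom G S T" "m \<in> carrier (val F' T)"
    then show "q' S (res F' S T f m) = res P S T f (q' T m)"
      using S by (auto simp: q'_def carrF' resF' kj right_module_closed[OF F] module_hom_natural[OF qhom])
  qed
  have "right_module G P"
    using P by (simp add: projective_module_def)
  moreover have "(\<lambda>T x. x) \<in> module_hom G P P"
    unfolding module_hom_def hom_def by auto
  ultimately obtain h where h: "h \<in> module_hom G P F'"
      "\<And>T x. T \<in> orbit_objects G \<Longrightarrow> x \<in> carrier (val P T) \<Longrightarrow> q' T (h T x) = x"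
    using P F' q' unfolding projective_module_def by meson
  define i where "i T = k T \<circ> h T" for T
  have "i \<in> module_hom G P F"
    unfolding module_hom_def
  proof (intro CollectI conjI ballI)
    fix S assume S: "S \<in> orbit_objects G"
    show "i S \<in> hom (val P S) (val F S)"
      unfolding i_def using Group.hom_compose[OF module_hom_hom[OF h(1) S] khom[OF S]] .
    fix T f m
    assume T: "T \<in> orbit_objects G" "f \<in> orbit_hom G S T" "m \<in> carrier (val P T)"
    have "k T (h T m) \<in> carrier (val F T)"
      using module_hom_closed[OF h(1) T(1,3)] khom[OF T(1)] hom_in_carrier by fastforce
    then show "i S (res P S T f m) = res F S T f (i T m)"
      using S T by (simp add: i_def module_hom_natural[OF h(1)] resF' kj right_module_closed[OF F])
  qed
  moreover have "q T (i T x) = x" if "T \<in> orbit_objects G" "x \<in> carrier (val P T)" for T x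
    using h(2)[OF that] by (simp add: i_def q'_def)
  ultimately show thesis
    using that by blast
qed

section \<open>Free abelian groups inside an infinite universe\<close>

lemma frag_map_inj_on:
  assumes "inj_on j B"
  shows "inj_on (frag_map j) {c. Poly_Mapping.keys c \<subseteq> B}"
proof (rule inj_on_inverseI)
  fix c :: "'a \<Rightarrow>\<^sub>0 int"
  assume "c \<in> {c. Poly_Mapping.keys c \<subseteq> B}"
  then show "frag_map (inv_into B j) (frag_map j c) = c"
    using assms unfolding frag_map_compose by (intro frag_map_id[of c B]) auto
qed

lemma frag_map_lift:
  assumes "Poly_Mapping.keys c \<subseteq> f ` B"
  obtains c' where "Poly_Mapping.keys c' \<subseteq> B" "frag_map f c' = c"
proof
  let ?c = "frag_map (inv_into B f) c"
  show "Poly_Mapping.keys ?c \<subseteq> B"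
    using keys_frag_map[of "inv_into B f" c] assms inv_into_into[of _ f B] by blast
  show "frag_map f ?c = c"
    unfolding frag_map_compose using assms by (intro frag_map_id[of c "f ` B"]) (auto simp: f_inv_into_f)
qed

text \<open>The free abelian group on an infinite type has the same cardinality as the type, so an
  injection of the basis is enough.\<close>

lemma frag_inj_into_type:
  fixes B :: "'b set"
  assumes "B \<lesssim> (UNIV :: 'a set)" "infinite (UNIV :: 'a set)"
  shows "\<exists>j :: ('b \<Rightarrow>\<^sub>0 int) \<Rightarrow> 'a. inj_on j (carrier (free_Abelian_group B))"
proof -
  obtain j :: "'b \<Rightarrow> 'a" where "inj_on j B"
    using assms(1) unfolding lepoll_def by blast
  then have j: "inj_on (frag_map j) (carrier (free_Abelian_group B))"
    using frag_map_inj_on by (simp add: free_Abelian_group_def)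
  obtain k :: "('a \<Rightarrow>\<^sub>0 int) \<Rightarrow> 'a" where "inj_on k (carrier (free_Abelian_group UNIV))"
    using eqpoll_imp_lepoll[OF eqpoll_free_Abelian_group_infinite[OF assms(2)]] unfolding lepoll_def by blast
  then have "inj_on k (frag_map j ` carrier (free_Abelian_group B))"
    by (rule inj_on_subset) auto
  then have "inj_on (k \<circ> frag_map j) (carrier (free_Abelian_group B))"
    using j by (intro comp_inj_on)
  then show ?thesis
    by blast
qed

subsection \<open>Free modules\<close>

text \<open>By the Yoneda lemma an element \<open>m\<close> of \<open>M\<close> at \<open>S\<close>
  is a map to \<open>M\<close> from the free module on the functor represented by \<open>S\<close>.
  The free module is the direct sum of these over all pairs \<open>(S, m)\<close>; at
  \<open>T\<close> the summand has the maps \<open>h\<close> from \<open>T\<close> to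
  \<open>S\<close> as basis.\<close>

definition free_basis ::
  "('g, 'x) monoid_scheme \<Rightarrow> ('g, 'm) orbit_functor \<Rightarrow> 'g set set
     \<Rightarrow> (('g set set \<times> 'm) \<times> ('g set \<Rightarrow> 'g set)) set" where
  "free_basis G M T = {((S, m), h) | S m h. S \<in> orbit_objects G \<and> m \<in> carrier (val M S) \<and> h \<in> orbit_hom G T S}"

definition precompose ::
  "'g set set \<Rightarrow> ('g set \<Rightarrow> 'g set) \<Rightarrow> ('i \<times> ('g set \<Rightarrow> 'g set)) \<Rightarrow> 'i \<times> ('g set \<Rightarrow> 'g set)" where
  "precompose S f = (\<lambda>(i, h). (i, compose S h f))"

definition free_module ::
  "('g, 'x) monoid_scheme \<Rightarrow> ('g, 'm) orbit_functor
     \<Rightarrow> ('g, (('g set set \<times> 'm) \<times> ('g set \<Rightarrow> 'g set)) \<Rightarrow>\<^sub>0 int) orbit_functor" where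
  "free_module G M = \<lparr>val = (\<lambda>T. free_Abelian_group (free_basis G M T)),
     res = (\<lambda>S T f. frag_map (precompose S f))\<rparr>"

lemma val_free_module [simp]: "val (free_module G M) T = free_Abelian_group (free_basis G M T)"
  and res_free_module [simp]: "res (free_module G M) S T f = frag_map (precompose S f)"
  by (simp_all add: free_module_def)

lemma free_Abelian_group_hom_eq:
  assumes "group H" "f \<in> hom (free_Abelian_group B) H" "g \<in> hom (free_Abelian_group B) H"
    and "\<And>b. b \<in> B \<Longrightarrow> f (frag_of b) = g (frag_of b)" and "Poly_Mapping.keys c \<subseteq> B"
  shows "f c = g c"
proof (rule free_Abelian_group_induct[OF assms(5)])
  interpret f: group_hom "free_Abelian_group B" H f
    using assms by (simp add: group_hom_def group_hom_axioms_def)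
  interpret g: group_hom "free_Abelian_group B" H g
    using assms by (simp add: group_hom_def group_hom_axioms_def)
  show "f 0 = g 0"
    using f.hom_one g.hom_one by simp
  fix x y
  assume xy: "Poly_Mapping.keys x \<subseteq> B" "Poly_Mapping.keys y \<subseteq> B" "f x = g x" "f y = g y"
  show "f (x - y) = g (x - y)"
    using xy(3,4) f.hom_mult[of x "- y"] g.hom_mult[of x "- y"] f.hom_inv[of y] g.hom_inv[of y]
    by (simp add: xy(1,2))
qed (use assms(4) in auto)

context group
begin

lemma orbit_objectE:
  assumes "S \<in> orbit_objects G"
  obtains H where "H \<in> VC G" "subgroup H G" "S = lcosets H"
  using assms unfolding orbit_objects_def VC_def by blast

lemma orbit_object_act: "S \<in> orbit_objects G \<Longrightarrow> g \<in> carrier G \<Longrightarrow> x \<in> S \<Longrightarrow> g <# x \<in> S"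
proof (erule orbit_objectE)
  fix H assume *: "g \<in> carrier G" "x \<in> S" "subgroup H G" "S = lcosets H"
  then obtain a where "a \<in> carrier G" "x = a <# H"
    by (auto simp: LCOSETS_def)
  then have "g <# x = (g \<otimes> a) <# H" "g \<otimes> a \<in> carrier G"
    using *(1) lcos_m_assoc[OF subgroup.subset[OF *(3)]] by auto
  then show "g <# x \<in> S"
    using * by (auto simp: LCOSETS_def)
qed

lemma orbit_hom_apply: "f \<in> orbit_hom G S T \<Longrightarrow> x \<in> S \<Longrightarrow> f x \<in> T"
  unfolding orbit_hom_def by auto

lemma orbit_hom_equivariant:
  "f \<in> orbit_hom G S T \<Longrightarrow> g \<in> carrier G \<Longrightarrow> x \<in> S \<Longrightarrow> f (g <# x) = g <# f x"
  unfolding orbit_hom_def by blast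

lemma orbit_hom_id: "S \<in> orbit_objects G \<Longrightarrow> (\<lambda>x\<in>S. x) \<in> orbit_hom G S S"
  unfolding orbit_hom_def using orbit_object_act by auto

lemma orbit_hom_compose:
  "S \<in> orbit_objects G \<Longrightarrow> f \<in> orbit_hom G S T \<Longrightarrow> h \<in> orbit_hom G T U \<Longrightarrow> compose S h f \<in> orbit_hom G S U"
  unfolding orbit_hom_def compose_def using orbit_object_act by (auto simp: PiE_iff)

lemma precompose_basis:
  "S \<in> orbit_objects G \<Longrightarrow> f \<in> orbit_hom G S T \<Longrightarrow> b \<in> free_basis G M T \<Longrightarrow> precompose S f b \<in> free_basis G M S"
  unfolding free_basis_def precompose_def using orbit_hom_compose by auto

lemma precompose_id: "b \<in> free_basis G M S \<Longrightarrow> precompose S (\<lambda>x\<in>S. x) b = b"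
  unfolding free_basis_def precompose_def orbit_hom_def by (auto simp: PiE_def compose_Id)

lemma precompose_compose:
  "f \<in> orbit_hom G S T \<Longrightarrow> precompose S (compose S h f) b = precompose S f (precompose T h b)"
  unfolding precompose_def orbit_hom_def
  by (auto simp: compose_def PiE_iff intro!: restrict_ext split: prod.splits)

lemma frag_precompose_hom:
  assumes "S \<in> orbit_objects G" "f \<in> orbit_hom G S T"
  shows "frag_map (precompose S f) \<in> hom (free_Abelian_group (free_basis G M T)) (free_Abelian_group (free_basis G M S))"
proof (rule homI)
  fix c :: "((('a set set) \<times> 'c) \<times> ('a set \<Rightarrow> 'a set)) \<Rightarrow>\<^sub>0 int"
  assume "c \<in> carrier (free_Abelian_group (free_basis G M T))"
  then show "frag_map (precompose S f) c \<in> carrier (free_Abelian_group (free_basis G M S))"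
    using keys_frag_map[of "precompose S f" c] precompose_basis[OF assms] by fastforce
qed (simp add: frag_extend_add)

lemma right_module_free: "right_module G (free_module G M)"
  unfolding right_module_def
proof (intro conjI ballI)
  fix S assume S: "S \<in> orbit_objects G"
  show "comm_group (val (free_module G M) S)"
    by (simp add: abelian_free_Abelian_group)
  show "res (free_module G M) S S (\<lambda>x\<in>S. x) m = m" if "m \<in> carrier (val (free_module G M) S)" for m
    using that by (simp, intro frag_map_id[of m "free_basis G M S"]) (auto simp: precompose_id)
  fix T f assume T: "T \<in> orbit_objects G" "f \<in> orbit_hom G S T"
  show "res (free_module G M) S T f \<in> hom (val (free_module G M) T) (val (free_module G M) S)"
    using frag_precompose_hom[OF S T(2)] by simp
  fix U h m
  assume "U \<in> orbit_objects G" "h \<in> orbit_hom G T U" "m \<in> carrier (val (free_module G M) U)"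
  then show "res (free_module G M) S U (compose S h f) m =
      res (free_module G M) S T f (res (free_module G M) T U h m)"
    by (simp add: frag_map_compose precompose_compose[OF T(2)])
qed

text \<open>The basis element \<open>((S, m), h)\<close> goes to the restriction of \<open>m\<close>
  along \<open>h\<close>; taking the identity for \<open>h\<close> gives surjectivity, and
  functoriality of \<open>M\<close> gives naturality.\<close>

lemma free_module_cover:
  assumes M: "right_module G M"
  obtains q where "q \<in> module_epi G (free_module G M) M"
proof -
  have "\<exists>q. q \<in> hom (free_Abelian_group (free_basis G M T)) (val M T) \<and>
      (\<forall>S m h. ((S, m), h) \<in> free_basis G M T \<longrightarrow> q (frag_of ((S, m), h)) = res M T S h m)"
    if T: "T \<in> orbit_objects G" for T
  proof -
    let ?f = "\<lambda>((S, m), h). res M T S h m"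
    have "?f ` free_basis G M T \<subseteq> carrier (val M T)"
      using right_module_closed[OF M T] by (auto simp: free_basis_def)
    then obtain q where "q \<in> hom (free_Abelian_group (free_basis G M T)) (val M T)"
        "\<And>b. b \<in> free_basis G M T \<Longrightarrow> q (frag_of b) = ?f b"
      using comm_group.free_Abelian_group_universal[OF right_module_comm_group[OF M T]] by blast
    then show ?thesis
      by (intro exI[of _ q]) auto
  qed
  then obtain q where q: "\<And>T. T \<in> orbit_objects G \<Longrightarrow>
      q T \<in> hom (free_Abelian_group (free_basis G M T)) (val M T)"
      "\<And>T S m h. T \<in> orbit_objects G \<Longrightarrow> ((S, m), h) \<in> free_basis G M T \<Longrightarrow> q T (frag_of ((S, m), h)) = res M T S h m"
    by metis
  have "q \<in> module_epi G (free_module G M) M"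
    unfolding module_epi_def module_hom_def
  proof (intro CollectI conjI ballI)
    fix S assume S: "S \<in> orbit_objects G"
    show "q S \<in> hom (val (free_module G M) S) (val M S)"
      using q(1)[OF S] by simp
    show "q S ` carrier (val (free_module G M) S) = carrier (val M S)"
    proof
      show "q S ` carrier (val (free_module G M) S) \<subseteq> carrier (val M S)"
        using hom_carrier[OF q(1)[OF S]] by simp
      show "carrier (val M S) \<subseteq> q S ` carrier (val (free_module G M) S)"
      proof
        fix m assume m: "m \<in> carrier (val M S)"
        have b: "((S, m), \<lambda>x\<in>S. x) \<in> free_basis G M S"
          using S m orbit_hom_id by (simp add: free_basis_def)
        then have "q S (frag_of ((S, m), \<lambda>x\<in>S. x)) = m"
          using q(2)[OF S b] right_module_id[OF M S m] by simp
        then show "m \<in> q S ` carrier (val (free_module G M) S)"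
          using b by (intro image_eqI[of _ _ "frag_of ((S, m), \<lambda>x\<in>S. x)"]) auto
      qed
    qed
    fix T f c
    assume T: "T \<in> orbit_objects G" "f \<in> orbit_hom G S T" "c \<in> carrier (val (free_module G M) T)"
    have "(q S \<circ> frag_map (precompose S f)) c = (res M S T f \<circ> q T) c"
    proof (rule free_Abelian_group_hom_eq[OF right_module_group[OF M S]])
      show "q S \<circ> frag_map (precompose S f) \<in> hom (free_Abelian_group (free_basis G M T)) (val M S)"
        using Group.hom_compose[OF frag_precompose_hom[OF S T(2)] q(1)[OF S]] .
      show "res M S T f \<circ> q T \<in> hom (free_Abelian_group (free_basis G M T)) (val M S)"
        using Group.hom_compose[OF q(1)[OF T(1)] right_module_hom[OF M S T(1,2)]] .
      fix b assume b: "b \<in> free_basis G M T"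
      then obtain U m h where U: "b = ((U, m), h)" "U \<in> orbit_objects G" "m \<in> carrier (val M U)" "h \<in> orbit_hom G T U"
        by (auto simp: free_basis_def)
      have "precompose S f b = ((U, m), compose S h f)"
        by (simp add: U precompose_def)
      moreover have "precompose S f b \<in> free_basis G M S"
        using precompose_basis[OF S T(2) b] .
      ultimately have "q S (frag_of (precompose S f b)) = res M S U (compose S h f) m"
        using q(2)[OF S] by simp
      then show "(q S \<circ> frag_map (precompose S f)) (frag_of b) = (res M S T f \<circ> q T) (frag_of b)"
        using q(2)[OF T(1)] b U right_module_compose[OF M S T(1) U(2) T(2) U(4) U(3)] by simp
    qed (use T(3) in simp)
    then show "q S (res (free_module G M) S T f c) = res M S T f (q T c)"
      by simp
  qed
  then show thesis
    using that by blast
qed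

section \<open>Cardinality of the free cover and splitting of projectives\<close>

lemma infinite_universe: "infinite (UNIV :: ('g list + 'm) set)"
proof
  assume "finite (UNIV :: ('g list + 'm) set)"
  then have "finite (range (Inl :: 'g list \<Rightarrow> 'g list + 'm))"
    by (rule rev_finite_subset) simp
  then have "finite (UNIV :: 'g list set)"
    by (rule finite_imageD) simp
  then show False
    by (simp add: infinite_UNIV_listI)
qed

text \<open>Every coset is a translate of \<open>K\<close>, and extensionality fixes the values off
  the orbit.\<close>

lemma orbit_hom_determined:
  assumes "subgroup K G" "h \<in> orbit_hom G (lcosets K) S" "h' \<in> orbit_hom G (lcosets K) S" "h K = h' K"
  shows "h = h'"
proof
  fix x
  show "h x = h' x"
  proof (cases "x \<in> lcosets K")
    case True
    then obtain g where g: "g \<in> carrier G" "x = g <# K"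
      by (auto simp: LCOSETS_def)
    have "\<one> <# K \<in> lcosets K"
      by (auto simp: LCOSETS_def)
    then have "K \<in> lcosets K"
      using lcos_mult_one[OF subgroup.subset[OF assms(1)]] by simp
    then show ?thesis
      using assms g orbit_hom_equivariant by metis
  next
    case False
    then show ?thesis
      using assms(2,3) by (auto simp: orbit_hom_def PiE_def extensional_def)
  qed
qed

text \<open>A basis element is recovered from generators of the subgroup whose cosets form
  \<open>S\<close>, the element \<open>m\<close>, and one group element of the coset
  \<open>h K\<close>. Thus the free cover fits into the universe of the resolution, where the
  lifting property is available.\<close>

lemma free_basis_lepoll:
  fixes M :: "('a, 'a list + 'm) orbit_functor"
  assumes "T \<in> orbit_objects G"
  shows "free_basis G M T \<lesssim> (UNIV :: ('a list + 'm) set)"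
proof -
  obtain K where K: "K \<in> VC G" "subgroup K G" "T = lcosets K"
    by (rule orbit_objectE[OF assms])
  have "\<one> <# K \<in> T"
    using K(3) by (auto simp: LCOSETS_def)
  then have K1: "K \<in> T"
    using lcos_mult_one[OF subgroup.subset[OF K(2)]] by simp
  have "\<exists>xs. S = lcosets (generate G (set xs)) \<and> set xs \<subseteq> carrier G" if S: "S \<in> orbit_objects G" for S
  proof -
    obtain H where H: "H \<in> VC G" "subgroup H G" "S = lcosets H"
      by (rule orbit_objectE[OF S])
    obtain xs where "set xs \<subseteq> carrier G" "H = generate G (set xs)"
      by (rule VC_finitely_generated[OF H(1)])
    then show ?thesis
      using H(3) by blast
  qed
  then obtain code where code: "\<And>S. S \<in> orbit_objects G \<Longrightarrow> S = lcosets (generate G (set (code S)))"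
      "\<And>S. S \<in> orbit_objects G \<Longrightarrow> set (code S) \<subseteq> carrier G"
    by metis
  define rep where "rep x = (SOME g. g \<in> x)" for x :: "'a set"
  have rep: "rep x \<in> x" if x: "S \<in> orbit_objects G" "x \<in> S" for S x
  proof -
    obtain H where H: "H \<in> VC G" "subgroup H G" "S = lcosets H"
      by (rule orbit_objectE[OF x(1)])
    then obtain a where "a \<in> carrier G" "x = a <# H"
      using x(2) by (auto simp: LCOSETS_def)
    then have "x \<noteq> {}"
      using lcos_self H(2) by blast
    then show ?thesis
      unfolding rep_def by (simp add: some_in_eq)
  qed
  \<comment> \<open>The representative is wrapped in a one-element list so that it fits into the
    list summand of the universe.\<close>
  define J where "J = (\<lambda>((S, m), h). (code S, (m, [rep (h K)])) :: 'a list \<times> (('a list + 'm) \<times> 'a list))"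
  have "inj_on J (free_basis G M T)"
  proof (rule inj_onI)
    fix b b' assume b: "b \<in> free_basis G M T" "b' \<in> free_basis G M T" "J b = J b'"
    obtain S m h where Smh: "b = ((S, m), h)" "S \<in> orbit_objects G" "h \<in> orbit_hom G T S"
      using b(1) by (auto simp: free_basis_def)
    obtain S' m' h' where Smh': "b' = ((S', m'), h')" "S' \<in> orbit_objects G" "h' \<in> orbit_hom G T S'"
      using b(2) by (auto simp: free_basis_def)
    have eq: "code S = code S'" "m = m'" "rep (h K) = rep (h' K)"
      using b(3) Smh Smh' by (auto simp: J_def)
    have SS: "S = S'"
      using code(1)[OF Smh(2)] code(1)[OF Smh'(2)] eq(1) by simp
    have hK: "h K \<in> S" "h' K \<in> S"
      using orbit_hom_apply Smh Smh' SS K1 by blast+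
    have "rep (h K) \<in> h K \<inter> h' K"
      using rep[OF Smh(2) hK(1)] rep[OF Smh(2) hK(2)] eq(3) by simp
    moreover obtain H where H: "H \<in> VC G" "subgroup H G" "S = lcosets H"
      by (rule orbit_objectE[OF Smh(2)])
    ultimately have "h K = h' K"
      using lcos_disjoint[OF H(2)] hK unfolding H(3) by blast
    then have "h = h'"
      using orbit_hom_determined[OF K(2)] Smh(3) Smh'(3) SS K(3) by blast
    then show "b = b'"
      using Smh Smh' SS eq by simp
  qed
  then have "free_basis G M T \<lesssim> (UNIV :: ('a list \<times> (('a list + 'm) \<times> 'a list)) set)"
    unfolding lepoll_def by blast
  also have "\<dots> \<lesssim> (UNIV :: ('a list + 'm) set) \<times> ((UNIV :: ('a list + 'm) set) \<times> (UNIV :: ('a list + 'm) set))"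
  proof -
    have "(UNIV :: 'a list set) \<lesssim> (UNIV :: ('a list + 'm) set)"
      unfolding lepoll_def using inj_Inl by blast
    then show ?thesis
      unfolding UNIV_Times_UNIV[symmetric] by (intro times_lepoll_mono) auto
  qed
  also have "\<dots> \<approx> (UNIV :: ('a list + 'm) set)"
  proof -
    have sq: "(UNIV :: ('a list + 'm) set) \<times> (UNIV :: ('a list + 'm) set) \<approx> (UNIV :: ('a list + 'm) set)"
      unfolding eqpoll_iff_card_of_ordIso by (rule card_of_Times_same_infinite[OF infinite_universe])
    show ?thesis
      using times_eqpoll_cong[OF eqpoll_refl sq] sq eqpoll_trans by blast
  qed
  finally show ?thesis .
qed

lemma projective_retract:
  fixes M :: "('a, 'a list + 'm) orbit_functor"
  assumes "projective_module G M"
  obtains i q where "i \<in> module_hom G M (free_module G M)" "q \<in> module_hom G (free_module G M) M"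
    "\<And>T x. T \<in> orbit_objects G \<Longrightarrow> x \<in> carrier (val M T) \<Longrightarrow> q T (i T x) = x"
proof -
  have M: "right_module G M"
    using assms by (simp add: projective_module_def)
  obtain q where q: "q \<in> module_epi G (free_module G M) M"
    using free_module_cover[OF M] .
  have "\<exists>j :: _ \<Rightarrow> 'a list + 'm. inj_on j (carrier (val (free_module G M) T))" if "T \<in> orbit_objects G" for T
    using frag_inj_into_type[OF free_basis_lepoll[OF that] infinite_universe] by simp
  then obtain i where "i \<in> module_hom G M (free_module G M)"
    "\<And>T x. T \<in> orbit_objects G \<Longrightarrow> x \<in> carrier (val M T) \<Longrightarrow> q T (i T x) = x"
    using projective_section[OF assms right_module_free _ q] by blast
  moreover have "q \<in> module_hom G (free_module G M) M"
    using q by (simp add: module_epi_def)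
  ultimately show thesis
    using that by blast
qed

end

section \<open>Evaluation at the orbit with trivial stabiliser\<close>

lemma keys_frag_map_subset:
  "Poly_Mapping.keys c \<subseteq> B \<Longrightarrow> Poly_Mapping.keys (frag_map f c) \<subseteq> f ` B"
  using keys_frag_map[of f c] by blast

context group
begin

definition base :: "'a set set" where
  "base = lcosets {\<one>}"

definition right_mult :: "'a \<Rightarrow> 'a set \<Rightarrow> 'a set" where
  "right_mult g = (\<lambda>x\<in>base. x #> g)"

definition quotient_map :: "'a set \<Rightarrow> 'a set \<Rightarrow> 'a set" where
  "quotient_map H = (\<lambda>x\<in>base. x <#> H)"

text \<open>Right multiplications are equivariant self-maps of the orbit of the trivial subgroup.
  They compose in the opposite order, and precomposition reverses the order again, so a left action
  results.\<close>

definition base_act :: "'a \<Rightarrow> ('i \<times> ('a set \<Rightarrow> 'a set)) \<Rightarrow> 'i \<times> ('a set \<Rightarrow> 'a set)" where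
  "base_act g = precompose base (right_mult g)"

lemma VC_object: "H \<in> VC G \<Longrightarrow> lcosets H \<in> orbit_objects G"
  unfolding orbit_objects_def by blast

lemma base_eq: "base = (\<lambda>a. {a}) ` carrier G"
  unfolding base_def LCOSETS_def l_coset_def by auto

lemma one_base: "{\<one>} \<in> base"
  unfolding base_eq by blast

lemma trivial_VC: "{\<one>} \<in> VC G"
  using generate_singleton_VC[OF one_closed] generate_one by simp

lemma base_object: "base \<in> orbit_objects G"
  unfolding base_def using VC_object[OF trivial_VC] .

lemma l_coset_singleton: "g <# {a} = {g \<otimes> a}"
  unfolding l_coset_def by simp

lemma right_mult_apply: "a \<in> carrier G \<Longrightarrow> right_mult g {a} = {a \<otimes> g}"
  by (simp add: right_mult_def base_eq r_coset_def)

lemma quotient_map_apply: "a \<in> carrier G \<Longrightarrow> quotient_map H {a} = a <# H"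
  by (auto simp: quotient_map_def base_eq set_mult_def l_coset_def)

lemma right_mult_hom:
  assumes "g \<in> carrier G"
  shows "right_mult g \<in> orbit_hom G base base"
  unfolding orbit_hom_def
proof (intro CollectI conjI ballI)
  show "right_mult g \<in> base \<rightarrow>\<^sub>E base"
    using assms by (auto simp: base_eq right_mult_def r_coset_def)
  fix k x assume k: "k \<in> carrier G" and "x \<in> base"
  then obtain a where a: "a \<in> carrier G" "x = {a}"
    by (auto simp: base_eq)
  show "right_mult g (k <# x) = k <# right_mult g x"
    using a k assms by (simp add: l_coset_singleton right_mult_apply m_assoc)
qed

lemma quotient_map_hom:
  assumes "H \<in> VC G"
  shows "quotient_map H \<in> orbit_hom G base (lcosets H)"
  unfolding orbit_hom_def
proof (intro CollectI conjI ballI)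
  have H: "H \<subseteq> carrier G"
    using assms subgroup.subset by (auto simp: VC_def)
  show "quotient_map H \<in> base \<rightarrow>\<^sub>E lcosets H"
  proof (rule PiE_I)
    fix x assume "x \<in> base"
    then obtain a where "a \<in> carrier G" "x = {a}"
      by (auto simp: base_eq)
    then show "quotient_map H x \<in> lcosets H"
      by (auto simp: quotient_map_apply LCOSETS_def)
  qed (simp add: quotient_map_def)
  fix k x assume k: "k \<in> carrier G" and "x \<in> base"
  then obtain a where a: "a \<in> carrier G" "x = {a}"
    by (auto simp: base_eq)
  show "quotient_map H (k <# x) = k <# quotient_map H x"
    using a k H by (simp add: l_coset_singleton quotient_map_apply lcos_m_assoc)
qed

lemma base_hom_eqI:
  "h \<in> orbit_hom G base S \<Longrightarrow> h' \<in> orbit_hom G base S \<Longrightarrow> h {\<one>} = h' {\<one>} \<Longrightarrow> h = h'"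
  using orbit_hom_determined[of "{\<one>}" h S h'] trivial_VC unfolding base_def VC_def by blast

lemma base_hom_apply:
  assumes "h \<in> orbit_hom G base S" "a \<in> carrier G"
  shows "h {a} = a <# h {\<one>}"
  using orbit_hom_equivariant[OF assms one_base] assms(2) by (simp add: l_coset_singleton)

lemma compose_right_mult:
  assumes "h \<in> orbit_hom G base S" "g \<in> carrier G"
  shows "compose base h (right_mult g) {\<one>} = g <# h {\<one>}"
  using assms one_base base_hom_apply[OF assms] by (simp add: compose_def right_mult_apply)

lemma object_subset: "S \<in> orbit_objects G \<Longrightarrow> x \<in> S \<Longrightarrow> x \<subseteq> carrier G"
  by (erule orbit_objectE) (use subgroup.lcosets_carrier[OF _ is_group] in blast)

lemma right_mult_one: "right_mult \<one> = (\<lambda>x\<in>base. x)"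
  by (rule base_hom_eqI[OF right_mult_hom[OF one_closed] orbit_hom_id[OF base_object]])
    (simp add: right_mult_apply one_base)

lemma right_mult_mult:
  assumes "g \<in> carrier G" "h \<in> carrier G"
  shows "right_mult (g \<otimes> h) = compose base (right_mult h) (right_mult g)"
proof (rule base_hom_eqI)
  show "right_mult (g \<otimes> h) \<in> orbit_hom G base base"
    using assms by (simp add: right_mult_hom)
  show "compose base (right_mult h) (right_mult g) \<in> orbit_hom G base base"
    by (rule orbit_hom_compose[OF base_object right_mult_hom[OF assms(1)] right_mult_hom[OF assms(2)]])
  show "right_mult (g \<otimes> h) {\<one>} = compose base (right_mult h) (right_mult g) {\<one>}"
    using assms one_base by (simp add: compose_def right_mult_apply)
qed

text \<open>A map out of \<open>base\<close> is determined by the image of \<open>{\<one>}\<close>,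
  which \<open>base_act g\<close> translates by \<open>g\<close>. Stabilisers of basis elements are
  therefore stabilisers of points of orbits.\<close>

lemma base_act_fixes_iff:
  assumes "((S, m), h) \<in> free_basis G M base" "g \<in> carrier G"
  shows "(base_act g ((S, m), h) = ((S, m), h)) = (g <# h {\<one>} = h {\<one>})"
proof -
  have h: "h \<in> orbit_hom G base S"
    using assms(1) by (simp add: free_basis_def)
  have "compose base h (right_mult g) = h \<longleftrightarrow> compose base h (right_mult g) {\<one>} = h {\<one>}"
    using base_hom_eqI[OF orbit_hom_compose[OF base_object right_mult_hom[OF assms(2)] h] h] by auto
  then show ?thesis
    using compose_right_mult[OF h assms(2)] by (simp add: base_act_def precompose_def)
qed

lemma l_coset_stabiliser:
  assumes "subgroup H G" "a \<in> carrier G"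
  shows "{g \<in> carrier G. g <# (a <# H) = a <# H} = (\<lambda>h. a \<otimes> h \<otimes> inv a) ` H"
proof
  have H: "h \<in> carrier G" if "h \<in> H" for h
    using that subgroup.mem_carrier[OF assms(1)] by blast
  show "{g \<in> carrier G. g <# (a <# H) = a <# H} \<subseteq> (\<lambda>h. a \<otimes> h \<otimes> inv a) ` H"
  proof
    fix g assume "g \<in> {g \<in> carrier G. g <# (a <# H) = a <# H}"
    then have g: "g \<in> carrier G" "(g \<otimes> a) <# H = a <# H"
      using assms lcos_m_assoc[OF subgroup.subset[OF assms(1)]] by auto
    then have "g \<otimes> a \<in> a <# H"
      using lcos_self[of "g \<otimes> a" H] assms by simp
    then obtain h where h: "h \<in> H" "g \<otimes> a = a \<otimes> h"
      by (auto simp: l_coset_def)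
    then have "g = a \<otimes> h \<otimes> inv a"
      using g(1) assms(2) H by (metis inv_solve_right m_closed)
    then show "g \<in> (\<lambda>h. a \<otimes> h \<otimes> inv a) ` H"
      using h(1) by blast
  qed
  show "(\<lambda>h. a \<otimes> h \<otimes> inv a) ` H \<subseteq> {g \<in> carrier G. g <# (a <# H) = a <# H}"
  proof
    fix g assume "g \<in> (\<lambda>h. a \<otimes> h \<otimes> inv a) ` H"
    then obtain h where h: "h \<in> H" "g = a \<otimes> h \<otimes> inv a" by blast
    have ga: "g \<otimes> a = a \<otimes> h" "g \<in> carrier G"
      using h H assms(2) by (auto simp: m_assoc)
    have "a \<otimes> h \<in> a <# H"
      using h(1) by (auto simp: l_coset_def)
    then have "a <# H = (a \<otimes> h) <# H"
      using l_repr_independence assms by blast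
    moreover have "g <# (a <# H) = (g \<otimes> a) <# H"
      using lcos_m_assoc[OF subgroup.subset[OF assms(1)] ga(2) assms(2)] .
    ultimately show "g \<in> {g \<in> carrier G. g <# (a <# H) = a <# H}"
      using ga by simp
  qed
qed

lemma base_VC_set: "VC_set G (free_basis G M base) base_act"
proof unfold_locales
  show "base_act g b \<in> free_basis G M base" if "g \<in> carrier G" "b \<in> free_basis G M base" for g b
    using precompose_basis[OF base_object right_mult_hom] that unfolding base_act_def by blast
  show "base_act \<one> b = b" if "b \<in> free_basis G M base" for b
    using precompose_id[OF that] by (simp add: base_act_def right_mult_one)
  show "base_act (g \<otimes> h) b = base_act g (base_act h b)" if "g \<in> carrier G" "h \<in> carrier G" for g h b
    using precompose_compose[OF right_mult_hom] that by (simp add: base_act_def right_mult_mult)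
  show "{g \<in> carrier G. base_act g b = b} \<in> VC G" if "b \<in> free_basis G M base" for b
  proof -
    obtain S m h where b: "b = ((S, m), h)" "S \<in> orbit_objects G" "h \<in> orbit_hom G base S"
      using \<open>b \<in> free_basis G M base\<close> by (auto simp: free_basis_def)
    obtain H where H: "H \<in> VC G" "subgroup H G" "S = lcosets H"
      by (rule orbit_objectE[OF b(2)])
    have "h {\<one>} \<in> lcosets H"
      using orbit_hom_apply[OF b(3) one_base] H(3) by simp
    then obtain a where a: "a \<in> carrier G" "h {\<one>} = a <# H"
      by (auto simp: LCOSETS_def)
    have "{g \<in> carrier G. base_act g b = b} = {g \<in> carrier G. g <# (a <# H) = a <# H}"
      using base_act_fixes_iff[of S m h M] \<open>b \<in> free_basis G M base\<close> a(2) unfolding b(1) by auto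
    then show ?thesis
      using l_coset_stabiliser[OF H(2) a(1)] VC_conj[OF H(1) a(1)] by simp
  qed
qed

text \<open>Maps from \<open>base\<close> to \<open>S\<close> correspond to points of
  \<open>S\<close>, and the points fixed by \<open>H\<close> correspond to maps from
  \<open>lcosets H\<close>. This turns exactness at the orbit of \<open>H\<close> into exactness on
  elements supported on \<open>H\<close>-fixed points.\<close>

lemma base_fixed_eq:
  assumes H: "H \<in> VC G"
  shows "{b \<in> free_basis G M base. \<forall>k\<in>H. base_act k b = b} =
    precompose base (quotient_map H) ` free_basis G M (lcosets H)"
proof
  have sub: "subgroup H G"
    using H by (simp add: VC_def)
  have HG: "k \<in> carrier G" if "k \<in> H" for k
    using that subgroup.mem_carrier[OF sub] by blast
  have q: "quotient_map H \<in> orbit_hom G base (lcosets H)"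
    by (rule quotient_map_hom[OF H])
  show "precompose base (quotient_map H) ` free_basis G M (lcosets H) \<subseteq>
      {b \<in> free_basis G M base. \<forall>k\<in>H. base_act k b = b}"
  proof
    fix b assume "b \<in> precompose base (quotient_map H) ` free_basis G M (lcosets H)"
    then obtain c where c: "c \<in> free_basis G M (lcosets H)" "b = precompose base (quotient_map H) c"
      by blast
    have "base_act k b = b" if k: "k \<in> H" for k
    proof -
      have kG: "k \<in> carrier G"
        using HG[OF k] .
      have "compose base (quotient_map H) (right_mult k) = quotient_map H"
      proof (rule base_hom_eqI[OF orbit_hom_compose[OF base_object right_mult_hom[OF kG] q] q])
        have "k <# H = H"
          using sub k by (simp add: coset_join3 kG)
        then show "compose base (quotient_map H) (right_mult k) {\<one>} = quotient_map H {\<one>}"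
          using compose_right_mult[OF q kG] lcos_mult_one[OF subgroup.subset[OF sub]]
          by (simp add: quotient_map_apply)
      qed
      then show ?thesis
        using precompose_compose[OF right_mult_hom[OF kG], of "quotient_map H" c]
        unfolding c(2) base_act_def by simp
    qed
    moreover have "b \<in> free_basis G M base"
      using c precompose_basis[OF base_object q] by blast
    ultimately show "b \<in> {b \<in> free_basis G M base. \<forall>k\<in>H. base_act k b = b}"
      by blast
  qed
  show "{b \<in> free_basis G M base. \<forall>k\<in>H. base_act k b = b} \<subseteq>
      precompose base (quotient_map H) ` free_basis G M (lcosets H)"
  proof
    fix b assume "b \<in> {b \<in> free_basis G M base. \<forall>k\<in>H. base_act k b = b}"
    then have b: "b \<in> free_basis G M base" "\<And>k. k \<in> H \<Longrightarrow> base_act k b = b" by auto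
    then obtain S m h where Smh: "b = ((S, m), h)" "S \<in> orbit_objects G" "m \<in> carrier (val M S)"
        "h \<in> orbit_hom G base S"
      by (auto simp: free_basis_def)
    define x where "x = h {\<one>}"
    have xS: "x \<in> S"
      unfolding x_def using orbit_hom_apply[OF Smh(4) one_base] .
    have xG: "x \<subseteq> carrier G"
      using object_subset[OF Smh(2) xS] .
    have kx: "k <# x = x" if "k \<in> H" for k
      using base_act_fixes_iff[of S m h M k] b that HG unfolding Smh(1) x_def by blast
    \<comment> \<open>The choice of a representative is harmless: \<open>H\<close> fixes
      \<open>x\<close>, so the translate of \<open>x\<close> depends only on the coset.\<close>
    define h' where "h' = (\<lambda>c\<in>lcosets H. (SOME g. g \<in> c) <# x)"
    have h': "h' (a <# H) = a <# x" if a: "a \<in> carrier G" for a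
    proof -
      have "(SOME g. g \<in> a <# H) \<in> a <# H"
        using lcos_self[OF a sub] by (rule someI)
      then obtain k where k: "k \<in> H" "(SOME g. g \<in> a <# H) = a \<otimes> k"
        by (auto simp: l_coset_def)
      have "(a \<otimes> k) <# x = a <# (k <# x)"
        using lcos_m_assoc[OF xG a HG[OF k(1)]] by simp
      then show ?thesis
        using a k kx[OF k(1)] by (auto simp: h'_def LCOSETS_def)
    qed
    have h'_hom: "h' \<in> orbit_hom G (lcosets H) S"
      unfolding orbit_hom_def
    proof (intro CollectI conjI ballI)
      show "h' \<in> lcosets H \<rightarrow>\<^sub>E S"
      proof (rule PiE_I)
        fix c assume "c \<in> lcosets H"
        then obtain a where "a \<in> carrier G" "c = a <# H"
          by (auto simp: LCOSETS_def)
        then show "h' c \<in> S"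
          using h' orbit_object_act[OF Smh(2) _ xS] by simp
      qed (simp add: h'_def)
      fix g c assume g: "g \<in> carrier G" and "c \<in> lcosets H"
      then obtain a where a: "a \<in> carrier G" "c = a <# H"
        by (auto simp: LCOSETS_def)
      have "g <# c = (g \<otimes> a) <# H"
        using lcos_m_assoc[OF subgroup.subset[OF sub] g a(1)] a(2) by simp
      then show "h' (g <# c) = g <# h' c"
        using h' a g lcos_m_assoc[OF xG g a(1)] by simp
    qed
    have "compose base h' (quotient_map H) = h"
    proof (rule base_hom_eqI[OF orbit_hom_compose[OF base_object q h'_hom] Smh(4)])
      show "compose base h' (quotient_map H) {\<one>} = h {\<one>}"
        using h'[OF one_closed] lcos_mult_one[OF xG] one_base
        by (simp add: compose_def quotient_map_apply x_def)
    qed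
    then have "b = precompose base (quotient_map H) ((S, m), h')"
      by (simp add: Smh(1) precompose_def)
    moreover have "((S, m), h') \<in> free_basis G M (lcosets H)"
      using Smh h'_hom by (simp add: free_basis_def)
    ultimately show "b \<in> precompose base (quotient_map H) ` free_basis G M (lcosets H)"
      by blast
  qed
qed

text \<open>With \<open>P0\<close> and \<open>P1\<close> written as retracts of free modules, the
  boundary \<open>i0 d q1\<close> and the augmentation \<open>\<epsilon> q0\<close> are defined on
  the whole free modules, and their composite is \<open>\<epsilon> d q1 = 0\<close>. Injectivity and
  exactness are claimed on the summands, which appear as the fixed elements of the idempotents
  \<open>R0 = i0 q0\<close> and \<open>R1 = i1 q1\<close>.\<close>

lemma bredon_complex_of_resolution:
  fixes P0 P1 :: "('a, 'a list + 'm) orbit_functor"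
  assumes P0: "projective_module G P0" and P1: "projective_module G P1"
    and d: "d \<in> module_hom G P1 P0" and eps: "\<epsilon> \<in> module_epi G P0 constant_Z"
    and ex: "exact_at G P1 d P0 \<epsilon> constant_Z"
    and inj: "\<And>T x. T \<in> orbit_objects G \<Longrightarrow> x \<in> carrier (val P1 T) \<Longrightarrow> d T x = \<one>\<^bsub>val P0 T\<^esub> \<Longrightarrow> x = \<one>\<^bsub>val P1 T\<^esub>"
  shows "\<exists>D E M0 M1. bredon_complex G (free_basis G P0 base) base_act (free_basis G P1 base) base_act D E M0 M1"
proof -
  let ?B0 = "free_basis G P0" and ?B1 = "free_basis G P1"
  let ?F0 = "\<lambda>T. free_Abelian_group (?B0 T)" and ?F1 = "\<lambda>T. free_Abelian_group (?B1 T)"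
  have rm0: "right_module G P0" and rm1: "right_module G P1"
    using P0 P1 by (auto simp: projective_module_def)
  obtain i0 q0 where i0: "i0 \<in> module_hom G P0 (free_module G P0)" and q0: "q0 \<in> module_hom G (free_module G P0) P0"
    and qi0: "\<And>T x. T \<in> orbit_objects G \<Longrightarrow> x \<in> carrier (val P0 T) \<Longrightarrow> q0 T (i0 T x) = x"
    using projective_retract[OF P0] by blast
  obtain i1 q1 where i1: "i1 \<in> module_hom G P1 (free_module G P1)" and q1: "q1 \<in> module_hom G (free_module G P1) P1"
    and qi1: "\<And>T x. T \<in> orbit_objects G \<Longrightarrow> x \<in> carrier (val P1 T) \<Longrightarrow> q1 T (i1 T x) = x"
    using projective_retract[OF P1] by blast
  have eps': "\<epsilon> \<in> module_hom G P0 constant_Z"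
    using eps by (simp add: module_epi_def)
  note closed = module_hom_closed[OF i0, simplified] module_hom_closed[OF q0, simplified]
    module_hom_closed[OF i1, simplified] module_hom_closed[OF q1, simplified] module_hom_closed[OF d]
  note nat = module_hom_natural[OF i0, simplified] module_hom_natural[OF q0, simplified]
    module_hom_natural[OF i1, simplified] module_hom_natural[OF q1, simplified] module_hom_natural[OF d]
  have eps_nat: "\<epsilon> S (res P0 S T f x) = \<epsilon> T x"
    if "S \<in> orbit_objects G" "T \<in> orbit_objects G" "f \<in> orbit_hom G S T" "x \<in> carrier (val P0 T)" for S T f x
    using module_hom_natural[OF eps' that] by (simp add: constant_Z_def)
  note b = base_object
  have eps_d: "\<epsilon> T (d T x) = 0" if "T \<in> orbit_objects G" "x \<in> carrier (val P1 T)" for T x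
  proof -
    have "d T x \<in> kernel (val P0 T) (val constant_Z T) (\<epsilon> T)"
      using ex that unfolding exact_at_def by blast
    then show ?thesis
      by (simp add: kernel_def constant_Z_def)
  qed
  have ker_eps: "\<exists>y\<in>carrier (val P1 T). d T y = x"
    if "T \<in> orbit_objects G" "x \<in> carrier (val P0 T)" "\<epsilon> T x = 0" for T x
  proof -
    have "x \<in> kernel (val P0 T) (val constant_Z T) (\<epsilon> T)"
      using that by (simp add: kernel_def constant_Z_def)
    then have "x \<in> d T ` carrier (val P1 T)"
      using ex that(1) unfolding exact_at_def by simp
    then show ?thesis by blast
  qed
  have surj_eps: "\<exists>x\<in>carrier (val P0 T). \<epsilon> T x = 1" if T: "T \<in> orbit_objects G" for T
  proof -
    have "\<epsilon> T ` carrier (val P0 T) = UNIV"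
      using eps T by (simp add: module_epi_def constant_Z_def)
    then show ?thesis by (metis UNIV_I imageE)
  qed
  define D' where "D' T = i0 T \<circ> (d T \<circ> q1 T)" for T
  define R0 where "R0 = i0 base \<circ> q0 base"
  define R1 where "R1 = i1 base \<circ> q1 base"
  define E where "E = \<epsilon> base \<circ> q0 base"
  have D'_hom: "D' T \<in> hom (?F1 T) (?F0 T)" if "T \<in> orbit_objects G" for T
    unfolding D'_def
    using Group.hom_compose[OF Group.hom_compose[OF module_hom_hom[OF q1 that] module_hom_hom[OF d that]]
        module_hom_hom[OF i0 that]] by (simp add: comp_assoc)
  have R0_hom: "R0 \<in> hom (?F0 base) (?F0 base)"
    unfolding R0_def using Group.hom_compose[OF module_hom_hom[OF q0 b] module_hom_hom[OF i0 b]] by simp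
  have R1_hom: "R1 \<in> hom (?F1 base) (?F1 base)"
    unfolding R1_def using Group.hom_compose[OF module_hom_hom[OF q1 b] module_hom_hom[OF i1 b]] by simp
  have E_hom: "E \<in> hom (?F0 base) integer_group"
    unfolding E_def using Group.hom_compose[OF module_hom_hom[OF q0 b] module_hom_hom[OF eps' b]]
    by (simp add: constant_Z_def)
  define D where "D y = D' base (frag_of y)" for y
  have DD: "frag_extend D c = D' base c" if "Poly_Mapping.keys c \<subseteq> ?B1 base" for c
  proof (rule free_Abelian_group_hom_eq[OF group_free_Abelian_group _ D'_hom[OF b] _ that])
    show "frag_extend D \<in> hom (?F1 base) (?F0 base)"
    proof (rule homI)
      fix c assume "c \<in> carrier (?F1 base)"
      then have "Poly_Mapping.keys (D y) \<subseteq> ?B0 base" if "y \<in> Poly_Mapping.keys c" for y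
        using that hom_in_carrier[OF D'_hom[OF b], of "frag_of y"] unfolding D_def by auto
      then show "frag_extend D c \<in> carrier (?F0 base)"
        using keys_frag_extend[of D c] by (simp, blast)
    qed (simp add: frag_extend_add)
  qed (simp add: D_def)
  have D'_nat: "D' S (frag_map (precompose S f) c) = frag_map (precompose S f) (D' T c)"
    if "S \<in> orbit_objects G" "T \<in> orbit_objects G" "f \<in> orbit_hom G S T" "Poly_Mapping.keys c \<subseteq> ?B1 T" for S T f c
    using that closed by (simp add: D'_def nat)
  note rho = right_mult_hom
  interpret V: VC_set G "?B0 base" base_act
    by (rule base_VC_set)
  interpret W: VC_set G "?B1 base" base_act
    by (rule base_VC_set)
  have Vfix: "V.fixed H = precompose base (quotient_map H) ` ?B0 (lcosets H)"
    and Wfix: "W.fixed H = precompose base (quotient_map H) ` ?B1 (lcosets H)" if "H \<in> VC G" for H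
    unfolding V.fixed_def W.fixed_def using base_fixed_eq[OF that] by simp_all
  have "bredon_complex G (?B0 base) base_act (?B1 base) base_act D E
      {c. Poly_Mapping.keys c \<subseteq> ?B0 base \<and> R0 c = c} {c. Poly_Mapping.keys c \<subseteq> ?B1 base \<and> R1 c = c}"
  proof unfold_locales
    fix y assume y: "y \<in> ?B1 base"
    have st: "W.stab y \<in> VC G"
      using W.stab_in_VC[OF y] .
    \<comment> \<open>\<open>y\<close> is pulled back from the orbit of its own stabiliser, so by
      naturality \<open>D y\<close> is pulled back from there too, and its support is fixed by that
      stabiliser.\<close>
    have "y \<in> W.fixed (W.stab y)"
      using y by (simp add: W.fixed_def W.stab_def)
    then obtain z where z: "z \<in> ?B1 (lcosets (W.stab y))" "y = precompose base (quotient_map (W.stab y)) z"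
      using Wfix[OF st] by blast
    have "D y = frag_map (precompose base (quotient_map (W.stab y))) (D' (lcosets (W.stab y)) (frag_of z))"
      using D'_nat[OF b VC_object[OF st] quotient_map_hom[OF st], of "frag_of z"] z by (simp add: D_def)
    moreover have "Poly_Mapping.keys (D' (lcosets (W.stab y)) (frag_of z)) \<subseteq> ?B0 (lcosets (W.stab y))"
      using hom_in_carrier[OF D'_hom[OF VC_object[OF st]], of "frag_of z"] z(1) by simp
    ultimately show "Poly_Mapping.keys (D y) \<subseteq> V.fixed (W.stab y)"
      unfolding Vfix[OF st] by (simp add: keys_frag_map_subset)
    show "D (base_act g y) = frag_map (base_act g) (D y)" if "g \<in> carrier G" for g
      using D'_nat[OF b b rho[OF that], of "frag_of y"] y by (simp add: D_def base_act_def)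
  next
    fix a c :: "(('a set set \<times> ('a list + 'm)) \<times> ('a set \<Rightarrow> 'a set)) \<Rightarrow>\<^sub>0 int"
    assume ac: "Poly_Mapping.keys a \<subseteq> ?B0 base" "Poly_Mapping.keys c \<subseteq> ?B0 base"
    then have "Poly_Mapping.keys (a - c) \<subseteq> ?B0 base"
      using keys_diff[of a c] by blast
    then have "E ((a - c) + c) = E (a - c) + E c"
      using hom_mult[OF E_hom, of "a - c" c] ac by simp
    then show "E (a - c) = E a - E c"
      by simp
  next
    fix g and a :: "(('a set set \<times> ('a list + 'm)) \<times> ('a set \<Rightarrow> 'a set)) \<Rightarrow>\<^sub>0 int"
    assume "g \<in> carrier G" "Poly_Mapping.keys a \<subseteq> ?B0 base"
    then show "E (frag_map (base_act g) a) = E a"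
      using b rho closed(2)[OF b] by (simp add: E_def base_act_def nat eps_nat)
  next
    fix c :: "(('a set set \<times> ('a list + 'm)) \<times> ('a set \<Rightarrow> 'a set)) \<Rightarrow>\<^sub>0 int"
    assume c: "Poly_Mapping.keys c \<subseteq> ?B1 base"
    then show "E (frag_extend D c) = 0"
      unfolding DD[OF c] using b closed by (simp add: E_def D'_def qi0 eps_d)
  next
    fix a c assume "a \<in> {c. Poly_Mapping.keys c \<subseteq> ?B0 base \<and> R0 c = c}" "c \<in> {c. Poly_Mapping.keys c \<subseteq> ?B0 base \<and> R0 c = c}"
    then show "a - c \<in> {c. Poly_Mapping.keys c \<subseteq> ?B0 base \<and> R0 c = c}"
      using keys_diff[of a c] hom_frag_diff[OF R0_hom] by auto
  next
    fix a c assume "a \<in> {c. Poly_Mapping.keys c \<subseteq> ?B1 base \<and> R1 c = c}" "c \<in> {c. Poly_Mapping.keys c \<subseteq> ?B1 base \<and> R1 c = c}"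
    then show "a - c \<in> {c. Poly_Mapping.keys c \<subseteq> ?B1 base \<and> R1 c = c}"
      using keys_diff[of a c] hom_frag_diff[OF R1_hom] by auto
  next
    fix g a assume ga: "g \<in> carrier G" "a \<in> {c. Poly_Mapping.keys c \<subseteq> ?B0 base \<and> R0 c = c}"
    then have "R0 (frag_map (base_act g) a) = frag_map (base_act g) (R0 a)"
      using b rho closed by (simp add: R0_def base_act_def nat)
    then show "frag_map (base_act g) a \<in> {c. Poly_Mapping.keys c \<subseteq> ?B0 base \<and> R0 c = c}"
      using ga V.keys_act by simp
  next
    fix g a assume ga: "g \<in> carrier G" "a \<in> {c. Poly_Mapping.keys c \<subseteq> ?B1 base \<and> R1 c = c}"
    then have "R1 (frag_map (base_act g) a) = frag_map (base_act g) (R1 a)"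
      using b rho closed by (simp add: R1_def base_act_def nat)
    then show "frag_map (base_act g) a \<in> {c. Poly_Mapping.keys c \<subseteq> ?B1 base \<and> R1 c = c}"
      using ga W.keys_act by simp
  next
    fix a assume a: "a \<in> {c. Poly_Mapping.keys c \<subseteq> ?B1 base \<and> R1 c = c}" "frag_extend D a = 0"
    then have aB: "Poly_Mapping.keys a \<subseteq> ?B1 base" and "R1 a = a" by auto
    have q1a: "q1 base a \<in> carrier (val P1 base)"
      using closed(4)[OF b aB] .
    have "i0 base (d base (q1 base a)) = 0"
      using a(2) DD[OF aB] by (simp add: D'_def)
    then have "d base (q1 base a) = q0 base 0"
      using qi0[OF b closed(5)[OF b q1a]] by simp
    also have "\<dots> = \<one>\<^bsub>val P0 base\<^esub>"
      using hom_one[OF module_hom_hom[OF q0 b]] right_module_group[OF rm0 b] by simp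
    finally have "q1 base a = \<one>\<^bsub>val P1 base\<^esub>"
      using inj[OF b q1a] by simp
    then show "a = 0"
      using \<open>R1 a = a\<close> hom_one[OF module_hom_hom[OF i1 b]] right_module_group[OF rm1 b] by (simp add: R1_def)
  next
    fix H assume H: "H \<in> VC G"
    let ?T = "lcosets H" and ?p = "quotient_map H"
    have T: "?T \<in> orbit_objects G" and p: "?p \<in> orbit_hom G base ?T"
      using VC_object[OF H] quotient_map_hom[OF H] by auto
    \<comment> \<open>An element of augmentation one over the orbit of \<open>H\<close>, restricted
      to \<open>base\<close>, is supported on \<open>H\<close>-fixed points and keeps its
      augmentation.\<close>
    obtain x where x: "x \<in> carrier (val P0 ?T)" "\<epsilon> ?T x = 1"
      using surj_eps[OF T] by blast
    let ?x = "res P0 base ?T ?p x"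
    have xb: "?x \<in> carrier (val P0 base)"
      using right_module_closed[OF rm0 b T p x(1)] .
    have "i0 base ?x = frag_map (precompose base ?p) (i0 ?T x)"
      using nat(1)[OF b T p x(1)] .
    then have "Poly_Mapping.keys (i0 base ?x) \<subseteq> V.fixed H"
      unfolding Vfix[OF H] using closed(1)[OF T x(1)] by (simp add: keys_frag_map_subset)
    moreover have "E (i0 base ?x) = 1"
      using qi0[OF b xb] eps_nat[OF b T p x(1)] x(2) by (simp add: E_def)
    moreover have "R0 (i0 base ?x) = i0 base ?x"
      using qi0[OF b xb] by (simp add: R0_def)
    ultimately show "\<exists>v\<in>{c. Poly_Mapping.keys c \<subseteq> ?B0 base \<and> R0 c = c}. Poly_Mapping.keys v \<subseteq> V.fixed H \<and> E v = 1"
      using closed(1)[OF b xb] by blast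
  next
    fix H v assume H: "H \<in> VC G" and v: "v \<in> {c. Poly_Mapping.keys c \<subseteq> ?B0 base \<and> R0 c = c}"
      "Poly_Mapping.keys v \<subseteq> V.fixed H" "E v = 0"
    let ?T = "lcosets H" and ?p = "quotient_map H"
    have T: "?T \<in> orbit_objects G" and p: "?p \<in> orbit_hom G base ?T"
      using VC_object[OF H] quotient_map_hom[OF H] by auto
    \<comment> \<open>The lift \<open>z\<close> of \<open>v\<close> to the orbit of \<open>H\<close>
      may lie outside the summand, but \<open>q0\<close> sends it to an element of \<open>P0\<close>
      with augmentation zero, and exactness at that orbit applies.\<close>
    obtain z where z: "Poly_Mapping.keys z \<subseteq> ?B0 ?T" "frag_map (precompose base ?p) z = v"
      using frag_map_lift v(2) unfolding Vfix[OF H] by blast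
    have q0z: "q0 ?T z \<in> carrier (val P0 ?T)"
      using closed(2)[OF T z(1)] .
    have q0v: "q0 base v = res P0 base ?T ?p (q0 ?T z)"
      using nat(2)[OF b T p z(1)] z(2) by simp
    have "\<epsilon> ?T (q0 ?T z) = 0"
      using eps_nat[OF b T p q0z] q0v v(3) by (simp add: E_def)
    then obtain x where x: "x \<in> carrier (val P1 ?T)" "d ?T x = q0 ?T z"
      using ker_eps[OF T q0z] by blast
    let ?x = "res P1 base ?T ?p x"
    have xb: "?x \<in> carrier (val P1 base)"
      using right_module_closed[OF rm1 b T p x(1)] .
    have i1x: "i1 base ?x = frag_map (precompose base ?p) (i1 ?T x)"
      using nat(3)[OF b T p x(1)] .
    then have "Poly_Mapping.keys (i1 base ?x) \<subseteq> W.fixed H"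
      unfolding Wfix[OF H] using closed(3)[OF T x(1)] by (simp add: keys_frag_map_subset)
    moreover have "frag_extend D (i1 base ?x) = v"
    proof -
      have "d base ?x = q0 base v"
        using nat(5)[OF b T p x(1)] x(2) q0v by simp
      then show ?thesis
        using DD[OF closed(3)[OF b xb]] qi1[OF b xb] v(1) by (simp add: D'_def R0_def)
    qed
    moreover have "R1 (i1 base ?x) = i1 base ?x"
      using qi1[OF b xb] by (simp add: R1_def)
    ultimately show "\<exists>e\<in>{c. Poly_Mapping.keys c \<subseteq> ?B1 base \<and> R1 c = c}. Poly_Mapping.keys e \<subseteq> W.fixed H \<and> frag_extend D e = v"
      using closed(3)[OF b xb] by blast
  qed auto
  then show ?thesis
    by blast
qed

end

section \<open>Resolutions of length at most one\<close>

lemma enat_Inf_in: "A \<noteq> {} \<Longrightarrow> Inf A \<in> (A :: enat set)"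
  unfolding Inf_enat_def using LeastI[of "\<lambda>x. x \<in> A"] by auto

theorem mainTheorem1:
  fixes G :: "('g, 'x) monoid_scheme"
  assumes "group G"
    and "vc_cd TYPE('m) G \<le> 1"
  shows "locally_virtually_cyclic G"
proof -
  interpret group G by fact
  let ?A = "{enat n | n. \<exists>(P :: nat \<Rightarrow> ('g, 'g list + 'm) orbit_functor) d \<epsilon>.
       projective_resolution G P d \<epsilon> \<and> (\<forall>i>n. zero_module G (P i))}"
  have le: "Inf ?A \<le> 1"
    using assms(2) unfolding vc_cd_def .
  have ne: "?A \<noteq> {}"
  proof
    \<comment> \<open>The infimum of the empty set is infinite.\<close>
    assume "?A = {}"
    then show False
      using le by (simp only: Inf_enat_def) (simp add: one_enat_def)
  qed
  then have "Inf ?A \<in> ?A"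
    by (rule enat_Inf_in)
  then obtain n and P :: "nat \<Rightarrow> ('g, 'g list + 'm) orbit_functor" and d \<epsilon> where
    n: "enat n \<le> 1" and res: "projective_resolution G P d \<epsilon>" and zero: "\<And>i. i > n \<Longrightarrow> zero_module G (P i)"
    using le by force
  have "zero_module G (P 2)"
    using zero n by (simp add: one_enat_def)
  have proj: "projective_module G (P i)" for i
    using res by (simp add: projective_resolution_def)
  have dhom: "d i \<in> module_hom G (P (Suc i)) (P i)" for i
    using res by (simp add: projective_resolution_def)
  have eps: "\<epsilon> \<in> module_epi G (P 0) constant_Z" and ex0: "exact_at G (P 1) (d 0) (P 0) \<epsilon> constant_Z"
    and ex1: "exact_at G (P (Suc (Suc 0))) (d (Suc 0)) (P (Suc 0)) (d 0) (P 0)"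
    using res by (simp_all add: projective_resolution_def)
  \<comment> \<open>\<open>P 2\<close> vanishes, so exactness at \<open>P 1\<close> says that
    \<open>d 0\<close> has trivial kernel.\<close>
  have inj: "x = \<one>\<^bsub>val (P 1) T\<^esub>"
    if T: "T \<in> orbit_objects G" and x: "x \<in> carrier (val (P 1) T)" "d 0 T x = \<one>\<^bsub>val (P 0) T\<^esub>" for T x
  proof -
    have triv: "trivial_group (val (P 2) T)"
      using \<open>zero_module G (P 2)\<close> T by (simp add: zero_module_def)
    have "x \<in> d 1 T ` carrier (val (P 2) T)"
      using ex1 T x by (auto simp: exact_at_def kernel_def numeral_2_eq_2)
    then have "x = d 1 T \<one>\<^bsub>val (P 2) T\<^esub>"
      using triv by (auto simp: trivial_group_def)
    moreover have "d 1 T \<in> hom (val (P 2) T) (val (P 1) T)"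
      using module_hom_hom[OF dhom[of 1] T] by (simp add: numeral_2_eq_2)
    moreover have "group (val (P 1) T)"
      using right_module_group[OF _ T] proj by (auto simp: projective_module_def)
    ultimately show ?thesis
      using hom_one triv by (metis trivial_group_def)
  qed
  have d0: "d 0 \<in> module_hom G (P 1) (P 0)"
    using dhom[of 0] by simp
  obtain D E M0 M1 where
    "bredon_complex G (free_basis G (P 0) base) base_act (free_basis G (P 1) base) base_act D E M0 M1"
    using bredon_complex_of_resolution[OF proj proj d0 eps ex0 inj] by blast
  then interpret bredon_complex G "free_basis G (P 0) base" base_act "free_basis G (P 1) base" base_act D E M0 M1 .
  have "virtually_cyclic (G\<lparr>carrier := H\<rparr>)" if H: "finitely_generated_subgroup H G" for H
  proof -
    obtain A where "finite A" "A \<subseteq> carrier G" "H = generate G A"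
      using H unfolding finitely_generated_subgroup_def by blast
    then have "H \<in> VC G"
      using finitely_generated_subgroups_VC by blast
    then show ?thesis
      by (simp add: VC_def)
  qed
  then show ?thesis
    by (simp add: locally_virtually_cyclic_def)
qed

end
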